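(* Let $M$ be an oriented (connected) non-maximal space-like surface in the Minkowski space $\mathbb E^4_1$. Then $M$ has (global) 1-type Gauss map of the first kind if and only if $M$ has parallel mean curvature vector and constant Gaussian curvature.
   Context: $\mathbb E^4_1$ is $\mathbb R^4$ with the metric $-dx_1^2+dx_2^2+dx_3^2+dx_4^2$. A surface $M$ is space-like if every nonzero tangent vector $v$ satisfies $\langle v,v\rangle>0$. The second fundamental form $h$ and normal connection $D$ are defined by $\widetilde\nabla_XY=\nabla_XY+h(X,Y)$ and $\widetilde\nabla_X\xi=-A_\xi(X)+D_X\xi$, for $X,Y$ tangent and $\xi$ normal. The mean curvature vector is $H=\frac12(h(e_1,e_1)+h(e_2,e_2))$ for an orthonormal tangent frame. $M$ is maximal if $H=0$ identically, non-maximal otherwise; $H$ is parallel if $DH=0$ identically. The Gauss map is $\nu=e_3\wedge e_4:M\to\bigwedge^2\mathbb E^4_1$, where $\{e_1,e_2,e_3,e_4\}$ is an oriented local orthonormal frame with $e_1,e_2$ tangent and $e_3,e_4$ normal to $M$; $\bigwedge^2\mathbb E^4_1$ is identified with a pseudo-Euclidean space via $\langle f_1\wedge f_2,g_1\wedge g_2\rangle=\det(\langle f_i,g_j\rangle)$. The Laplacian $\Delta=\sum_{i=1}^2(\nabla_{e_i}e_i-e_ie_i)$ of $M$ acts componentwise on $\nu$. $M$ has (global) 1-type Gauss map of the first kind if $\Delta\nu=\lambda\nu$ for some constant $\lambda\in\mathbb R$ ($\lambda=0$ allowed). *)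

theory Defs
  imports "HOL-Analysis.Analysis"
begin

section \<open>Smooth maps on open subsets of Euclidean space\<close>

text \<open>Only meant for open \<open>S\<close>.\<close>

primrec Ck_on :: "nat \<Rightarrow> 'a::euclidean_space set \<Rightarrow> ('a \<Rightarrow> 'b::real_normed_vector) \<Rightarrow> bool" where
  "Ck_on 0 S f \<longleftrightarrow> continuous_on S f"
| "Ck_on (Suc k) S f \<longleftrightarrow> (\<forall>u\<in>S. f differentiable (at u)) \<and>
     (\<forall>w. Ck_on k S (\<lambda>u. frechet_derivative f (at u) w))"

definition smooth_on :: "'a::euclidean_space set \<Rightarrow> ('a \<Rightarrow> 'b::real_normed_vector) \<Rightarrow> bool" where
  "smooth_on S f \<longleftrightarrow> (\<forall>k. Ck_on k S f)"


section \<open>Minkowski space and its bivectors\<close>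

definition lorentz :: "real^4 \<Rightarrow> real^4 \<Rightarrow> real" where
  "lorentz v w = - (v$1 * w$1) + v$2 * w$2 + v$3 * w$3 + v$4 * w$4"

text \<open>The second exterior power of \<open>\<real>\<^sup>4\<close> is realised as the space of skew-symmetric
  \<open>4 \<times> 4\<close> matrices: the entry \<open>(i, j)\<close>, \<open>i < j\<close>, is the coordinate with respect to the
  basis bivector \<open>b\<^sub>i \<and> b\<^sub>j\<close>, where \<open>b\<^sub>1, \<dots>, b\<^sub>4\<close> is the standard basis.\<close>

definition wedge :: "real^4 \<Rightarrow> real^4 \<Rightarrow> real^4^4" where
  "wedge v w = (\<chi> i j. v$i * w$j - v$j * w$i)"


section \<open>Oriented surfaces\<close>

type_synonym 'a chart = "'a set \<times> ('a \<Rightarrow> real^2)"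

definition chart_rep :: "'a chart \<Rightarrow> ('a \<Rightarrow> 'b) \<Rightarrow> real^2 \<Rightarrow> 'b" where
  "chart_rep c f = f \<circ> inv_into (fst c) (snd c)"

definition chart_diff :: "'a chart \<Rightarrow> ('a \<Rightarrow> 'b::real_normed_vector) \<Rightarrow> 'a \<Rightarrow> real^2 \<Rightarrow> 'b" where
  "chart_diff c f p = frechet_derivative (chart_rep c f) (at (snd c p))"

text \<open>A smooth 2-manifold \<open>X\<close> with an oriented atlas \<open>A\<close> (not required to be maximal).\<close>

locale oriented_surface =
  fixes X :: "'a topology" and A :: "'a chart set"
  assumes Hausdorff: "Hausdorff_space X"
    and second_countable: "second_countable X"
    and chart_open: "c \<in> A \<Longrightarrow> openin X (fst c) \<and> open (snd c ` fst c)"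
    and chart_homeo: "c \<in> A \<Longrightarrow>
          homeomorphic_map (subtopology X (fst c)) (top_of_set (snd c ` fst c)) (snd c)"
    and charts_cover: "(\<Union>c\<in>A. fst c) = topspace X"
    and transition_smooth: "\<lbrakk>c \<in> A; d \<in> A\<rbrakk> \<Longrightarrow>
          smooth_on (snd c ` (fst c \<inter> fst d)) (chart_rep c (snd d))"
    and transition_orientation: "\<lbrakk>c \<in> A; d \<in> A; p \<in> fst c; p \<in> fst d\<rbrakk> \<Longrightarrow>
          0 < det (matrix (chart_diff c (snd d) p))"
begin

definition smooth_map :: "'a set \<Rightarrow> ('a \<Rightarrow> 'b::real_normed_vector) \<Rightarrow> bool" where
  "smooth_map W f \<longleftrightarrow> (\<forall>c\<in>A. smooth_on (snd c ` (fst c \<inter> W)) (chart_rep c f))"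

definition chart_at :: "'a \<Rightarrow> 'a chart" where
  "chart_at p = (SOME c. c \<in> A \<and> p \<in> fst c)"

end


section \<open>Space-like surfaces in Minkowski space\<close>

text \<open>The surface is immersed by \<open>x\<close>.\<close>

locale spacelike_surface = oriented_surface X A
  for X :: "'a topology" and A :: "'a chart set" +
  fixes x :: "'a \<Rightarrow> real^4"
  assumes x_smooth: "smooth_map (topspace X) x"
    and immersion: "\<lbrakk>c \<in> A; p \<in> fst c\<rbrakk> \<Longrightarrow> inj (chart_diff c x p)"
    and spacelike: "\<lbrakk>c \<in> A; p \<in> fst c; v \<in> range (chart_diff c x p); v \<noteq> 0\<rbrakk> \<Longrightarrow>
          0 < lorentz v v"
begin

text \<open>Tangent vectors at \<open>p\<close> are identified with their images under the differential of \<open>x\<close>,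
  so that tangent and normal fields are functions with values in \<open>\<real>\<^sup>4\<close>. The notions below that
  refer to \<open>chart_at p\<close> do not depend on the choice of the chart around \<open>p\<close>.\<close>

definition tangent_space :: "'a \<Rightarrow> (real^4) set" where
  "tangent_space p = range (chart_diff (chart_at p) x p)"

definition normal_space :: "'a \<Rightarrow> (real^4) set" where
  "normal_space p = {\<xi>. \<forall>v\<in>tangent_space p. lorentz \<xi> v = 0}"

definition tangent_coords :: "'a \<Rightarrow> real^4 \<Rightarrow> real^2" where
  "tangent_coords p v = (THE w. chart_diff (chart_at p) x p w = v)"

definition tan_part :: "'a \<Rightarrow> real^4 \<Rightarrow> real^4" where
  "tan_part p V = (THE v. v \<in> tangent_space p \<and> V - v \<in> normal_space p)"

definition nor_part :: "'a \<Rightarrow> real^4 \<Rightarrow> real^4" where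
  "nor_part p V = V - tan_part p V"

text \<open>The derivative at \<open>p\<close> of a vector-valued function along a tangent vector \<open>v\<close>; for
  functions with values in \<open>\<real>\<^sup>4\<close> this is the flat connection of the ambient space.\<close>

definition deriv_along :: "'a \<Rightarrow> real^4 \<Rightarrow> ('a \<Rightarrow> 'b::real_normed_vector) \<Rightarrow> 'b" where
  "deriv_along p v f = chart_diff (chart_at p) f p (tangent_coords p v)"

text \<open>The Gauss and Weingarten formulas: Levi-Civita connection, second fundamental form and
  normal connection.\<close>

definition nabla :: "('a \<Rightarrow> real^4) \<Rightarrow> ('a \<Rightarrow> real^4) \<Rightarrow> 'a \<Rightarrow> real^4" where
  "nabla Y Z p = tan_part p (deriv_along p (Y p) Z)"

definition second_ff :: "('a \<Rightarrow> real^4) \<Rightarrow> ('a \<Rightarrow> real^4) \<Rightarrow> 'a \<Rightarrow> real^4" where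
  "second_ff Y Z p = nor_part p (deriv_along p (Y p) Z)"

definition normal_conn :: "'a \<Rightarrow> real^4 \<Rightarrow> ('a \<Rightarrow> real^4) \<Rightarrow> real^4" where
  "normal_conn p v \<xi> = nor_part p (deriv_along p v \<xi>)"

text \<open>The Lie bracket, as a field of ambient vectors.\<close>

definition bracket :: "('a \<Rightarrow> real^4) \<Rightarrow> ('a \<Rightarrow> real^4) \<Rightarrow> 'a \<Rightarrow> real^4" where
  "bracket Y Z p = deriv_along p (Y p) Z - deriv_along p (Z p) Y"

definition curvature ::
  "('a \<Rightarrow> real^4) \<Rightarrow> ('a \<Rightarrow> real^4) \<Rightarrow> ('a \<Rightarrow> real^4) \<Rightarrow> 'a \<Rightarrow> real^4" where
  "curvature Y Z V p = nabla Y (nabla Z V) p - nabla Z (nabla Y V) p - nabla (bracket Y Z) V p"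

definition tangent_frame :: "'a set \<Rightarrow> ('a \<Rightarrow> real^4) \<Rightarrow> ('a \<Rightarrow> real^4) \<Rightarrow> bool" where
  "tangent_frame W e1 e2 \<longleftrightarrow> openin X W \<and> smooth_map W e1 \<and> smooth_map W e2 \<and>
     (\<forall>p\<in>W. e1 p \<in> tangent_space p \<and> e2 p \<in> tangent_space p \<and>
        lorentz (e1 p) (e1 p) = 1 \<and> lorentz (e2 p) (e2 p) = 1 \<and> lorentz (e1 p) (e2 p) = 0)"

text \<open>Orthonormality of \<open>e3, e4\<close> is meant in the indefinite sense. An oriented frame
  is one where \<open>e1, e2\<close> is positive for the orientation of the surface and \<open>e1, e2, e3, e4\<close>
  is positive for the standard orientation of \<open>\<real>\<^sup>4\<close>.\<close>

definition oriented_adapted_frame ::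
  "'a set \<Rightarrow> ('a \<Rightarrow> real^4) \<Rightarrow> ('a \<Rightarrow> real^4) \<Rightarrow> ('a \<Rightarrow> real^4) \<Rightarrow> ('a \<Rightarrow> real^4) \<Rightarrow> bool" where
  "oriented_adapted_frame W e1 e2 e3 e4 \<longleftrightarrow> tangent_frame W e1 e2 \<and>
     smooth_map W e3 \<and> smooth_map W e4 \<and>
     (\<forall>p\<in>W. e3 p \<in> normal_space p \<and> e4 p \<in> normal_space p \<and>
        \<bar>lorentz (e3 p) (e3 p)\<bar> = 1 \<and> \<bar>lorentz (e4 p) (e4 p)\<bar> = 1 \<and> lorentz (e3 p) (e4 p) = 0 \<and>
        0 < det (vector [tangent_coords p (e1 p), tangent_coords p (e2 p)] :: real^2^2) \<and>
        0 < det (vector [e1 p, e2 p, e3 p, e4 p] :: real^4^4))"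

text \<open>The following quantities are computed from a local orthonormal frame around \<open>p\<close>; their
  values do not depend on the choice of the frame.\<close>

definition mean_curvature_vector :: "'a \<Rightarrow> real^4" where
  "mean_curvature_vector p = (SOME H. \<exists>W e1 e2. p \<in> W \<and> tangent_frame W e1 e2 \<and>
     H = (1/2) *\<^sub>R (second_ff e1 e1 p + second_ff e2 e2 p))"

definition gaussian_curvature :: "'a \<Rightarrow> real" where
  "gaussian_curvature p = (SOME K. \<exists>W e1 e2. p \<in> W \<and> tangent_frame W e1 e2 \<and>
     K = lorentz (curvature e1 e2 e2 p) (e1 p))"

definition gauss_map :: "'a \<Rightarrow> real^4^4" where
  "gauss_map p = (SOME \<omega>. \<exists>W e1 e2 e3 e4. p \<in> W \<and> oriented_adapted_frame W e1 e2 e3 e4 \<and>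
     \<omega> = wedge (e3 p) (e4 p))"

definition laplacian :: "('a \<Rightarrow> 'b::real_normed_vector) \<Rightarrow> 'a \<Rightarrow> 'b" where
  "laplacian f p = (SOME L. \<exists>W e1 e2. p \<in> W \<and> tangent_frame W e1 e2 \<and>
     L = (deriv_along p (nabla e1 e1 p) f - deriv_along p (e1 p) (\<lambda>q. deriv_along q (e1 q) f)) +
         (deriv_along p (nabla e2 e2 p) f - deriv_along p (e2 p) (\<lambda>q. deriv_along q (e2 q) f)))"

definition maximal :: bool where
  "maximal \<longleftrightarrow> (\<forall>p\<in>topspace X. mean_curvature_vector p = 0)"

definition parallel_mean_curvature :: bool where
  "parallel_mean_curvature \<longleftrightarrow>
     (\<forall>p\<in>topspace X. \<forall>v\<in>tangent_space p. normal_conn p v mean_curvature_vector = 0)"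

definition constant_gaussian_curvature :: bool where
  "constant_gaussian_curvature \<longleftrightarrow> (\<exists>K. \<forall>p\<in>topspace X. gaussian_curvature p = K)"

definition one_type_gauss_map_first_kind :: bool where
  "one_type_gauss_map_first_kind \<longleftrightarrow>
     (\<exists>a::real. \<forall>p\<in>topspace X. laplacian gauss_map p = a *\<^sub>R gauss_map p)"

end

end

theory Submission
  imports Defs
begin

text \<open>Since \<open>\<nu> = \<star>(e\<^sub>1 \<and> e\<^sub>2)\<close> with a constant linear Hodge star, it suffices to compute the Laplacian
  of \<open>T = e\<^sub>1 \<and> e\<^sub>2\<close> in a tangent frame. With \<open>h\<^sub>i\<^sub>j = h(e\<^sub>i, e\<^sub>j)\<close>, the Codazzi equation gives
  \<open>\<Delta>T = |h|\<^sup>2 T - 2 (h\<^sub>1\<^sub>1 - h\<^sub>2\<^sub>2) \<and> h\<^sub>1\<^sub>2 - D\<^sub>1(2H) \<and> e\<^sub>2 - e\<^sub>1 \<and> D\<^sub>2(2H)\<close>, where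
  \<open>(h\<^sub>1\<^sub>1 - h\<^sub>2\<^sub>2) \<and> h\<^sub>1\<^sub>2\<close> is the curvature of the normal bundle. Hence \<open>\<Delta>\<nu> = \<lambda>\<nu>\<close> means that \<open>H\<close> is
  parallel, the normal bundle is flat and \<open>|h|\<^sup>2 = 4\<langle>H, H\<rangle> - 2K\<close> equals \<open>\<lambda>\<close>; for parallel \<open>H\<close> the
  function \<open>\<langle>H, H\<rangle>\<close> is constant. Conversely, a parallel \<open>H\<close> that is not identically zero vanishes
  nowhere by uniqueness for linear differential equations, and a nowhere vanishing parallel section
  makes the normal bundle, a plane bundle, flat.\<close>

section \<open>Calculus of smooth maps\<close>

text \<open>The normal plane is Lorentzian, which shapes the converse. A parallel \<open>H\<close>
  has constant \<open>\<langle>H, H\<rangle>\<close>, but a nonzero \<open>H\<close> may be null, so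
  this constancy cannot show that \<open>H\<close> vanishes nowhere; hence a uniqueness argument in
  Euclidean norms, carried out in charts. For the same reason flatness of the normal bundle is not
  read off from an orthonormal normal frame containing \<open>H\<close>, but from a Gram determinant
  that also covers null \<open>H\<close>. Thanks to the Hodge star no normal frame has to be
  differentiated, and the terms of the Laplacian formula lie in independent summands of the
  bivectors (tangent-tangent, normal-normal, mixed), so each can be tested separately. The notions
  are defined by choosing a frame at each point. \<open>H\<close>, \<open>K\<close> and
  \<open>\<nu>\<close> are differentiated or compared at different points and need independence of
  the frame; the Laplacian is only evaluated, so it is computed in whichever frame was chosen. That
  frame may have the wrong orientation, which costs a locally constant sign in front of the
  star.\<close>

lemma frechet_derivative_eqI:
  "(f has_derivative f') (at u) \<Longrightarrow> frechet_derivative f (at u) = f'"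
  by (rule frechet_derivative_at[symmetric])

lemma has_frechet_derivative:
  "f differentiable (at u) \<Longrightarrow> (f has_derivative frechet_derivative f (at u)) (at u)"
  by (simp add: frechet_derivative_works)

text \<open>Differentiability is not assumed: \<open>frechet_derivative\<close> is a choice among
  candidate derivatives, and \<open>f\<close> and \<open>g\<close> have the same candidates at
  \<open>u\<close>.\<close>

lemma frechet_derivative_cong_open:
  assumes "open S" "u \<in> S" "\<And>v. v \<in> S \<Longrightarrow> f v = g v"
  shows "frechet_derivative f (at u) = frechet_derivative g (at u)"
proof -
  have "(f has_derivative D) (at u) \<longleftrightarrow> (g has_derivative D) (at u)" for D
    using has_derivative_transform_within_open[OF _ assms(1,2)] assms(3) by metis
  then show ?thesis by (simp add: frechet_derivative_def)
qed

lemma differentiable_cong_open: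
  assumes "open S" "u \<in> S" "\<And>v. v \<in> S \<Longrightarrow> f v = g v" "f differentiable (at u)"
  shows "g differentiable (at u)"
  using assms has_derivative_transform_within_open unfolding differentiable_def by metis

lemma Ck_on_subset: "Ck_on k S f \<Longrightarrow> T \<subseteq> S \<Longrightarrow> Ck_on k T f"
proof (induction k arbitrary: f)
  case 0 then show ?case by (auto intro: continuous_on_subset)
next
  case (Suc k) then show ?case by auto
qed

lemma Ck_on_cong:
  assumes "open S" "\<And>u. u \<in> S \<Longrightarrow> f u = g u" "Ck_on k S f"
  shows "Ck_on k S g"
  using assms(2,3)
proof (induction k arbitrary: f g)
  case 0 then show ?case using continuous_on_cong[of S S f g] by auto
next
  case (Suc k)
  have "frechet_derivative f (at u) = frechet_derivative g (at u)" if "u \<in> S" for u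
    using frechet_derivative_cong_open[OF assms(1) that, of f g] Suc.prems(1) by blast
  then have "Ck_on k S (\<lambda>u. frechet_derivative g (at u) w)" for w
    using Suc.IH[of "\<lambda>u. frechet_derivative f (at u) w" "\<lambda>u. frechet_derivative g (at u) w"] Suc.prems(2)
    by simp
  then show ?case
    using Suc.prems differentiable_cong_open[OF assms(1)] by (auto; blast)
qed

lemma Ck_on_SucD: "Ck_on (Suc k) S f \<Longrightarrow> Ck_on k S f"
proof (induction k arbitrary: f)
  case 0
  then show ?case
    by (auto intro!: continuous_at_imp_continuous_on differentiable_imp_continuous_within)
next
  case (Suc k)
  from Suc.prems have "Ck_on (Suc k) S (\<lambda>u. frechet_derivative f (at u) w)" for w
    by simp
  then have "Ck_on k S (\<lambda>u. frechet_derivative f (at u) w)" for w by (rule Suc.IH)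
  then show ?case using Suc.prems by simp
qed

text \<open>By uniqueness of the derivative, any explicit formula for it may stand in for
  \<open>frechet_derivative\<close> on the open set; the closure proofs below go through this
  form.\<close>

lemma Ck_on_SucI:
  assumes "open S" "\<And>u. u \<in> S \<Longrightarrow> (f has_derivative f' u) (at u)"
    "\<And>w. Ck_on k S (\<lambda>u. f' u w)"
  shows "Ck_on (Suc k) S f"
proof -
  have eq: "frechet_derivative f (at u) = f' u" if "u \<in> S" for u
    by (rule frechet_derivative_eqI[OF assms(2)[OF that]])
  have "Ck_on k S (\<lambda>u. frechet_derivative f (at u) w)" for w
    by (rule Ck_on_cong[OF assms(1) _ assms(3)[of w]]) (simp add: eq)
  then show ?thesis using assms(2) by (auto simp: differentiable_def)
qed

lemma Ck_on_has_derivative: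
  "Ck_on (Suc k) S f \<Longrightarrow> u \<in> S \<Longrightarrow> (f has_derivative frechet_derivative f (at u)) (at u)"
  by (simp add: has_frechet_derivative)

lemma Ck_on_const [simp]: "Ck_on k S (\<lambda>u. c)"
  by (induction k arbitrary: c) simp_all

lemma Ck_on_add:
  assumes "open S" shows "Ck_on k S f \<Longrightarrow> Ck_on k S g \<Longrightarrow> Ck_on k S (\<lambda>u. f u + g u)"
proof (induction k arbitrary: f g)
  case 0 then show ?case by (auto intro: continuous_intros)
next
  case (Suc k)
  show ?case
  proof (rule Ck_on_SucI[OF assms])
    fix u assume "u \<in> S"
    show "((\<lambda>u. f u + g u) has_derivative
      (\<lambda>w. frechet_derivative f (at u) w + frechet_derivative g (at u) w)) (at u)"
      using Suc.prems \<open>u \<in> S\<close> by (intro has_derivative_add Ck_on_has_derivative)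
  qed (use Suc in auto)
qed

lemma Ck_on_sum:
  assumes "open S" "finite I" "\<And>i. i \<in> I \<Longrightarrow> Ck_on k S (f i)"
  shows "Ck_on k S (\<lambda>u. \<Sum>i\<in>I. f i u)"
  using assms(2,3) by (induction I) (auto intro: Ck_on_add[OF assms(1)])

lemma (in bounded_linear) Ck_on_comp:
  assumes "open S" shows "Ck_on k S g \<Longrightarrow> Ck_on k S (\<lambda>u. f (g u))"
proof (induction k arbitrary: g)
  case 0 then show ?case by (auto intro: continuous_on)
next
  case (Suc k)
  show ?case
  proof (rule Ck_on_SucI[OF assms])
    fix u assume "u \<in> S"
    show "((\<lambda>u. f (g u)) has_derivative (\<lambda>w. f (frechet_derivative g (at u) w))) (at u)"
      using Suc.prems \<open>u \<in> S\<close> by (intro has_derivative Ck_on_has_derivative)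
  qed (use Suc in auto)
qed

lemma (in bounded_bilinear) Ck_on_prod:
  assumes "open S" shows "Ck_on k S f \<Longrightarrow> Ck_on k S g \<Longrightarrow> Ck_on k S (\<lambda>u. prod (f u) (g u))"
proof (induction k arbitrary: f g)
  case 0 then show ?case by (auto intro: continuous_on)
next
  case (Suc k)
  show ?case
  proof (rule Ck_on_SucI[OF assms])
    fix u assume "u \<in> S"
    show "((\<lambda>u. prod (f u) (g u)) has_derivative
      (\<lambda>w. prod (f u) (frechet_derivative g (at u) w) + prod (frechet_derivative f (at u) w) (g u))) (at u)"
      using Suc.prems \<open>u \<in> S\<close> by (intro FDERIV Ck_on_has_derivative)
  next
    fix w
    have "Ck_on k S f" "Ck_on k S g" using Suc.prems Ck_on_SucD by blast+
    then show "Ck_on k S (\<lambda>u. prod (f u) (frechet_derivative g (at u) w) + prod (frechet_derivative f (at u) w) (g u))"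
      using Suc by (intro Ck_on_add[OF assms]) auto
  qed
qed

lemma linear_euclidean_expansion:
  fixes L :: "'a::euclidean_space \<Rightarrow> 'b::real_vector"
  assumes "linear L"
  shows "L w = (\<Sum>b\<in>Basis. (w \<bullet> b) *\<^sub>R L b)"
proof -
  have "L w = L (\<Sum>b\<in>Basis. (w \<bullet> b) *\<^sub>R b)"
    by (simp only: euclidean_representation)
  also have "\<dots> = (\<Sum>b\<in>Basis. (w \<bullet> b) *\<^sub>R L b)"
    by (simp only: linear_sum[OF assms] linear_scale[OF assms])
  finally show ?thesis .
qed

lemmas Ck_on_mult = bounded_bilinear.Ck_on_prod[OF bounded_bilinear_mult]

text \<open>\<open>Ck_on\<close> only sees derivatives in fixed directions, so the chain rule is
  expanded in the basis: the result is a sum of products of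
  \<open>frechet_derivative f (at (g u)) b\<close>, covered by the induction hypothesis, with
  components of the derivative of \<open>g\<close>.\<close>

lemma Ck_on_compose:
  fixes f :: "'b::euclidean_space \<Rightarrow> 'c::real_normed_vector" and g :: "'a::euclidean_space \<Rightarrow> 'b"
  assumes S: "open S"
  shows "Ck_on k R f \<Longrightarrow> Ck_on k S g \<Longrightarrow> g ` S \<subseteq> R \<Longrightarrow> Ck_on k S (\<lambda>u. f (g u))"
proof (induction k arbitrary: f)
  case 0 then show ?case by (auto intro: continuous_on_compose2)
next
  case (Suc k)
  let ?f' = "\<lambda>v. frechet_derivative f (at v)" and ?g' = "\<lambda>u. frechet_derivative g (at u)"
  show ?case
  proof (rule Ck_on_SucI[OF S])
    fix u assume u: "u \<in> S"
    then have gu: "g u \<in> R" using Suc.prems by auto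
    have "(f \<circ> g has_derivative (?f' (g u) \<circ> ?g' u)) (at u)"
      using Suc.prems u gu by (intro diff_chain_at Ck_on_has_derivative)
    moreover have "linear (?f' (g u))"
      using Suc.prems gu by (auto intro: linear_frechet_derivative)
    then have "?f' (g u) (?g' u w) = (\<Sum>b\<in>Basis. (?g' u w \<bullet> b) *\<^sub>R ?f' (g u) b)" for w
      by (rule linear_euclidean_expansion)
    ultimately show "((\<lambda>u. f (g u)) has_derivative
        (\<lambda>w. \<Sum>b\<in>Basis. (?g' u w \<bullet> b) *\<^sub>R ?f' (g u) b)) (at u)"
      by (simp add: o_def)
  next
    fix w
    have g: "Ck_on k S g" using Suc.prems Ck_on_SucD by blast
    have "Ck_on k S (\<lambda>u. ?g' u w)" using Suc.prems by simp
    then have "Ck_on k S (\<lambda>u. ?g' u w \<bullet> b)" for b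
      by (rule bounded_linear.Ck_on_comp[OF bounded_linear_inner_left S])
    moreover have "Ck_on k S (\<lambda>u. ?f' (g u) b)" for b
      using Suc.IH[of "\<lambda>v. ?f' v b"] Suc.prems g by auto
    ultimately show "Ck_on k S (\<lambda>u. \<Sum>b\<in>Basis. (?g' u w \<bullet> b) *\<^sub>R ?f' (g u) b)"
      by (intro Ck_on_sum[OF S] bounded_bilinear.Ck_on_prod[OF bounded_bilinear_scaleR S]) auto
  qed
qed

text \<open>The derivative is a constant multiple of the square of the function, so regularity of
  order \<open>k\<close> passes to order \<open>Suc k\<close> by the product rule.\<close>

lemma Ck_on_inverse: "Ck_on k {0<..} (inverse :: real \<Rightarrow> real)"
proof (induction k)
  case 0 show ?case by (auto intro!: continuous_intros)
next
  case (Suc k)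
  show ?case
  proof (rule Ck_on_SucI)
    fix t :: real assume "t \<in> {0<..}"
    then show "(inverse has_derivative (\<lambda>w. - (inverse t * w * inverse t))) (at t)"
      by (intro has_derivative_inverse') auto
  next
    have "Ck_on k {0<..} (\<lambda>t. (- w) * (inverse t * inverse t))" for w :: real
      by (rule Ck_on_mult[OF _ Ck_on_const Ck_on_mult[OF _ Suc Suc]]) auto
    then show "Ck_on k {0<..} (\<lambda>t. - (inverse t * w * inverse t))" for w :: real
      by (simp add: mult_ac)
  qed auto
qed

lemma Ck_on_inverse_sqrt: "Ck_on k {0<..} (\<lambda>t::real. inverse (sqrt t))"
proof (induction k)
  case 0 show ?case by (auto intro!: continuous_intros)
next
  case (Suc k)
  show ?case
  proof (rule Ck_on_SucI)
    fix t :: real assume "t \<in> {0<..}"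
    then have t: "t > 0" by simp
    have "((\<lambda>t. inverse (sqrt t)) has_real_derivative (-(1/2)) * (inverse t * inverse (sqrt t))) (at t)"
      using t by (auto intro!: derivative_eq_intros simp: field_simps power2_eq_square)
    then show "((\<lambda>t. inverse (sqrt t)) has_derivative (\<lambda>w. (-(1/2)*w) * (inverse t * inverse (sqrt t)))) (at t)"
      unfolding has_field_derivative_def by (rule has_derivative_eq_rhs) (simp add: fun_eq_iff)
  next
    show "Ck_on k {0<..} (\<lambda>t::real. (-(1/2)*w) * (inverse t * inverse (sqrt t)))" for w
      by (rule Ck_on_mult[OF _ Ck_on_const Ck_on_mult[OF _ Ck_on_inverse Suc]]) auto
  qed auto
qed

lemma smooth_on_subset: "smooth_on S f \<Longrightarrow> T \<subseteq> S \<Longrightarrow> smooth_on T f"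
  unfolding smooth_on_def using Ck_on_subset[of _ S f T] by simp

lemma smooth_on_cong: "open S \<Longrightarrow> (\<And>u. u \<in> S \<Longrightarrow> f u = g u) \<Longrightarrow> smooth_on S f \<Longrightarrow> smooth_on S g"
  unfolding smooth_on_def using Ck_on_cong[of S f g] by simp

lemma smooth_on_const [simp]: "smooth_on S (\<lambda>u. c)"
  by (simp add: smooth_on_def)

lemma smooth_on_add: "open S \<Longrightarrow> smooth_on S f \<Longrightarrow> smooth_on S g \<Longrightarrow> smooth_on S (\<lambda>u. f u + g u)"
  by (simp add: smooth_on_def Ck_on_add)

lemma (in bounded_linear) smooth_on_comp: "open S \<Longrightarrow> smooth_on S g \<Longrightarrow> smooth_on S (\<lambda>u. f (g u))"
  by (simp add: smooth_on_def Ck_on_comp)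

lemma (in bounded_bilinear) smooth_on_prod:
  "open S \<Longrightarrow> smooth_on S f \<Longrightarrow> smooth_on S g \<Longrightarrow> smooth_on S (\<lambda>u. prod (f u) (g u))"
  by (simp add: smooth_on_def Ck_on_prod)

lemma smooth_on_compose:
  "open S \<Longrightarrow> smooth_on R f \<Longrightarrow> smooth_on S g \<Longrightarrow> g ` S \<subseteq> R \<Longrightarrow> smooth_on S (\<lambda>u. f (g u))"
  unfolding smooth_on_def using Ck_on_compose[of S _ R f g] by simp

lemma smooth_on_inverse_sqrt:
  assumes "open S" "smooth_on S f" "\<And>u. u \<in> S \<Longrightarrow> 0 < (f u :: real)"
  shows "smooth_on S (\<lambda>u. inverse (sqrt (f u)))"
  using smooth_on_compose[OF assms(1) _ assms(2), of "{0<..}" "\<lambda>t. inverse (sqrt t)"] assms(3)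
  by (auto simp: smooth_on_def Ck_on_inverse_sqrt)

lemma smooth_on_inverse:
  assumes "open S" "smooth_on S f" "\<And>u. u \<in> S \<Longrightarrow> 0 < (f u :: real)"
  shows "smooth_on S (\<lambda>u. inverse (f u))"
  using smooth_on_compose[OF assms(1) _ assms(2), of "{0<..}" inverse] assms(3)
  by (auto simp: smooth_on_def Ck_on_inverse)

lemma smooth_on_differentiable: "smooth_on S f \<Longrightarrow> u \<in> S \<Longrightarrow> f differentiable (at u)"
  unfolding smooth_on_def by (drule spec[of _ "Suc 0"]) simp

lemma smooth_on_has_derivative:
  "smooth_on S f \<Longrightarrow> u \<in> S \<Longrightarrow> (f has_derivative frechet_derivative f (at u)) (at u)"
  using smooth_on_differentiable has_frechet_derivative by blast

lemma smooth_on_frechet_derivative: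
  "smooth_on S f \<Longrightarrow> smooth_on S (\<lambda>u. frechet_derivative f (at u) w)"
  unfolding smooth_on_def
proof
  fix k assume "\<forall>k. Ck_on k S f"
  then have "Ck_on (Suc k) S f" ..
  then show "Ck_on k S (\<lambda>u. frechet_derivative f (at u) w)" by simp
qed

lemma smooth_on_continuous_on: "smooth_on S f \<Longrightarrow> continuous_on S f"
  unfolding smooth_on_def by (drule spec[of _ 0]) simp

lemma frechet_derivative_expansion:
  fixes f :: "'a::euclidean_space \<Rightarrow> 'b::real_normed_vector"
  shows "f differentiable (at u) \<Longrightarrow>
    frechet_derivative f (at u) w = (\<Sum>b\<in>Basis. (w \<bullet> b) *\<^sub>R frechet_derivative f (at u) b)"
  by (intro linear_euclidean_expansion linear_frechet_derivative)

lemma smooth_on_sum: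
  "open S \<Longrightarrow> finite I \<Longrightarrow> (\<And>i. i \<in> I \<Longrightarrow> smooth_on S (f i)) \<Longrightarrow> smooth_on S (\<lambda>u. \<Sum>i\<in>I. f i u)"
  by (simp add: smooth_on_def Ck_on_sum)

lemma smooth_on_frechet_derivative_along:
  fixes f :: "'a::euclidean_space \<Rightarrow> 'b::real_normed_vector"
  assumes S: "open S" and f: "smooth_on S f" and y: "smooth_on S y"
  shows "smooth_on S (\<lambda>u. frechet_derivative f (at u) (y u))"
proof (rule smooth_on_cong[OF S])
  show "smooth_on S (\<lambda>u. \<Sum>b\<in>Basis. (y u \<bullet> b) *\<^sub>R frechet_derivative f (at u) b)"
    using bounded_bilinear.smooth_on_prod[OF bounded_bilinear_scaleR S
        bounded_linear.smooth_on_comp[OF bounded_linear_inner_left S y]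
        smooth_on_frechet_derivative[OF f]]
    by (intro smooth_on_sum[OF S]) simp_all
qed (simp add: frechet_derivative_expansion[OF smooth_on_differentiable[OF f], symmetric])


text \<open>Two applications of the mean value inequality: in direction \<open>w\<close> to the
  derivative along \<open>v\<close>, then in direction \<open>v\<close> to a difference of values of
  \<open>f\<close>. Continuity of the mixed derivative near \<open>u\<close> supplies the
  \<open>e\<close>.\<close>

lemma second_difference_bound:
  fixes f :: "'a::euclidean_space \<Rightarrow> 'b::real_normed_vector"
  assumes S: "open S" and f: "smooth_on S f" and u: "u \<in> S" and e: "0 < e"
  shows "\<exists>d>0. \<forall>t. 0 < t \<and> t < d \<longrightarrow>
    norm (f (u + t *\<^sub>R v + t *\<^sub>R w) - f (u + t *\<^sub>R v) - f (u + t *\<^sub>R w) + f u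
       - (t * t) *\<^sub>R frechet_derivative (\<lambda>u. frechet_derivative f (at u) v) (at u) w) \<le> e * t * t"
proof -
  let ?fv = "\<lambda>u. frechet_derivative f (at u) v"
  let ?L = "\<lambda>u. frechet_derivative ?fv (at u) w"
  have fv: "smooth_on S ?fv" by (rule smooth_on_frechet_derivative[OF f])
  have "continuous_on S ?L" by (rule smooth_on_continuous_on[OF smooth_on_frechet_derivative[OF fv]])
  then have "isCont ?L u" using S u continuous_on_eq_continuous_at by blast
  then obtain d0 where d0: "d0 > 0" "\<And>z. dist z u < d0 \<Longrightarrow> dist (?L z) (?L u) < e"
    unfolding continuous_at_eps_delta using e by metis
  obtain d1 where d1: "d1 > 0" "ball u d1 \<subseteq> S" using S u openE by blast
  \<comment> \<open>For \<open>a, b \<le> t < d\<close> the displacement \<open>a v + b w\<close>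
    stays shorter than \<open>min d0 d1\<close>; the \<open>+ 1\<close> keeps the divisor positive
    when both directions vanish.\<close>
  define d where "d = min d0 d1 / (norm v + norm w + 1)"
  have nn: "norm v + norm w + 1 > 0" by (simp add: add_nonneg_pos)
  have dpos: "d > 0" using d0 d1 nn by (simp add: d_def)
  have inb: "u + a *\<^sub>R v + b *\<^sub>R w \<in> S \<and> dist (?L (u + a *\<^sub>R v + b *\<^sub>R w)) (?L u) < e"
    if "0 \<le> a" "a \<le> t" "0 \<le> b" "b \<le> t" "0 < t" "t < d" for a b t
  proof -
    have "norm (a *\<^sub>R v + b *\<^sub>R w) \<le> a * norm v + b * norm w"
      using norm_triangle_ineq[of "a *\<^sub>R v" "b *\<^sub>R w"] that by simp
    also have "\<dots> \<le> t * norm v + t * norm w" using that by (intro add_mono mult_right_mono) auto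
    also have "\<dots> \<le> t * (norm v + norm w + 1)" using that by (simp add: algebra_simps)
    also have "\<dots> < d * (norm v + norm w + 1)" using that nn by simp
    also have "\<dots> = min d0 d1" using nn by (simp add: d_def)
    finally have *: "norm (a *\<^sub>R v + b *\<^sub>R w) < min d0 d1" .
    have "dist (u + a *\<^sub>R v + b *\<^sub>R w) u = norm (a *\<^sub>R v + b *\<^sub>R w)"
      by (simp add: dist_norm add.assoc)
    then show ?thesis using * d0(2)[of "u + a *\<^sub>R v + b *\<^sub>R w"] d1(2)
      by (auto simp: dist_commute subset_iff)
  qed
  have main: "norm (f (u + t *\<^sub>R v + t *\<^sub>R w) - f (u + t *\<^sub>R v) - f (u + t *\<^sub>R w) + f u
       - (t * t) *\<^sub>R ?L u) \<le> e * t * t" if t: "0 < t" "t < d" for t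
  proof -
    have inner: "norm (?fv (u + s *\<^sub>R v + t *\<^sub>R w) - ?fv (u + s *\<^sub>R v) - t *\<^sub>R ?L u) \<le> e * t"
      if s: "0 \<le> s" "s \<le> t" for s
    proof -
      \<comment> \<open>The derivative of \<open>K\<close> is the deviation of the mixed derivative
        from its value at \<open>u\<close>, of norm below \<open>e\<close>.\<close>
      define K where "K b = ?fv (u + s *\<^sub>R v + b *\<^sub>R w) - b *\<^sub>R ?L u" for b
      have "norm (K t - K 0) \<le> e * norm (t - 0)"
      proof (rule differentiable_bound[of "{0..t}" K "\<lambda>b h. h *\<^sub>R (?L (u + s *\<^sub>R v + b *\<^sub>R w) - ?L u)"])
        fix b assume b: "b \<in> {0..t}"
        have ib: "u + s *\<^sub>R v + b *\<^sub>R w \<in> S \<and> dist (?L (u + s *\<^sub>R v + b *\<^sub>R w)) (?L u) < e"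
          using inb[of s t b] s b t by auto
        have "((\<lambda>b. u + s *\<^sub>R v + b *\<^sub>R w) has_derivative (\<lambda>h. h *\<^sub>R w)) (at b)"
          by (auto intro!: derivative_eq_intros)
        from diff_chain_at[OF this smooth_on_has_derivative[OF fv]] ib
        have "((\<lambda>b. ?fv (u + s *\<^sub>R v + b *\<^sub>R w)) has_derivative
            (\<lambda>h. frechet_derivative ?fv (at (u + s *\<^sub>R v + b *\<^sub>R w)) (h *\<^sub>R w))) (at b)"
          by (simp add: o_def)
        moreover have "frechet_derivative ?fv (at (u + s *\<^sub>R v + b *\<^sub>R w)) (h *\<^sub>R w) =
            h *\<^sub>R ?L (u + s *\<^sub>R v + b *\<^sub>R w)" for h
          using linear_frechet_derivative[OF smooth_on_differentiable[OF fv]] ib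
          by (simp add: linear_scale)
        ultimately have "((\<lambda>b. ?fv (u + s *\<^sub>R v + b *\<^sub>R w)) has_derivative
            (\<lambda>h. h *\<^sub>R ?L (u + s *\<^sub>R v + b *\<^sub>R w))) (at b)" by simp
        then have "(K has_derivative (\<lambda>h. h *\<^sub>R ?L (u + s *\<^sub>R v + b *\<^sub>R w) - h *\<^sub>R ?L u)) (at b)"
          unfolding K_def by (intro has_derivative_diff has_derivative_scaleR_left has_derivative_ident)
        then show "(K has_derivative (\<lambda>h. h *\<^sub>R (?L (u + s *\<^sub>R v + b *\<^sub>R w) - ?L u))) (at b within {0..t})"
          by (simp add: has_derivative_at_withinI scaleR_right_diff_distrib)
        show "onorm (\<lambda>h. h *\<^sub>R (?L (u + s *\<^sub>R v + b *\<^sub>R w) - ?L u)) \<le> e"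
          using ib by (intro onorm_le) (simp add: dist_norm mult.commute[of e] mult_left_mono)
      qed (use t in auto)
      then show ?thesis using t by (simp add: K_def algebra_simps)
    qed
    \<comment> \<open>The derivative of \<open>G\<close> is the quantity bounded by
      \<open>inner\<close>, and \<open>G t - G 0\<close> is the second difference minus its expected
      value.\<close>
    define G where "G a = f (u + a *\<^sub>R v + t *\<^sub>R w) - f (u + a *\<^sub>R v) - (a * t) *\<^sub>R ?L u" for a
    have "norm (G t - G 0) \<le> (e * t) * norm (t - 0)"
    proof (rule differentiable_bound[of "{0..t}" G "\<lambda>s h. h *\<^sub>R (?fv (u + s *\<^sub>R v + t *\<^sub>R w) - ?fv (u + s *\<^sub>R v) - t *\<^sub>R ?L u)"])
      fix a assume a: "a \<in> {0..t}"
      have deriv: "((\<lambda>a. f (u + a *\<^sub>R v + b *\<^sub>R w)) has_derivative (\<lambda>h. h *\<^sub>R ?fv (u + a *\<^sub>R v + b *\<^sub>R w))) (at a)"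
        if "0 \<le> b" "b \<le> t" for b
      proof -
        have ib: "u + a *\<^sub>R v + b *\<^sub>R w \<in> S"
          using inb[of a t b] that a t by auto
        have "((\<lambda>a. u + a *\<^sub>R v + b *\<^sub>R w) has_derivative (\<lambda>h. h *\<^sub>R v)) (at a)"
          by (auto intro!: derivative_eq_intros)
        from diff_chain_at[OF this smooth_on_has_derivative[OF f]] ib
        have "((\<lambda>a. f (u + a *\<^sub>R v + b *\<^sub>R w)) has_derivative
            (\<lambda>h. frechet_derivative f (at (u + a *\<^sub>R v + b *\<^sub>R w)) (h *\<^sub>R v))) (at a)"
          by (simp add: o_def)
        moreover have "frechet_derivative f (at (u + a *\<^sub>R v + b *\<^sub>R w)) (h *\<^sub>R v) =
            h *\<^sub>R ?fv (u + a *\<^sub>R v + b *\<^sub>R w)" for h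
          using linear_frechet_derivative[OF smooth_on_differentiable[OF f]] ib
          by (simp add: linear_scale)
        ultimately show ?thesis by simp
      qed
      have "(G has_derivative (\<lambda>h. h *\<^sub>R ?fv (u + a *\<^sub>R v + t *\<^sub>R w) - h *\<^sub>R ?fv (u + a *\<^sub>R v)
          - (h * t) *\<^sub>R ?L u)) (at a)"
        unfolding G_def using deriv[of t] deriv[of 0] t
        by (intro has_derivative_diff has_derivative_scaleR_left has_derivative_mult_left has_derivative_ident)
          simp_all
      then show "(G has_derivative (\<lambda>h. h *\<^sub>R (?fv (u + a *\<^sub>R v + t *\<^sub>R w) - ?fv (u + a *\<^sub>R v) - t *\<^sub>R ?L u))) (at a within {0..t})"
        by (simp add: has_derivative_at_withinI scaleR_right_diff_distrib)
      show "onorm (\<lambda>h. h *\<^sub>R (?fv (u + a *\<^sub>R v + t *\<^sub>R w) - ?fv (u + a *\<^sub>R v) - t *\<^sub>R ?L u)) \<le> e * t"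
        using inner[of a] a
        by (intro onorm_le) (simp add: mult.commute[of "e * t"] mult_left_mono)
    qed (use t in auto)
    then show ?thesis using t by (simp add: G_def algebra_simps)
  qed
  show ?thesis using main dpos by blast
qed

text \<open>The second difference is symmetric in \<open>v\<close> and \<open>w\<close>, and after
  division by \<open>t * t\<close> it approximates both mixed derivatives.\<close>

lemma symmetric_second_derivative:
  fixes f :: "'a::euclidean_space \<Rightarrow> 'b::real_normed_vector"
  assumes S: "open S" and f: "smooth_on S f" and u: "u \<in> S"
  shows "frechet_derivative (\<lambda>u. frechet_derivative f (at u) v) (at u) w =
         frechet_derivative (\<lambda>u. frechet_derivative f (at u) w) (at u) v" (is "?L = ?R")
proof -
  have "norm (?L - ?R) \<le> 0 + e" if "e > 0" for e
  proof -
    have e2: "e / 2 > 0" using that by simp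
    obtain d where d: "d > 0" "\<And>t. 0 < t \<Longrightarrow> t < d \<Longrightarrow>
      norm (f (u + t *\<^sub>R v + t *\<^sub>R w) - f (u + t *\<^sub>R v) - f (u + t *\<^sub>R w) + f u - (t * t) *\<^sub>R ?L) \<le> e / 2 * t * t"
      using second_difference_bound[OF S f u e2, of v w] by blast
    obtain d' where d': "d' > 0" "\<And>t. 0 < t \<Longrightarrow> t < d' \<Longrightarrow>
      norm (f (u + t *\<^sub>R w + t *\<^sub>R v) - f (u + t *\<^sub>R w) - f (u + t *\<^sub>R v) + f u - (t * t) *\<^sub>R ?R) \<le> e / 2 * t * t"
      using second_difference_bound[OF S f u e2, of w v] by blast
    define t where "t = min d d' / 2"
    have t: "0 < t" "t < d" "t < d'" using d(1) d'(1) by (auto simp: t_def min_def)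
    let ?D = "f (u + t *\<^sub>R v + t *\<^sub>R w) - f (u + t *\<^sub>R v) - f (u + t *\<^sub>R w) + f u"
    have R: "norm (?D - (t * t) *\<^sub>R ?R) \<le> e / 2 * t * t"
      using d'(2)[OF t(1,3)] by (simp add: algebra_simps)
    have "(t * t) *\<^sub>R (?L - ?R) = (?D - (t * t) *\<^sub>R ?R) - (?D - (t * t) *\<^sub>R ?L)"
      by (simp add: algebra_simps)
    then have "norm ((t * t) *\<^sub>R (?L - ?R)) \<le> norm (?D - (t * t) *\<^sub>R ?R) + norm (?D - (t * t) *\<^sub>R ?L)"
      by (metis norm_triangle_ineq4)
    also have "\<dots> \<le> e * (t * t)" using d(2)[OF t(1,2)] R by simp
    finally have "(t * t) * norm (?L - ?R) \<le> (t * t) * e" by (simp add: mult.commute)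
    then show ?thesis using t(1) by simp
  qed
  then have "norm (?L - ?R) \<le> 0" by (rule field_le_epsilon)
  then show ?thesis by simp
qed


section \<open>Charts\<close>

text \<open>Product rule for a varying direction: expanding \<open>z\<close> in the basis reduces it
  to scalar coefficients times derivatives in fixed directions.\<close>

lemma frechet_derivative_along_derivative:
  fixes f :: "'a::euclidean_space \<Rightarrow> 'b::real_normed_vector"
  assumes S: "open S" and f: "smooth_on S f" and z: "smooth_on S z" and u: "u \<in> S"
  shows "frechet_derivative (\<lambda>v. frechet_derivative f (at v) (z v)) (at u) a =
    frechet_derivative (\<lambda>v. frechet_derivative f (at v) (z u)) (at u) a +
    frechet_derivative f (at u) (frechet_derivative z (at u) a)"
proof -
  let ?D = "\<lambda>w v. frechet_derivative f (at v) w"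
  have D: "(?D w has_derivative frechet_derivative (?D w) (at u)) (at u)" for w
    by (rule smooth_on_has_derivative[OF smooth_on_frechet_derivative[OF f] u])
  have exp: "?D w v = (\<Sum>b\<in>Basis. (w \<bullet> b) *\<^sub>R ?D b v)" if "v \<in> S" for v w
    by (rule frechet_derivative_expansion[OF smooth_on_differentiable[OF f that]])
  have zd: "(z has_derivative frechet_derivative z (at u)) (at u)"
    by (rule smooth_on_has_derivative[OF z u])
  have "frechet_derivative (\<lambda>v. ?D (z v) v) (at u) =
        frechet_derivative (\<lambda>v. \<Sum>b\<in>Basis. (z v \<bullet> b) *\<^sub>R ?D b v) (at u)"
    by (rule frechet_derivative_cong_open[OF S u exp])
  also have "\<dots> = (\<lambda>a. \<Sum>b\<in>Basis. (z u \<bullet> b) *\<^sub>R frechet_derivative (?D b) (at u) a +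
      (frechet_derivative z (at u) a \<bullet> b) *\<^sub>R ?D b u)"
    by (rule frechet_derivative_eqI)
       (intro has_derivative_sum has_derivative_scaleR has_derivative_inner_left zd D)
  finally have 1: "frechet_derivative (\<lambda>v. ?D (z v) v) (at u) a =
     (\<Sum>b\<in>Basis. (z u \<bullet> b) *\<^sub>R frechet_derivative (?D b) (at u) a) + ?D (frechet_derivative z (at u) a) u"
    by (simp add: sum.distrib exp[OF u, of "frechet_derivative z (at u) a"])
  have "frechet_derivative (?D (z u)) (at u) =
        frechet_derivative (\<lambda>v. \<Sum>b\<in>Basis. (z u \<bullet> b) *\<^sub>R ?D b v) (at u)"
    by (rule frechet_derivative_cong_open[OF S u exp])
  also have "\<dots> = (\<lambda>a. \<Sum>b\<in>Basis. (z u \<bullet> b) *\<^sub>R frechet_derivative (?D b) (at u) a)"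
    by (rule frechet_derivative_eqI)
       (intro has_derivative_sum has_derivative_scaleR_right D)
  finally show ?thesis using 1 by simp
qed

text \<open>The second-order terms cancel by symmetry; what is left is the coordinate form of the
  Lie bracket of \<open>y\<close> and \<open>z\<close>.\<close>

lemma frechet_derivative_commutator:
  fixes f :: "'a::euclidean_space \<Rightarrow> 'b::real_normed_vector"
  assumes S: "open S" and f: "smooth_on S f" and y: "smooth_on S y" and z: "smooth_on S z" and u: "u \<in> S"
  shows "frechet_derivative (\<lambda>v. frechet_derivative f (at v) (z v)) (at u) (y u) -
         frechet_derivative (\<lambda>v. frechet_derivative f (at v) (y v)) (at u) (z u) =
     frechet_derivative f (at u) (frechet_derivative z (at u) (y u) - frechet_derivative y (at u) (z u))"
  using frechet_derivative_along_derivative[OF S f z u, of "y u"]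
    frechet_derivative_along_derivative[OF S f y u, of "z u"]
    symmetric_second_derivative[OF S f u, of "z u" "y u"]
    linear_diff[OF linear_frechet_derivative[OF smooth_on_differentiable[OF f u]]]
  by simp

lemma chart_rep_bilinear: "chart_rep c (\<lambda>q. B (f q) (g q)) = (\<lambda>u. B (chart_rep c f u) (chart_rep c g u))"
  by (simp add: chart_rep_def o_def)

lemma chart_rep_linear: "chart_rep c (\<lambda>q. L (f q)) = (\<lambda>u. L (chart_rep c f u))"
  by (simp add: chart_rep_def o_def)

lemma chart_rep_const: "chart_rep c (\<lambda>q. k) = (\<lambda>u. k)"
  by (simp add: chart_rep_def o_def)

section \<open>Smooth maps on the surface and changes of chart\<close>

context oriented_surface
begin

lemma chart_subset: "c \<in> A \<Longrightarrow> fst c \<subseteq> topspace X"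
  using chart_open openin_subset by blast

lemma chart_inj: assumes "c \<in> A" shows "inj_on (snd c) (fst c)"
  using chart_homeo[OF assms] chart_subset[OF assms]
  by (simp add: homeomorphic_eq_everything_map Int_absorb1)

lemma chart_rep_apply: "c \<in> A \<Longrightarrow> p \<in> fst c \<Longrightarrow> chart_rep c f (snd c p) = f p"
  by (simp add: chart_rep_def chart_inj)

lemma open_chart_image:
  assumes c: "c \<in> A" and W: "openin X W"
  shows "open (snd c ` (fst c \<inter> W))"
proof -
  have "openin (top_of_set (snd c ` fst c)) (snd c ` (fst c \<inter> W))"
  proof -
    have "openin (subtopology X (fst c)) (W \<inter> fst c)"
      by (rule openin_subtopology_Int[OF W])
    moreover have "open_map (subtopology X (fst c)) (top_of_set (snd c ` fst c)) (snd c)"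
      using chart_homeo[OF c] by (rule homeomorphic_imp_open_map)
    ultimately show ?thesis unfolding open_map_def by (simp add: Int_commute)
  qed
  then show ?thesis using chart_open[OF c] by (simp add: openin_open_eq)
qed

lemma open_chart_preimage:
  assumes c: "c \<in> A" and S: "open S"
  shows "openin X {p \<in> fst c. snd c p \<in> S}"
proof -
  have "continuous_map (subtopology X (fst c)) (top_of_set (snd c ` fst c)) (snd c)"
    using chart_homeo[OF c] by (simp add: homeomorphic_imp_continuous_map)
  moreover have "openin (top_of_set (snd c ` fst c)) (snd c ` fst c \<inter> S)"
    using S by auto
  ultimately have "openin (subtopology X (fst c)) {p \<in> topspace (subtopology X (fst c)). snd c p \<in> snd c ` fst c \<inter> S}"
    by (rule openin_continuous_map_preimage)
  moreover have "{p \<in> topspace (subtopology X (fst c)). snd c p \<in> snd c ` fst c \<inter> S} = {p \<in> fst c. snd c p \<in> S}"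
    using chart_subset[OF c] by (auto simp: topspace_subtopology)
  ultimately have "openin (subtopology X (fst c)) {p \<in> fst c. snd c p \<in> S}" by simp
  then show ?thesis using chart_open[OF c] by (simp add: openin_open_subtopology)
qed

lemma chart_at: assumes "p \<in> topspace X" shows "chart_at p \<in> A" "p \<in> fst (chart_at p)"
proof -
  have "\<exists>c. c \<in> A \<and> p \<in> fst c" using assms charts_cover by blast
  then have "chart_at p \<in> A \<and> p \<in> fst (chart_at p)" unfolding chart_at_def by (rule someI_ex)
  then show "chart_at p \<in> A" "p \<in> fst (chart_at p)" by auto
qed

lemma smooth_mapD: "smooth_map W f \<Longrightarrow> c \<in> A \<Longrightarrow> smooth_on (snd c ` (fst c \<inter> W)) (chart_rep c f)"
  by (simp add: smooth_map_def)

lemma smooth_map_subset: "smooth_map W f \<Longrightarrow> V \<subseteq> W \<Longrightarrow> smooth_map V f"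
  unfolding smooth_map_def by (intro ballI, rule smooth_on_subset, erule (1) bspec) auto

lemma smooth_map_bilinear:
  assumes "bounded_bilinear B" and W: "openin X W" and "smooth_map W f" "smooth_map W g"
  shows "smooth_map W (\<lambda>q. B (f q) (g q))"
  using assms unfolding smooth_map_def
  by (simp add: chart_rep_bilinear bounded_bilinear.smooth_on_prod open_chart_image)

lemma smooth_map_linear:
  assumes "bounded_linear L" and W: "openin X W" and "smooth_map W f"
  shows "smooth_map W (\<lambda>q. L (f q))"
  using assms unfolding smooth_map_def
  by (simp add: chart_rep_linear bounded_linear.smooth_on_comp open_chart_image)

lemma smooth_map_const: "smooth_map W (\<lambda>q. k)"
  unfolding smooth_map_def by (simp add: chart_rep_const)

lemma smooth_map_add:
  assumes W: "openin X W" and "smooth_map W f" "smooth_map W g"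
  shows "smooth_map W (\<lambda>q. f q + g q)"
  using assms unfolding smooth_map_def
  by (simp add: chart_rep_bilinear smooth_on_add open_chart_image)

lemma smooth_map_minus:
  "openin X W \<Longrightarrow> smooth_map W f \<Longrightarrow> smooth_map W (\<lambda>q. - f q)"
  by (rule smooth_map_linear[OF bounded_linear_minus[OF bounded_linear_ident]])

lemma smooth_map_diff:
  assumes W: "openin X W" and "smooth_map W f" "smooth_map W g"
  shows "smooth_map W (\<lambda>q. f q - g q)"
  using smooth_map_add[OF W assms(2) smooth_map_minus[OF W assms(3)]] by simp

lemma smooth_map_scaleR:
  "openin X W \<Longrightarrow> smooth_map W f \<Longrightarrow> smooth_map W g \<Longrightarrow> smooth_map W (\<lambda>q. f q *\<^sub>R g q)"
  by (rule smooth_map_bilinear[OF bounded_bilinear_scaleR])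

lemma smooth_map_inverse_sqrt:
  assumes W: "openin X W" and f: "smooth_map W f" and pos: "\<And>q. q \<in> W \<Longrightarrow> 0 < (f q :: real)"
  shows "smooth_map W (\<lambda>q. inverse (sqrt (f q)))"
  unfolding smooth_map_def
proof
  fix c assume c: "c \<in> A"
  have "smooth_on (snd c ` (fst c \<inter> W)) (\<lambda>u. inverse (sqrt (chart_rep c f u)))"
    by (rule smooth_on_inverse_sqrt[OF open_chart_image[OF c W] smooth_mapD[OF f c]])
      (use pos c in \<open>auto simp: chart_rep_apply\<close>)
  then show "smooth_on (snd c ` (fst c \<inter> W)) (chart_rep c (\<lambda>q. inverse (sqrt (f q))))"
    by (simp add: chart_rep_def o_def)
qed

lemma chart_rep_transition:
  assumes "c \<in> A" "d \<in> A" "u \<in> snd d ` (fst c \<inter> fst d)"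
  shows "chart_rep d f u = chart_rep c f (chart_rep d (snd c) u)"
  using assms by (auto simp: chart_rep_apply)

text \<open>Smooth transition maps carry smoothness from one chart containing \<open>W\<close> to
  all the others.\<close>

lemma smooth_map_in_chart:
  assumes c: "c \<in> A" and W: "openin X W" "W \<subseteq> fst c"
    and f: "smooth_on (snd c ` W) (chart_rep c f)"
  shows "smooth_map W f"
  unfolding smooth_map_def
proof
  fix d assume d: "d \<in> A"
  let ?S = "snd d ` (fst d \<inter> W)"
  have S: "open ?S" by (rule open_chart_image[OF d W(1)])
  have "smooth_on ?S (chart_rep d (snd c))"
    by (rule smooth_on_subset[OF transition_smooth[OF d c]]) (use W in auto)
  then have "smooth_on ?S (\<lambda>u. chart_rep c f (chart_rep d (snd c) u))"
    by (rule smooth_on_compose[OF S f]) (auto simp: chart_rep_apply[OF d])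
  then show "smooth_on ?S (chart_rep d f)"
    by (rule smooth_on_cong[OF S, rotated]) (use W in \<open>auto simp: chart_rep_apply[OF d] chart_rep_apply[OF c]\<close>)
qed

lemma chart_differentiable:
  assumes W: "openin X W" and f: "smooth_map W f" and c: "c \<in> A" and p: "p \<in> fst c" "p \<in> W"
  shows "chart_rep c f differentiable (at (snd c p))"
  by (rule smooth_on_differentiable[OF smooth_mapD[OF f c]]) (use p in auto)

lemma chart_has_derivative:
  assumes W: "openin X W" and f: "smooth_map W f" and c: "c \<in> A" and p: "p \<in> fst c" "p \<in> W"
  shows "(chart_rep c f has_derivative chart_diff c f p) (at (snd c p))"
  unfolding chart_diff_def by (rule has_frechet_derivative[OF chart_differentiable[OF assms]])

lemma chart_diff_transition:
  assumes W: "openin X W" and f: "smooth_map W f" and c: "c \<in> A" and d: "d \<in> A"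
    and p: "p \<in> fst c" "p \<in> fst d" "p \<in> W"
  shows "chart_diff d f p w = chart_diff c f p (chart_diff d (snd c) p w)"
proof -
  let ?S = "snd d ` (fst c \<inter> fst d)"
  have S: "open ?S" "snd d p \<in> ?S"
    using open_chart_image[OF d, of "fst c"] chart_open[OF c] p by (auto simp: Int_commute)
  have "chart_rep d (snd c) differentiable (at (snd d p))"
    by (rule smooth_on_differentiable[OF transition_smooth[OF d c]]) (use p in auto)
  then have 1: "(chart_rep d (snd c) has_derivative chart_diff d (snd c) p) (at (snd d p))"
    unfolding chart_diff_def by (rule has_frechet_derivative)
  have 2: "(chart_rep c f has_derivative chart_diff c f p) (at (chart_rep d (snd c) (snd d p)))"
    using chart_has_derivative[OF W f c p(1,3)] by (simp add: chart_rep_apply[OF d p(2)])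
  have "(chart_rep d f has_derivative (chart_diff c f p \<circ> chart_diff d (snd c) p)) (at (snd d p))"
    by (rule has_derivative_transform_within_open[OF diff_chain_at[OF 1 2] S])
       (simp only: o_apply chart_rep_transition[OF c d, of _ f])
  then show ?thesis by (simp add: chart_diff_def frechet_derivative_eqI)
qed

lemma chart_diff_cong:
  assumes "c \<in> A" "openin X W" "p \<in> fst c" "p \<in> W" "\<And>q. q \<in> W \<Longrightarrow> f q = g q"
  shows "chart_diff c f p = chart_diff c g p"
  unfolding chart_diff_def
  by (rule frechet_derivative_cong_open[OF open_chart_image[OF assms(1,2)]])
     (use assms in \<open>auto simp: chart_rep_apply\<close>)

end


section \<open>Derivatives along tangent vectors\<close>

lemma bilinear_lorentz: "bilinear lorentz"
  by (auto simp: bilinear_def lorentz_def algebra_simps intro!: linearI)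

lemma bounded_bilinear_lorentz: "bounded_bilinear lorentz"
  using bilinear_lorentz by (simp add: bilinear_conv_bounded_bilinear)

interpretation lorentz: bounded_bilinear lorentz by (rule bounded_bilinear_lorentz)

lemma bilinear_wedge: "bilinear wedge"
  by (auto simp: bilinear_def wedge_def vec_eq_iff algebra_simps intro!: linearI)

lemma bounded_bilinear_wedge: "bounded_bilinear wedge"
  using bilinear_wedge by (simp add: bilinear_conv_bounded_bilinear)

interpretation wedge: bounded_bilinear wedge by (rule bounded_bilinear_wedge)

lemma lorentz_commute: "lorentz v w = lorentz w v"
  by (simp add: lorentz_def)

lemma wedge_commute: "wedge v w = - wedge w v"
  by (simp add: wedge_def vec_eq_iff)

lemma wedge_self [simp]: "wedge v v = 0"
  by (simp add: wedge_def vec_eq_iff)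

section \<open>Tangent spaces and chart-independent directional derivatives\<close>

context spacelike_surface
begin

lemma open_carrier: "openin X (topspace X)"
  by simp

lemma x_chart_smooth: "c \<in> A \<Longrightarrow> smooth_on (snd c ` fst c) (chart_rep c x)"
  using smooth_mapD[OF x_smooth, of c] chart_subset[of c] by (simp add: Int_absorb2)

lemma x_chart_linear:
  assumes "c \<in> A" "p \<in> fst c" shows "linear (chart_diff c x p)"
  unfolding chart_diff_def
  by (rule linear_frechet_derivative[OF smooth_on_differentiable[OF x_chart_smooth]]) (use assms in auto)

lemma x_transition:
  assumes "c \<in> A" "d \<in> A" "p \<in> fst c" "p \<in> fst d"
  shows "chart_diff d x p w = chart_diff c x p (chart_diff d (snd c) p w)"
  by (rule chart_diff_transition[OF open_carrier x_smooth]) (use assms chart_subset[OF assms(1)] in auto)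

lemma tangent_space_chart:
  assumes c: "c \<in> A" and p: "p \<in> fst c"
  shows "tangent_space p = range (chart_diff c x p)"
proof -
  have pX: "p \<in> topspace X" using chart_subset[OF c] p by auto
  note d = chart_at[OF pX]
  have sub: "range (chart_diff d' x p) \<subseteq> range (chart_diff c' x p)"
    if "c' \<in> A" "d' \<in> A" "p \<in> fst c'" "p \<in> fst d'" for c' d'
    using x_transition[OF that] by (metis image_subsetI rangeI)
  show ?thesis
    unfolding tangent_space_def using sub[OF c d(1) p d(2)] sub[OF d(1) c d(2) p] by blast
qed

lemma subspace_tangent_space:
  assumes p: "p \<in> topspace X" shows "subspace (tangent_space p)"
  unfolding tangent_space_def
  by (rule linear_subspace_image[OF x_chart_linear[OF chart_at[OF p]] subspace_UNIV])

lemma inj_chart_at: "p \<in> topspace X \<Longrightarrow> inj (chart_diff (chart_at p) x p)"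
  by (rule immersion[OF chart_at])

lemma tangent_coords_eq:
  assumes p: "p \<in> topspace X" and w: "chart_diff (chart_at p) x p w = v"
  shows "tangent_coords p v = w"
  unfolding tangent_coords_def
  by (rule the_equality[where P = "\<lambda>w. chart_diff (chart_at p) x p w = v", OF w])
     (use w in \<open>simp add: inj_eq[OF inj_chart_at[OF p], symmetric]\<close>)

lemma tangent_coords:
  assumes p: "p \<in> topspace X" and v: "v \<in> tangent_space p"
  shows "chart_diff (chart_at p) x p (tangent_coords p v) = v"
proof -
  obtain w where w: "chart_diff (chart_at p) x p w = v" using v unfolding tangent_space_def by auto
  show ?thesis unfolding tangent_coords_eq[OF p w] by (rule w)
qed

lemma tangent_coords_transition:
  assumes c: "c \<in> A" and p: "p \<in> fst c" and w: "chart_diff c x p w = v"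
  shows "tangent_coords p v = chart_diff c (snd (chart_at p)) p w"
proof -
  have pX: "p \<in> topspace X" using chart_subset[OF c] p by auto
  note d = chart_at[OF pX]
  show ?thesis
    by (rule tangent_coords_eq[OF pX], unfold x_transition[OF d(1) c d(2) p, symmetric], rule w)
qed

text \<open>\<open>deriv_along\<close> uses \<open>chart_at p\<close>, an arbitrary choice that may
  change from point to point. Passing to one fixed chart \<open>c\<close> is what makes iterated
  derivatives accessible.\<close>

lemma deriv_along_chart:
  assumes W: "openin X W" and f: "smooth_map W f" and pW: "p \<in> W"
    and c: "c \<in> A" and p: "p \<in> fst c" and w: "chart_diff c x p w = v"
  shows "deriv_along p v f = chart_diff c f p w"
proof -
  have pX: "p \<in> topspace X" using chart_subset[OF c] p by auto
  note d = chart_at[OF pX]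
  show ?thesis
    unfolding deriv_along_def tangent_coords_transition[OF c p w]
    by (rule chart_diff_transition[OF W f d(1) c d(2) p pW, symmetric])
qed

lemma deriv_along_cong:
  assumes "openin X W" "p \<in> W" "\<And>q. q \<in> W \<Longrightarrow> f q = g q"
  shows "deriv_along p v f = deriv_along p v g"
proof -
  have pX: "p \<in> topspace X" using openin_subset[OF assms(1)] assms(2) by auto
  show ?thesis unfolding deriv_along_def
    by (rule fun_cong[OF chart_diff_cong[OF chart_at(1)[OF pX] assms(1) chart_at(2)[OF pX] assms(2,3)]])
qed

lemma deriv_along_const: "deriv_along p v (\<lambda>q. k) = 0"
  by (simp add: deriv_along_def chart_diff_def chart_rep_const)

lemma deriv_along_bilinear:
  assumes B: "bounded_bilinear B" and W: "openin X W" and p: "p \<in> W"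
    and f: "smooth_map W f" and g: "smooth_map W g"
  shows "deriv_along p v (\<lambda>q. B (f q) (g q)) = B (deriv_along p v f) (g p) + B (f p) (deriv_along p v g)"
proof -
  have pX: "p \<in> topspace X" using p W openin_subset by blast
  note c = chart_at[OF pX]
  have "(chart_rep (chart_at p) (\<lambda>q. B (f q) (g q)) has_derivative
     (\<lambda>w. B (f p) (chart_diff (chart_at p) g p w) + B (chart_diff (chart_at p) f p w) (g p))) (at (snd (chart_at p) p))"
    using bounded_bilinear.FDERIV[OF B chart_has_derivative[OF W f c p] chart_has_derivative[OF W g c p]]
    by (simp add: chart_rep_bilinear chart_rep_apply[OF c])
  from frechet_derivative_eqI[OF this] show ?thesis
    unfolding deriv_along_def by (subst (1) chart_diff_def) simp
qed

lemma deriv_along_linear: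
  assumes L: "bounded_linear L" and W: "openin X W" and p: "p \<in> W" and f: "smooth_map W f"
  shows "deriv_along p v (\<lambda>q. L (f q)) = L (deriv_along p v f)"
proof -
  have pX: "p \<in> topspace X" using p W openin_subset by blast
  note c = chart_at[OF pX]
  have "(chart_rep (chart_at p) (\<lambda>q. L (f q)) has_derivative
     (\<lambda>w. L (chart_diff (chart_at p) f p w))) (at (snd (chart_at p) p))"
    using bounded_linear.has_derivative[OF L chart_has_derivative[OF W f c p]]
    by (simp add: chart_rep_linear)
  from frechet_derivative_eqI[OF this] show ?thesis
    unfolding deriv_along_def by (subst (1) chart_diff_def) simp
qed

lemma deriv_along_add:
  assumes W: "openin X W" and p: "p \<in> W" and f: "smooth_map W f" and g: "smooth_map W g"
  shows "deriv_along p v (\<lambda>q. f q + g q) = deriv_along p v f + deriv_along p v g"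
proof -
  have pX: "p \<in> topspace X" using p W openin_subset by blast
  note c = chart_at[OF pX]
  have "(chart_rep (chart_at p) (\<lambda>q. f q + g q) has_derivative
     (\<lambda>w. chart_diff (chart_at p) f p w + chart_diff (chart_at p) g p w)) (at (snd (chart_at p) p))"
    using has_derivative_add[OF chart_has_derivative[OF W f c p] chart_has_derivative[OF W g c p]]
    by (simp add: chart_rep_bilinear)
  from frechet_derivative_eqI[OF this] show ?thesis
    unfolding deriv_along_def by (subst (1) chart_diff_def) simp
qed

lemma linear_deriv_along:
  assumes W: "openin X W" and p: "p \<in> W" and f: "smooth_map W f"
    and v: "v \<in> tangent_space p" and w: "w \<in> tangent_space p"
  shows "deriv_along p (a *\<^sub>R v + b *\<^sub>R w) f = a *\<^sub>R deriv_along p v f + b *\<^sub>R deriv_along p w f"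
proof -
  have pX: "p \<in> topspace X" using p W openin_subset by blast
  note c = chart_at[OF pX]
  note lin = x_chart_linear[OF c]
  have fl: "linear (chart_diff (chart_at p) f p)"
    using chart_has_derivative[OF W f c p] by (rule has_derivative_linear)
  have "tangent_coords p (a *\<^sub>R v + b *\<^sub>R w) = a *\<^sub>R tangent_coords p v + b *\<^sub>R tangent_coords p w"
    by (rule tangent_coords_eq[OF pX])
      (simp add: linear_add[OF lin] linear_scale[OF lin] tangent_coords[OF pX] v w)
  then show ?thesis
    unfolding deriv_along_def by (simp add: linear_add[OF fl] linear_scale[OF fl])
qed

text \<open>The immersion serves as a test function: it turns identities between derivations into
  identities between ambient vectors.\<close>

lemma deriv_along_x:
  assumes "p \<in> topspace X" "v \<in> tangent_space p" shows "deriv_along p v x = v"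
  unfolding deriv_along_def by (rule tangent_coords[OF assms])

abbreviation (input) E1 :: "real^2" where "E1 \<equiv> axis 1 1"
abbreviation (input) E2 :: "real^2" where "E2 \<equiv> axis 2 1"

lemma chart_gram_positive:
  assumes c: "c \<in> A" and p: "p \<in> fst c"
  defines "X1 \<equiv> chart_diff c x p E1" and "X2 \<equiv> chart_diff c x p E2"
  shows "0 < lorentz X1 X1" "0 < lorentz X1 X1 * lorentz X2 X2 - lorentz X1 X2 * lorentz X1 X2"
proof -
  note lin = x_chart_linear[OF c p]
  have nz: "chart_diff c x p w \<noteq> 0" if "w \<noteq> 0" for w
    using immersion[OF c p] linear_0[OF lin] that by (metis injD)
  have "E1 \<noteq> 0" by (simp add: axis_eq_0_iff)
  then show 1: "0 < lorentz X1 X1"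
    unfolding X1_def using spacelike[OF c p] nz by blast
  \<comment> \<open>Up to scale, the Gram-Schmidt vector of the second coordinate field; the squared
    length of its image is \<open>lorentz X1 X1\<close> times the Gram determinant.\<close>
  let ?w = "lorentz X1 X1 *\<^sub>R E2 - lorentz X1 X2 *\<^sub>R E1"
  have "?w $ 2 \<noteq> 0" using 1 by (simp add: axis_def)
  then have "?w \<noteq> 0" by (metis zero_index)
  then have "0 < lorentz (chart_diff c x p ?w) (chart_diff c x p ?w)"
    using spacelike[OF c p] nz by blast
  also have "chart_diff c x p ?w = lorentz X1 X1 *\<^sub>R X2 - lorentz X1 X2 *\<^sub>R X1"
    by (simp add: linear_diff[OF lin] linear_scale[OF lin] X1_def X2_def)
  also have "lorentz \<dots> \<dots> = lorentz X1 X1 * (lorentz X1 X1 * lorentz X2 X2 - lorentz X1 X2 * lorentz X1 X2)"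
    by (simp add: lorentz.diff_left lorentz.diff_right lorentz.scaleR_left lorentz.scaleR_right
        lorentz_commute[of X2 X1] algebra_simps)
  finally show "0 < lorentz X1 X1 * lorentz X2 X2 - lorentz X1 X2 * lorentz X1 X2"
    using 1 by (simp add: zero_less_mult_iff)
qed

lemma chart_diff_expand:
  assumes c: "c \<in> A" and p: "p \<in> fst c"
  shows "chart_diff c x p w = (w $ 1) *\<^sub>R chart_diff c x p E1 + (w $ 2) *\<^sub>R chart_diff c x p E2"
proof -
  have "w = (w $ 1) *\<^sub>R E1 + (w $ 2) *\<^sub>R E2"
    by (simp add: vec_eq_iff forall_2 axis_def)
  then have "chart_diff c x p w = chart_diff c x p ((w $ 1) *\<^sub>R E1 + (w $ 2) *\<^sub>R E2)" by simp
  also have "\<dots> = (w $ 1) *\<^sub>R chart_diff c x p E1 + (w $ 2) *\<^sub>R chart_diff c x p E2"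
    using x_chart_linear[OF c p] by (simp add: linear_add linear_scale)
  finally show ?thesis .
qed

text \<open>By Cramer's rule for the Gram matrix, the chart coordinates of a smooth tangent field are
  smooth.\<close>

lemma tangent_field_coords:
  assumes c: "c \<in> A" and W: "openin X W" and Y: "smooth_map W Y"
    and tang: "\<And>q. q \<in> W \<Longrightarrow> Y q \<in> tangent_space q"
  obtains y where "smooth_on (snd c ` (fst c \<inter> W)) y"
    and "\<And>q. q \<in> fst c \<inter> W \<Longrightarrow> chart_diff c x q (y (snd c q)) = Y q"
proof -
  let ?S = "snd c ` (fst c \<inter> W)"
  have S: "open ?S" by (rule open_chart_image[OF c W])
  define X1 where "X1 u = frechet_derivative (chart_rep c x) (at u) E1" for u
  define X2 where "X2 u = frechet_derivative (chart_rep c x) (at u) E2" for u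
  define Yc where "Yc = chart_rep c Y"
  have xs: "smooth_on ?S (chart_rep c x)"
    by (rule smooth_on_subset[OF x_chart_smooth[OF c]]) auto
  have s: "smooth_on ?S X1" "smooth_on ?S X2" "smooth_on ?S Yc"
    unfolding X1_def X2_def Yc_def
    by (auto intro: smooth_on_frechet_derivative[OF xs] smooth_mapD[OF Y c])
  note prods = lorentz.smooth_on_prod[OF S] bounded_bilinear.smooth_on_prod[OF bounded_bilinear_mult S]
  define D where "D u = lorentz (X1 u) (X1 u) * lorentz (X2 u) (X2 u) + (-1) * (lorentz (X1 u) (X2 u) * lorentz (X1 u) (X2 u))" for u
  define n1 where "n1 u = lorentz (X2 u) (X2 u) * lorentz (Yc u) (X1 u) + (-1) * (lorentz (X1 u) (X2 u) * lorentz (Yc u) (X2 u))" for u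
  define n2 where "n2 u = lorentz (X1 u) (X1 u) * lorentz (Yc u) (X2 u) + (-1) * (lorentz (X1 u) (X2 u) * lorentz (Yc u) (X1 u))" for u
  have sD: "smooth_on ?S D" unfolding D_def
    by (intro smooth_on_add[OF S] prods smooth_on_const s)
  have sn: "smooth_on ?S n1" "smooth_on ?S n2" unfolding n1_def n2_def
    by (intro smooth_on_add[OF S] prods smooth_on_const s)+
  have eval: "X1 (snd c q) = chart_diff c x q E1" "X2 (snd c q) = chart_diff c x q E2" for q
    by (auto simp: X1_def X2_def chart_diff_def)
  have Dpos: "0 < D u" if u: "u \<in> ?S" for u
  proof -
    obtain q where q: "u = snd c q" "q \<in> fst c" using u by auto
    show ?thesis using chart_gram_positive(2)[OF c q(2)] unfolding D_def q(1) eval by simp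
  qed
  have sinv: "smooth_on ?S (\<lambda>u. inverse (D u))" by (rule smooth_on_inverse[OF S sD Dpos])
  define y where "y u = (inverse (D u) * n1 u) *\<^sub>R E1 + (inverse (D u) * n2 u) *\<^sub>R E2" for u
  have "smooth_on ?S y" unfolding y_def
    by (intro smooth_on_add[OF S] bounded_bilinear.smooth_on_prod[OF bounded_bilinear_scaleR S] prods(2)
        sinv sn smooth_on_const)
  moreover have "chart_diff c x q (y (snd c q)) = Y q" if q: "q \<in> fst c \<inter> W" for q
  proof -
    let ?a = "chart_diff c x q E1" and ?b = "chart_diff c x q E2" and ?u = "snd c q"
    have qc: "q \<in> fst c" using q by simp
    obtain w where "Y q = chart_diff c x q w"
      using tang[of q] q tangent_space_chart[OF c qc] by auto
    then have Yq: "Y q = (w $ 1) *\<^sub>R ?a + (w $ 2) *\<^sub>R ?b" using chart_diff_expand[OF c qc] by metis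
    have Yc: "Yc ?u = Y q" unfolding Yc_def by (rule chart_rep_apply[OF c qc])
    have D0: "D ?u \<noteq> 0" using Dpos[of ?u] q by auto
    have "n1 ?u = w $ 1 * D ?u" "n2 ?u = w $ 2 * D ?u"
      unfolding n1_def n2_def D_def Yc Yq eval
      by (simp_all add: lorentz.add_left lorentz.scaleR_left lorentz_commute[of ?b ?a] algebra_simps)
    then have "y ?u $ 1 = w $ 1" "y ?u $ 2 = w $ 2" using D0 by (simp_all add: y_def axis_def)
    then show ?thesis using Yq chart_diff_expand[OF c qc, of "y ?u"] by simp
  qed
  ultimately show thesis by (rule that)
qed

text \<open>In each chart the field has smooth coordinates, and \<open>deriv_along_chart\<close>
  merges the pointwise choices \<open>chart_at q\<close> into one derivative of the chart
  representative.\<close>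

lemma smooth_map_deriv_along:
  assumes W: "openin X W" and Y: "smooth_map W Y" and f: "smooth_map W f"
    and tang: "\<And>q. q \<in> W \<Longrightarrow> Y q \<in> tangent_space q"
  shows "smooth_map W (\<lambda>q. deriv_along q (Y q) f)"
  unfolding smooth_map_def
proof
  fix c assume c: "c \<in> A"
  let ?S = "snd c ` (fst c \<inter> W)"
  have S: "open ?S" by (rule open_chart_image[OF c W])
  obtain y where y: "smooth_on ?S y" "\<And>q. q \<in> fst c \<inter> W \<Longrightarrow> chart_diff c x q (y (snd c q)) = Y q"
    using tangent_field_coords[OF c W Y tang] by blast
  show "smooth_on ?S (chart_rep c (\<lambda>q. deriv_along q (Y q) f))"
  proof (rule smooth_on_cong[OF S])
    show "smooth_on ?S (\<lambda>u. frechet_derivative (chart_rep c f) (at u) (y u))"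
      by (rule smooth_on_frechet_derivative_along[OF S smooth_mapD[OF f c] y(1)])
    fix u assume "u \<in> ?S"
    then obtain q where q: "u = snd c q" "q \<in> fst c" "q \<in> W" by auto
    show "frechet_derivative (chart_rep c f) (at u) (y u) = chart_rep c (\<lambda>q. deriv_along q (Y q) f) u"
      using deriv_along_chart[OF W f q(3) c q(2) y(2)] q
      by (simp add: chart_rep_apply[OF c] chart_diff_def)
  qed
qed

text \<open>In a fixed chart the commutator is the derivative along the coordinate bracket
  \<open>b\<close>. Applying this to \<open>x\<close> itself identifies the image of
  \<open>b\<close> with the ambient bracket, which is thereby tangent.\<close>

lemma deriv_along_commutator:
  assumes W: "openin X W" and p: "p \<in> W" and Y: "smooth_map W Y" and Z: "smooth_map W Z"
    and tang: "\<And>q. q \<in> W \<Longrightarrow> Y q \<in> tangent_space q" "\<And>q. q \<in> W \<Longrightarrow> Z q \<in> tangent_space q"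
  shows "bracket Y Z p \<in> tangent_space p"
    and "smooth_map W f \<Longrightarrow>
      deriv_along p (Y p) (\<lambda>q. deriv_along q (Z q) f) - deriv_along p (Z p) (\<lambda>q. deriv_along q (Y q) f) =
      deriv_along p (bracket Y Z p) f"
proof -
  have pX: "p \<in> topspace X" using p W openin_subset by blast
  define c where "c = chart_at p"
  have c: "c \<in> A" "p \<in> fst c" using chart_at[OF pX] by (auto simp: c_def)
  let ?S = "snd c ` (fst c \<inter> W)" and ?u = "snd c p"
  have S: "open ?S" "?u \<in> ?S" using open_chart_image[OF c(1) W] c p by auto
  obtain y where y: "smooth_on ?S y" "\<And>q. q \<in> fst c \<inter> W \<Longrightarrow> chart_diff c x q (y (snd c q)) = Y q"
    using tangent_field_coords[OF c(1) W Y tang(1)] by blast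
  obtain z where z: "smooth_on ?S z" "\<And>q. q \<in> fst c \<inter> W \<Longrightarrow> chart_diff c x q (z (snd c q)) = Z q"
    using tangent_field_coords[OF c(1) W Z tang(2)] by blast
  define b where "b = frechet_derivative z (at ?u) (y ?u) - frechet_derivative y (at ?u) (z ?u)"
  have two: "deriv_along p (V p) (\<lambda>q. deriv_along q (V' q) g) =
      frechet_derivative (\<lambda>u. frechet_derivative (chart_rep c g) (at u) (v' u)) (at ?u) (v ?u)"
    if g: "smooth_map W g" and V': "smooth_map W V'"
      and "\<And>q. q \<in> fst c \<inter> W \<Longrightarrow> chart_diff c x q (v (snd c q)) = V q"
      and v': "\<And>q. q \<in> fst c \<inter> W \<Longrightarrow> chart_diff c x q (v' (snd c q)) = V' q"
      and t: "\<And>q. q \<in> W \<Longrightarrow> V' q \<in> tangent_space q"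
    for g :: "'a \<Rightarrow> 'c::real_normed_vector" and V V' v v'
  proof -
    have "deriv_along p (V p) (\<lambda>q. deriv_along q (V' q) g) =
        chart_diff c (\<lambda>q. deriv_along q (V' q) g) p (v ?u)"
      by (rule deriv_along_chart[OF W smooth_map_deriv_along[OF W V' g t] p c]) (use that c p in auto)
    also have "\<dots> = frechet_derivative (\<lambda>u. frechet_derivative (chart_rep c g) (at u) (v' u)) (at ?u) (v ?u)"
      unfolding chart_diff_def
    proof (rule fun_cong[OF frechet_derivative_cong_open[OF S]])
      fix u assume "u \<in> ?S"
      then obtain q where q: "u = snd c q" "q \<in> fst c" "q \<in> W" by auto
      show "chart_rep c (\<lambda>q. deriv_along q (V' q) g) u = frechet_derivative (chart_rep c g) (at u) (v' u)"
        using deriv_along_chart[OF W g q(3) c(1) q(2) v'] q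
        by (simp add: chart_rep_apply[OF c(1)] chart_diff_def)
    qed
    finally show ?thesis .
  qed
  have main: "deriv_along p (Y p) (\<lambda>q. deriv_along q (Z q) g) - deriv_along p (Z p) (\<lambda>q. deriv_along q (Y q) g) =
      chart_diff c g p b" if g: "smooth_map W g" for g :: "'a \<Rightarrow> 'c::real_normed_vector"
  proof -
    have 1: "deriv_along p (Y p) (\<lambda>q. deriv_along q (Z q) g) =
      frechet_derivative (\<lambda>u. frechet_derivative (chart_rep c g) (at u) (z u)) (at ?u) (y ?u)"
      by (rule two[of g Z y Y z, OF g Z y(2) z(2) tang(2)])
    have 2: "deriv_along p (Z p) (\<lambda>q. deriv_along q (Y q) g) =
      frechet_derivative (\<lambda>u. frechet_derivative (chart_rep c g) (at u) (y u)) (at ?u) (z ?u)"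
      by (rule two[of g Y z Z y, OF g Y z(2) y(2) tang(1)])
    show ?thesis
      unfolding 1 2 b_def chart_diff_def
      by (rule frechet_derivative_commutator[OF S(1) smooth_mapD[OF g c(1)] y(1) z(1) S(2)])
  qed
  have xW: "smooth_map W x" by (rule smooth_map_subset[OF x_smooth openin_subset[OF W]])
  have dx: "deriv_along p v (\<lambda>q. deriv_along q (V q) x) = deriv_along p v V"
    if "\<And>q. q \<in> W \<Longrightarrow> V q \<in> tangent_space q" for v V
    by (rule deriv_along_cong[OF W p]) (use deriv_along_x that openin_subset[OF W] in auto)
  have b: "chart_diff c x p b = bracket Y Z p"
    unfolding bracket_def using main[OF xW] by (simp add: dx tang)
  then show "bracket Y Z p \<in> tangent_space p"
    unfolding tangent_space_chart[OF c] by (metis rangeI)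
  show "deriv_along p (Y p) (\<lambda>q. deriv_along q (Z q) f) - deriv_along p (Z p) (\<lambda>q. deriv_along q (Y q) f) =
      deriv_along p (bracket Y Z p) f" if f: "smooth_map W f"
    using main[OF f] deriv_along_chart[OF W f p c b] by simp
qed

end


section \<open>The structure equations in a moving frame\<close>

context spacelike_surface
begin

text \<open>An orthonormal pair is independent, and the tangent space is an injective linear image
  of \<open>real^2\<close>, so the pair spans it.\<close>

lemma tangent_expand:
  assumes p: "p \<in> topspace X" and a: "a \<in> tangent_space p" and b: "b \<in> tangent_space p"
    and on: "lorentz a a = 1" "lorentz b b = 1" "lorentz a b = 0" and v: "v \<in> tangent_space p"
  shows "v = lorentz v a *\<^sub>R a + lorentz v b *\<^sub>R b"
proof -
  have ba: "lorentz b a = 0" using on lorentz_commute by simp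
  have "a \<noteq> b" using on by auto
  have indep: "independent {a, b}"
  proof (rule independent_insertI)
    show "a \<notin> span {b}"
    proof
      assume "a \<in> span {b}"
      then obtain k where "a = k *\<^sub>R b" by (auto simp: span_singleton)
      then show False using on ba by (simp add: lorentz.scaleR_right)
    qed
    have "b \<noteq> 0" using on by (auto simp: lorentz.zero_left)
    then show "independent {b}" by simp
  qed
  have "dim (tangent_space p) = dim (UNIV :: (real^2) set)"
    unfolding tangent_space_def
    by (rule dim_image_eq[OF x_chart_linear[OF chart_at[OF p]]]) (simp add: inj_chart_at[OF p])
  then have "card {a, b} = dim (tangent_space p)" using \<open>a \<noteq> b\<close> by simp
  then have "tangent_space p \<subseteq> span {a, b}"
    using card_eq_dim[of "{a, b}" "tangent_space p"] indep a b by simp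
  then have "v \<in> span {a, b}" using v by auto
  then obtain k l where v: "v = k *\<^sub>R a + l *\<^sub>R b"
    unfolding span_insert[of a "{b}"] span_singleton by (auto simp: algebra_simps)
  then show ?thesis using on ba by (simp add: lorentz.add_left lorentz.scaleR_left)
qed

lemma normal_space_iff:
  assumes p: "p \<in> topspace X" and a: "a \<in> tangent_space p" and b: "b \<in> tangent_space p"
    and on: "lorentz a a = 1" "lorentz b b = 1" "lorentz a b = 0"
  shows "\<xi> \<in> normal_space p \<longleftrightarrow> lorentz \<xi> a = 0 \<and> lorentz \<xi> b = 0"
proof
  assume "lorentz \<xi> a = 0 \<and> lorentz \<xi> b = 0"
  then have "lorentz \<xi> v = 0" if "v \<in> tangent_space p" for v
    by (subst tangent_expand[OF p a b on that]) (simp add: lorentz.add_right lorentz.scaleR_right)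
  then show "\<xi> \<in> normal_space p" by (simp add: normal_space_def)
qed (use a b in \<open>simp add: normal_space_def\<close>)

lemma tan_part_eq:
  assumes p: "p \<in> topspace X" and a: "a \<in> tangent_space p" and b: "b \<in> tangent_space p"
    and on: "lorentz a a = 1" "lorentz b b = 1" "lorentz a b = 0"
  shows "tan_part p V = lorentz V a *\<^sub>R a + lorentz V b *\<^sub>R b"
  unfolding tan_part_def
proof (rule the_equality)
  have ba: "lorentz b a = 0" using on lorentz_commute by simp
  show "lorentz V a *\<^sub>R a + lorentz V b *\<^sub>R b \<in> tangent_space p \<and>
      V - (lorentz V a *\<^sub>R a + lorentz V b *\<^sub>R b) \<in> normal_space p"
    unfolding normal_space_iff[OF p a b on]
    using subspace_tangent_space[OF p] a b on ba
    by (simp add: subspace_add subspace_scale lorentz.add_left lorentz.diff_left lorentz.scaleR_left)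
next
  fix v assume v: "v \<in> tangent_space p \<and> V - v \<in> normal_space p"
  then have "lorentz v a = lorentz V a" "lorentz v b = lorentz V b"
    unfolding normal_space_iff[OF p a b on] by (simp_all add: lorentz.diff_left)
  then show "v = lorentz V a *\<^sub>R a + lorentz V b *\<^sub>R b"
    using tangent_expand[OF p a b on] v by metis
qed

end

section \<open>Gauss, Weingarten and Codazzi equations in a fixed tangent frame\<close>

locale framed_surface = spacelike_surface X A x
  for X :: "'a topology" and A :: "'a chart set" and x :: "'a \<Rightarrow> real^4" +
  fixes W :: "'a set" and e1 e2 :: "'a \<Rightarrow> real^4"
  assumes frame: "tangent_frame W e1 e2"
begin

lemma W: "openin X W"
  using frame by (simp add: tangent_frame_def)

lemma in_carrier: "p \<in> W \<Longrightarrow> p \<in> topspace X"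
  using openin_subset[OF W] by auto

lemma e_smooth: "smooth_map W e1" "smooth_map W e2"
  using frame by (simp_all add: tangent_frame_def)

lemma e_tangent: "p \<in> W \<Longrightarrow> e1 p \<in> tangent_space p" "p \<in> W \<Longrightarrow> e2 p \<in> tangent_space p"
  using frame by (simp_all add: tangent_frame_def)

lemma e_orthonormal:
  "p \<in> W \<Longrightarrow> lorentz (e1 p) (e1 p) = 1" "p \<in> W \<Longrightarrow> lorentz (e2 p) (e2 p) = 1"
  "p \<in> W \<Longrightarrow> lorentz (e1 p) (e2 p) = 0" "p \<in> W \<Longrightarrow> lorentz (e2 p) (e1 p) = 0"
  using frame by (simp_all add: tangent_frame_def lorentz_commute[of "e2 p" "e1 p"])

lemma tan_part_frame:
  "p \<in> W \<Longrightarrow> tan_part p V = lorentz V (e1 p) *\<^sub>R e1 p + lorentz V (e2 p) *\<^sub>R e2 p"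
  by (rule tan_part_eq[OF in_carrier e_tangent e_orthonormal(1-3)])

lemma normal_space_frame:
  "p \<in> W \<Longrightarrow> \<xi> \<in> normal_space p \<longleftrightarrow> lorentz \<xi> (e1 p) = 0 \<and> lorentz \<xi> (e2 p) = 0"
  by (rule normal_space_iff[OF in_carrier e_tangent e_orthonormal(1-3)])

lemma tangent_frame_expand:
  "p \<in> W \<Longrightarrow> v \<in> tangent_space p \<Longrightarrow> v = lorentz v (e1 p) *\<^sub>R e1 p + lorentz v (e2 p) *\<^sub>R e2 p"
  by (rule tangent_expand[OF in_carrier e_tangent e_orthonormal(1-3)])

lemma nor_part_frame:
  "p \<in> W \<Longrightarrow> nor_part p V = V - (lorentz V (e1 p) *\<^sub>R e1 p + lorentz V (e2 p) *\<^sub>R e2 p)"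
  by (simp add: nor_part_def tan_part_frame)

lemma nor_part_linear:
  assumes "p \<in> W"
  shows "nor_part p (V + V') = nor_part p V + nor_part p V'"
    and "nor_part p (V - V') = nor_part p V - nor_part p V'"
    and "nor_part p (k *\<^sub>R V) = k *\<^sub>R nor_part p V"
    and "nor_part p (- V) = - nor_part p V"
    and "nor_part p (e1 p) = 0" and "nor_part p (e2 p) = 0"
  using assms
  by (simp_all add: nor_part_frame lorentz.add_left lorentz.diff_left lorentz.scaleR_left
      lorentz.minus_left e_orthonormal algebra_simps)

lemma nor_part_normal: "p \<in> W \<Longrightarrow> \<xi> \<in> normal_space p \<Longrightarrow> nor_part p \<xi> = \<xi>"
  by (simp add: nor_part_frame normal_space_frame)

abbreviation d1 :: "('a \<Rightarrow> 'b::real_normed_vector) \<Rightarrow> 'a \<Rightarrow> 'b" where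
  "d1 f \<equiv> \<lambda>q. deriv_along q (e1 q) f"
abbreviation d2 :: "('a \<Rightarrow> 'b::real_normed_vector) \<Rightarrow> 'a \<Rightarrow> 'b" where
  "d2 f \<equiv> \<lambda>q. deriv_along q (e2 q) f"

lemma smooth_d: "smooth_map W f \<Longrightarrow> smooth_map W (d1 f)" "smooth_map W f \<Longrightarrow> smooth_map W (d2 f)"
  by (auto intro!: smooth_map_deriv_along W e_smooth e_tangent)

text \<open>\<open>w1\<close> and \<open>w2\<close> are the values of the connection form on
  \<open>e1\<close> and \<open>e2\<close>; \<open>h11\<close>, \<open>h12\<close>,
  \<open>h22\<close> are the components of the second fundamental form, written as derivatives minus
  their tangential parts so that smoothness is immediate. That the normal part of
  \<open>d2 e1\<close> is \<open>h12\<close> too is shown in \<open>frame_derivs\<close>.\<close>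

definition w1 :: "'a \<Rightarrow> real" where "w1 q = lorentz (d1 e1 q) (e2 q)"
definition w2 :: "'a \<Rightarrow> real" where "w2 q = lorentz (d2 e1 q) (e2 q)"
definition h11 :: "'a \<Rightarrow> real^4" where "h11 q = d1 e1 q - w1 q *\<^sub>R e2 q"
definition h12 :: "'a \<Rightarrow> real^4" where "h12 q = d1 e2 q + w1 q *\<^sub>R e1 q"
definition h22 :: "'a \<Rightarrow> real^4" where "h22 q = d2 e2 q + w2 q *\<^sub>R e1 q"

lemma smooth_w: "smooth_map W w1" "smooth_map W w2"
  unfolding w1_def w2_def
  by (intro smooth_map_bilinear[OF bounded_bilinear_lorentz] W smooth_d e_smooth)+

lemma smooth_h: "smooth_map W h11" "smooth_map W h12" "smooth_map W h22"
  unfolding h11_def h12_def h22_def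
  by (intro smooth_map_add smooth_map_diff smooth_map_scaleR W smooth_d e_smooth smooth_w)+

lemmas deriv_lorentz = deriv_along_bilinear[OF bounded_bilinear_lorentz W]
lemmas deriv_wedge = deriv_along_bilinear[OF bounded_bilinear_wedge W]
lemmas deriv_scaleR = deriv_along_bilinear[OF bounded_bilinear_scaleR W]

lemma deriv_orthogonal:
  assumes p: "p \<in> W" and f: "smooth_map W f" and g: "smooth_map W g"
    and k: "\<And>q. q \<in> W \<Longrightarrow> lorentz (f q) (g q) = k"
  shows "lorentz (deriv_along p v f) (g p) = - lorentz (f p) (deriv_along p v g)"
proof -
  have "deriv_along p v (\<lambda>q. lorentz (f q) (g q)) = deriv_along p v (\<lambda>q. k)"
    by (rule deriv_along_cong[OF W p k])
  then show ?thesis unfolding deriv_lorentz[OF p f g] deriv_along_const by linarith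
qed

lemma connection_coeffs:
  assumes p: "p \<in> W"
  shows "lorentz (deriv_along p v e1) (e1 p) = 0" "lorentz (deriv_along p v e2) (e2 p) = 0"
    "lorentz (deriv_along p v e2) (e1 p) = - lorentz (deriv_along p v e1) (e2 p)"
  using deriv_orthogonal[OF p e_smooth(1) e_smooth(1) e_orthonormal(1), of v]
    deriv_orthogonal[OF p e_smooth(2) e_smooth(2) e_orthonormal(2), of v]
    deriv_orthogonal[OF p e_smooth(2) e_smooth(1) e_orthonormal(4), of v]
  by (simp_all add: lorentz_commute)

lemma h_normal:
  assumes "p \<in> W"
  shows "h11 p \<in> normal_space p" "h12 p \<in> normal_space p" "h22 p \<in> normal_space p"
  unfolding normal_space_frame[OF assms] h11_def h12_def h22_def
  using assms connection_coeffs[OF assms]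
  by (simp_all add: lorentz.add_left lorentz.diff_left lorentz.scaleR_left e_orthonormal w1_def w2_def)

lemma h_orthogonal:
  assumes "p \<in> W"
  shows "lorentz (h11 p) (e1 p) = 0" "lorentz (h11 p) (e2 p) = 0"
    "lorentz (h12 p) (e1 p) = 0" "lorentz (h12 p) (e2 p) = 0"
    "lorentz (h22 p) (e1 p) = 0" "lorentz (h22 p) (e2 p) = 0"
  using h_normal[OF assms] by (simp_all add: normal_space_frame[OF assms])

lemma bracket_tangent: "p \<in> W \<Longrightarrow> bracket e1 e2 p \<in> tangent_space p"
  by (rule deriv_along_commutator(1)[OF W _ e_smooth e_tangent])

lemma bracket_frame:
  assumes p: "p \<in> W"
  shows "bracket e1 e2 p = (- w1 p) *\<^sub>R e1 p + (- w2 p) *\<^sub>R e2 p"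
  by (subst tangent_frame_expand[OF p bracket_tangent[OF p]])
     (simp add: bracket_def lorentz.diff_left connection_coeffs[OF p] w1_def w2_def)

lemma frame_derivs:
  assumes p: "p \<in> W"
  shows "d1 e1 p = w1 p *\<^sub>R e2 p + h11 p" "d1 e2 p = (- w1 p) *\<^sub>R e1 p + h12 p"
    "d2 e1 p = w2 p *\<^sub>R e2 p + h12 p" "d2 e2 p = (- w2 p) *\<^sub>R e1 p + h22 p"
proof -
  show "d1 e1 p = w1 p *\<^sub>R e2 p + h11 p" "d1 e2 p = (- w1 p) *\<^sub>R e1 p + h12 p"
    "d2 e2 p = (- w2 p) *\<^sub>R e1 p + h22 p"
    by (simp_all add: h11_def h12_def h22_def)
  \<comment> \<open>Symmetry of the second fundamental form: the bracket is tangent, so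
    \<open>d1 e2\<close> and \<open>d2 e1\<close> have the same normal part.\<close>
  show "d2 e1 p = w2 p *\<^sub>R e2 p + h12 p"
    using bracket_frame[OF p] unfolding bracket_def h12_def by (simp add: algebra_simps)
qed

text \<open>Weingarten formula: differentiating the orthogonality of \<open>h\<close> to the frame
  moves the derivative onto \<open>e1\<close> and \<open>e2\<close>, whose derivatives pair with
  \<open>h\<close> only through their normal parts.\<close>

lemma deriv_h_tangential:
  assumes p: "p \<in> W" and h: "smooth_map W h" and n: "\<And>q. q \<in> W \<Longrightarrow> h q \<in> normal_space q"
  shows "d1 h p = nor_part p (d1 h p) - lorentz (h p) (h11 p) *\<^sub>R e1 p - lorentz (h p) (h12 p) *\<^sub>R e2 p"
    "d2 h p = nor_part p (d2 h p) - lorentz (h p) (h12 p) *\<^sub>R e1 p - lorentz (h p) (h22 p) *\<^sub>R e2 p"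
proof -
  have o: "lorentz (h q) (e1 q) = 0" "lorentz (h q) (e2 q) = 0" if "q \<in> W" for q
    using n[OF that] normal_space_frame[OF that] by auto
  have "lorentz (deriv_along p v h) (e1 p) = - lorentz (h p) (deriv_along p v e1)"
    "lorentz (deriv_along p v h) (e2 p) = - lorentz (h p) (deriv_along p v e2)" for v
    by (rule deriv_orthogonal[OF p h e_smooth(1) o(1)] deriv_orthogonal[OF p h e_smooth(2) o(2)]; assumption)+
  then show "d1 h p = nor_part p (d1 h p) - lorentz (h p) (h11 p) *\<^sub>R e1 p - lorentz (h p) (h12 p) *\<^sub>R e2 p"
    "d2 h p = nor_part p (d2 h p) - lorentz (h p) (h12 p) *\<^sub>R e1 p - lorentz (h p) (h22 p) *\<^sub>R e2 p"
    using o[OF p]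
    by (simp_all add: nor_part_frame[OF p] frame_derivs[OF p] lorentz.add_right lorentz.scaleR_right
        lorentz.minus_right lorentz.diff_right)
qed

lemma deriv_h:
  assumes p: "p \<in> W"
  shows "d1 h11 p = nor_part p (d1 h11 p) - lorentz (h11 p) (h11 p) *\<^sub>R e1 p - lorentz (h11 p) (h12 p) *\<^sub>R e2 p"
    "d1 h12 p = nor_part p (d1 h12 p) - lorentz (h12 p) (h11 p) *\<^sub>R e1 p - lorentz (h12 p) (h12 p) *\<^sub>R e2 p"
    "d2 h12 p = nor_part p (d2 h12 p) - lorentz (h12 p) (h12 p) *\<^sub>R e1 p - lorentz (h12 p) (h22 p) *\<^sub>R e2 p"
    "d2 h22 p = nor_part p (d2 h22 p) - lorentz (h22 p) (h12 p) *\<^sub>R e1 p - lorentz (h22 p) (h22 p) *\<^sub>R e2 p"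
  by (rule deriv_h_tangential[OF p smooth_h(1) h_normal(1)] deriv_h_tangential[OF p smooth_h(2) h_normal(2)]
      deriv_h_tangential[OF p smooth_h(3) h_normal(3)]; assumption)+

lemma deriv_frame_combination:
  assumes p: "p \<in> W" and a: "smooth_map W a" and e: "smooth_map W e" and h: "smooth_map W h"
    and F: "\<And>q. q \<in> W \<Longrightarrow> F q = a q *\<^sub>R e q + h q"
  shows "deriv_along p v F = deriv_along p v a *\<^sub>R e p + a p *\<^sub>R deriv_along p v e + deriv_along p v h"
proof -
  have "deriv_along p v F = deriv_along p v (\<lambda>q. a q *\<^sub>R e q + h q)"
    by (rule deriv_along_cong[OF W p F])
  also have "\<dots> = deriv_along p v (\<lambda>q. a q *\<^sub>R e q) + deriv_along p v h"
    by (rule deriv_along_add[OF W p smooth_map_scaleR[OF W a e] h])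
  finally show ?thesis using deriv_scaleR[OF p a e] by simp
qed

lemma deriv_minus_real:
  "p \<in> W \<Longrightarrow> smooth_map W a \<Longrightarrow> deriv_along p v (\<lambda>q. - a q) = - deriv_along p v a"
  by (rule deriv_along_linear[OF bounded_linear_minus[OF bounded_linear_ident] W])

lemma second_derivs:
  assumes p: "p \<in> W"
  shows "deriv_along p v (d1 e1) = deriv_along p v w1 *\<^sub>R e2 p + w1 p *\<^sub>R deriv_along p v e2 + deriv_along p v h11"
    and "deriv_along p v (d1 e2) = - deriv_along p v w1 *\<^sub>R e1 p - w1 p *\<^sub>R deriv_along p v e1 + deriv_along p v h12"
    and "deriv_along p v (d2 e1) = deriv_along p v w2 *\<^sub>R e2 p + w2 p *\<^sub>R deriv_along p v e2 + deriv_along p v h12"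
    and "deriv_along p v (d2 e2) = - deriv_along p v w2 *\<^sub>R e1 p - w2 p *\<^sub>R deriv_along p v e1 + deriv_along p v h22"
proof -
  note m = smooth_map_minus[OF W]
  show "deriv_along p v (d1 e1) = deriv_along p v w1 *\<^sub>R e2 p + w1 p *\<^sub>R deriv_along p v e2 + deriv_along p v h11"
    by (rule deriv_frame_combination[OF p smooth_w(1) e_smooth(2) smooth_h(1) frame_derivs(1)])
  show "deriv_along p v (d2 e1) = deriv_along p v w2 *\<^sub>R e2 p + w2 p *\<^sub>R deriv_along p v e2 + deriv_along p v h12"
    by (rule deriv_frame_combination[OF p smooth_w(2) e_smooth(2) smooth_h(2) frame_derivs(3)])
  show "deriv_along p v (d1 e2) = - deriv_along p v w1 *\<^sub>R e1 p - w1 p *\<^sub>R deriv_along p v e1 + deriv_along p v h12"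
    using deriv_frame_combination[OF p m[OF smooth_w(1)] e_smooth(1) smooth_h(2), of "d1 e2"]
      frame_derivs(2) deriv_minus_real[OF p smooth_w(1)] by simp
  show "deriv_along p v (d2 e2) = - deriv_along p v w2 *\<^sub>R e1 p - w2 p *\<^sub>R deriv_along p v e1 + deriv_along p v h22"
    using deriv_frame_combination[OF p m[OF smooth_w(2)] e_smooth(1) smooth_h(3), of "d2 e2"]
      frame_derivs(4) deriv_minus_real[OF p smooth_w(2)] by simp
qed

lemma frame_commutator:
  assumes p: "p \<in> W" and f: "smooth_map W f"
  shows "d1 (d2 f) p - d2 (d1 f) p = (- w1 p) *\<^sub>R d1 f p + (- w2 p) *\<^sub>R d2 f p"
  using deriv_along_commutator(2)[OF W p e_smooth e_tangent f]
  unfolding bracket_frame[OF p] linear_deriv_along[OF W p f e_tangent(1)[OF p] e_tangent(2)[OF p]]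
  by simp

text \<open>The ambient connection is flat, so \<open>frame_commutator\<close> applies to
  \<open>e1\<close> and \<open>e2\<close> as vector-valued functions; the normal parts for
  \<open>e1\<close> and for \<open>e2\<close> give the two equations.\<close>

lemma codazzi:
  assumes p: "p \<in> W"
  shows "nor_part p (d1 h12 p) = nor_part p (d2 h11 p) + w1 p *\<^sub>R h22 p - w1 p *\<^sub>R h11 p - w2 p *\<^sub>R h12 p - w2 p *\<^sub>R h12 p"
    and "nor_part p (d2 h12 p) = nor_part p (d1 h22 p) + w1 p *\<^sub>R h12 p + w1 p *\<^sub>R h12 p + w2 p *\<^sub>R h22 p - w2 p *\<^sub>R h11 p"
proof -
  note N = nor_part_linear[OF p] nor_part_normal[OF p h_normal(1)[OF p]]
    nor_part_normal[OF p h_normal(2)[OF p]] nor_part_normal[OF p h_normal(3)[OF p]]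
  have "nor_part p (d1 (d2 e1) p - d2 (d1 e1) p) =
      w2 p *\<^sub>R h12 p + nor_part p (d1 h12 p) - (w1 p *\<^sub>R h22 p + nor_part p (d2 h11 p))"
    unfolding second_derivs(1,3)[OF p] frame_derivs[OF p] by (simp add: N)
  moreover have "nor_part p (d1 (d2 e1) p - d2 (d1 e1) p) = - w1 p *\<^sub>R h11 p - w2 p *\<^sub>R h12 p"
    unfolding frame_commutator[OF p e_smooth(1)] frame_derivs[OF p] by (simp add: N)
  ultimately have 1: "nor_part p (d1 h12 p) =
      - w1 p *\<^sub>R h11 p - w2 p *\<^sub>R h12 p + (w1 p *\<^sub>R h22 p + nor_part p (d2 h11 p)) - w2 p *\<^sub>R h12 p"
    by (simp add: algebra_simps)
  then show "nor_part p (d1 h12 p) = nor_part p (d2 h11 p) + w1 p *\<^sub>R h22 p - w1 p *\<^sub>R h11 p - w2 p *\<^sub>R h12 p - w2 p *\<^sub>R h12 p"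
    by (simp add: algebra_simps)
  have "nor_part p (d1 (d2 e2) p - d2 (d1 e2) p) =
      - w2 p *\<^sub>R h11 p + nor_part p (d1 h22 p) - (- w1 p *\<^sub>R h12 p + nor_part p (d2 h12 p))"
    unfolding second_derivs(2,4)[OF p] frame_derivs[OF p] by (simp add: N)
  moreover have "nor_part p (d1 (d2 e2) p - d2 (d1 e2) p) = - w1 p *\<^sub>R h12 p - w2 p *\<^sub>R h22 p"
    unfolding frame_commutator[OF p e_smooth(2)] frame_derivs[OF p] by (simp add: N)
  ultimately have 2: "nor_part p (d2 h12 p) = - w2 p *\<^sub>R h11 p + nor_part p (d1 h22 p) + w1 p *\<^sub>R h12 p
      - (- w1 p *\<^sub>R h12 p - w2 p *\<^sub>R h22 p)"
    by (simp add: algebra_simps)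
  then show "nor_part p (d2 h12 p) = nor_part p (d1 h22 p) + w1 p *\<^sub>R h12 p + w1 p *\<^sub>R h12 p + w2 p *\<^sub>R h22 p - w2 p *\<^sub>R h11 p"
    by (simp add: algebra_simps)
qed


text \<open>The intrinsic curvature is compared with the flat commutator of \<open>d1\<close> and
  \<open>d2\<close> on \<open>e2\<close>: the derivatives of \<open>w1\<close> and \<open>w2\<close>
  cancel, and only the Weingarten terms of \<open>h22\<close> and \<open>h12\<close> remain.\<close>

lemma gauss_equation:
  assumes p: "p \<in> W"
  shows "lorentz (curvature e1 e2 e2 p) (e1 p) = lorentz (h11 p) (h22 p) - lorentz (h12 p) (h12 p)"
proof -
  have n: "nabla e2 e2 q = - w2 q *\<^sub>R e1 q" "nabla e1 e2 q = - w1 q *\<^sub>R e1 q" if "q \<in> W" for q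
    unfolding nabla_def tan_part_frame[OF that] frame_derivs[OF that]
    by (simp_all add: lorentz.add_left lorentz.scaleR_left lorentz.minus_left lorentz.diff_left
        e_orthonormal[OF that] h_orthogonal[OF that])
  have D: "deriv_along p v (nabla e2 e2) = - deriv_along p v w2 *\<^sub>R e1 p - w2 p *\<^sub>R deriv_along p v e1"
    "deriv_along p v (nabla e1 e2) = - deriv_along p v w1 *\<^sub>R e1 p - w1 p *\<^sub>R deriv_along p v e1" for v
  proof -
    have m: "deriv_along p v (\<lambda>q. - a q *\<^sub>R e1 q) = - deriv_along p v a *\<^sub>R e1 p - a p *\<^sub>R deriv_along p v e1"
      if a: "smooth_map W a" for a
      using deriv_scaleR[OF p smooth_map_minus[OF W a] e_smooth(1), of v] deriv_minus_real[OF p a, of v]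
      by simp
    have "deriv_along p v (nabla e2 e2) = deriv_along p v (\<lambda>q. - w2 q *\<^sub>R e1 q)"
      "deriv_along p v (nabla e1 e2) = deriv_along p v (\<lambda>q. - w1 q *\<^sub>R e1 q)"
      by (rule deriv_along_cong[OF W p n(1)], assumption) (rule deriv_along_cong[OF W p n(2)])
    then show "deriv_along p v (nabla e2 e2) = - deriv_along p v w2 *\<^sub>R e1 p - w2 p *\<^sub>R deriv_along p v e1"
      "deriv_along p v (nabla e1 e2) = - deriv_along p v w1 *\<^sub>R e1 p - w1 p *\<^sub>R deriv_along p v e1"
      using m[OF smooth_w(1)] m[OF smooth_w(2)] by simp_all
  qed
  note b = bracket_frame[OF p] linear_deriv_along[OF W p e_smooth(2) e_tangent(1)[OF p] e_tangent(2)[OF p]]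
  note simps = lorentz.add_left lorentz.scaleR_left lorentz.minus_left lorentz.diff_left
    e_orthonormal[OF p] connection_coeffs[OF p]
  have "lorentz (curvature e1 e2 e2 p) (e1 p) =
      - d1 w2 p + d2 w1 p - lorentz ((- w1 p) *\<^sub>R d1 e2 p + (- w2 p) *\<^sub>R d2 e2 p) (e1 p)"
    unfolding curvature_def nabla_def[of _ "nabla _ _"] nabla_def[of "bracket e1 e2"] tan_part_frame[OF p] D b
    by (simp add: simps)
  also have "(- w1 p) *\<^sub>R d1 e2 p + (- w2 p) *\<^sub>R d2 e2 p = d1 (d2 e2) p - d2 (d1 e2) p"
    by (rule frame_commutator[OF p e_smooth(2), symmetric])
  also have "lorentz \<dots> (e1 p) = - d1 w2 p + d2 w1 p + lorentz (d1 h22 p) (e1 p) - lorentz (d2 h12 p) (e1 p)"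
    unfolding second_derivs[OF p] by (simp add: simps)
  also have "lorentz (d1 h22 p) (e1 p) = - lorentz (h22 p) (h11 p)"
    using deriv_orthogonal[OF p smooth_h(3) e_smooth(1) h_orthogonal(5)] frame_derivs[OF p] h_orthogonal[OF p]
    by (simp add: lorentz.add_right lorentz.scaleR_right)
  also have "lorentz (d2 h12 p) (e1 p) = - lorentz (h12 p) (h12 p)"
    using deriv_orthogonal[OF p smooth_h(2) e_smooth(1) h_orthogonal(3)] frame_derivs[OF p] h_orthogonal[OF p]
    by (simp add: lorentz.add_right lorentz.scaleR_right)
  finally show ?thesis by (simp add: lorentz_commute[of "h22 p"])
qed

definition T :: "'a \<Rightarrow> real^4^4" where "T q = wedge (e1 q) (e2 q)"

definition h_norm2 :: "'a \<Rightarrow> real" where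
  "h_norm2 q = lorentz (h11 q) (h11 q) + 2 * lorentz (h12 q) (h12 q) + lorentz (h22 q) (h22 q)"

text \<open>The expression under the choice operator in \<open>laplacian\<close>, taken for the
  fixed frame.\<close>

definition frame_laplacian :: "('a \<Rightarrow> 'b::real_normed_vector) \<Rightarrow> 'a \<Rightarrow> 'b" where
  "frame_laplacian f p = (deriv_along p (nabla e1 e1 p) f - d1 (d1 f) p) +
     (deriv_along p (nabla e2 e2 p) f - d2 (d2 f) p)"

lemma smooth_T: "smooth_map W T"
  unfolding T_def by (intro smooth_map_bilinear[OF bounded_bilinear_wedge] W e_smooth)

text \<open>The connection terms drop out, being multiples of \<open>wedge (e2 p) (e2 p)\<close> and
  \<open>wedge (e1 p) (e1 p)\<close>.\<close>

lemma deriv_T: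
  assumes p: "p \<in> W"
  shows "d1 T p = wedge (h11 p) (e2 p) + wedge (e1 p) (h12 p)"
    and "d2 T p = wedge (h12 p) (e2 p) + wedge (e1 p) (h22 p)"
  unfolding T_def deriv_wedge[OF p e_smooth] frame_derivs[OF p]
  by (simp_all add: wedge.add_left wedge.add_right wedge.scaleR_left wedge.scaleR_right
      wedge.diff_left wedge.diff_right)

lemma deriv_wedge_sum:
  assumes p: "p \<in> W" and s: "smooth_map W a" "smooth_map W b" "smooth_map W c" "smooth_map W d"
    and F: "\<And>q. q \<in> W \<Longrightarrow> F q = wedge (a q) (b q) + wedge (c q) (d q)"
  shows "deriv_along p v F = wedge (deriv_along p v a) (b p) + wedge (a p) (deriv_along p v b) +
    (wedge (deriv_along p v c) (d p) + wedge (c p) (deriv_along p v d))"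
proof -
  have "deriv_along p v F = deriv_along p v (\<lambda>q. wedge (a q) (b q) + wedge (c q) (d q))"
    by (rule deriv_along_cong[OF W p F])
  also have "\<dots> = deriv_along p v (\<lambda>q. wedge (a q) (b q)) + deriv_along p v (\<lambda>q. wedge (c q) (d q))"
    by (rule deriv_along_add[OF W p]; rule smooth_map_bilinear[OF bounded_bilinear_wedge W]; rule s)
  finally show ?thesis unfolding deriv_wedge[OF p s(1,2)] deriv_wedge[OF p s(3,4)] .
qed

text \<open>On differentiating \<open>d1 T\<close> and \<open>d2 T\<close> again, the Weingarten
  terms give the multiple of \<open>T\<close>, and products of two components of \<open>h\<close>
  give the normal curvature. Codazzi trades normal derivatives of \<open>h12\<close> for those of
  \<open>h11\<close> and \<open>h22\<close>, which completes the trace; all terms in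
  \<open>w1\<close>, \<open>w2\<close> cancel, including those from \<open>nabla\<close>.\<close>

lemma laplacian_T:
  assumes p: "p \<in> W"
  shows "frame_laplacian T p = h_norm2 p *\<^sub>R T p - 2 *\<^sub>R wedge (h11 p - h22 p) (h12 p)
    - wedge (nor_part p (d1 h11 p + d1 h22 p)) (e2 p) - wedge (e1 p) (nor_part p (d2 h11 p + d2 h22 p))"
proof -
  have n: "nabla e1 e1 p = 0 *\<^sub>R e1 p + w1 p *\<^sub>R e2 p" "nabla e2 e2 p = (- w2 p) *\<^sub>R e1 p + 0 *\<^sub>R e2 p"
    unfolding nabla_def tan_part_frame[OF p] frame_derivs[OF p]
    by (simp_all add: lorentz.add_left lorentz.scaleR_left lorentz.minus_left lorentz.diff_left
        e_orthonormal[OF p] h_orthogonal[OF p])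
  note nl = linear_deriv_along[OF W p smooth_T e_tangent(1)[OF p] e_tangent(2)[OF p]]
  note w = wedge.add_left wedge.add_right wedge.scaleR_left wedge.scaleR_right wedge.diff_left wedge.diff_right
    wedge.minus_left wedge.minus_right
  \<comment> \<open>The first index is the direction of differentiation, the other two name the
    component of \<open>h\<close>.\<close>
  define n111 n112 n122 n211 n212 n222 where "n111 = nor_part p (d1 h11 p)"
    and "n112 = nor_part p (d1 h12 p)" and "n122 = nor_part p (d1 h22 p)"
    and "n211 = nor_part p (d2 h11 p)" and "n212 = nor_part p (d2 h12 p)" and "n222 = nor_part p (d2 h22 p)"
  note dh = deriv_h[OF p, folded n111_def n211_def n112_def n212_def n122_def n222_def]
  note cod = codazzi[OF p, folded n112_def n212_def n122_def n211_def]
  have d11: "d1 (d1 T) p = wedge (d1 h11 p) (e2 p) + wedge (h11 p) (d1 e2 p) + (wedge (d1 e1 p) (h12 p) + wedge (e1 p) (d1 h12 p))"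
    by (rule deriv_wedge_sum[OF p smooth_h(1) e_smooth(2) e_smooth(1) smooth_h(2) deriv_T(1)])
  have d22: "d2 (d2 T) p = wedge (d2 h12 p) (e2 p) + wedge (h12 p) (d2 e2 p) + (wedge (d2 e1 p) (h22 p) + wedge (e1 p) (d2 h22 p))"
    by (rule deriv_wedge_sum[OF p smooth_h(2) e_smooth(2) e_smooth(1) smooth_h(3) deriv_T(2)])
  have N: "nor_part p (d1 h11 p + d1 h22 p) = n111 + n122" "nor_part p (d2 h11 p + d2 h22 p) = n211 + n222"
    by (simp_all add: nor_part_linear[OF p] n111_def n122_def n211_def n222_def)
  have comm: "wedge (h11 p) (e1 p) = - wedge (e1 p) (h11 p)" "wedge (h12 p) (e1 p) = - wedge (e1 p) (h12 p)"
    "wedge (e2 p) (h12 p) = - wedge (h12 p) (e2 p)" "wedge (e2 p) (h22 p) = - wedge (h22 p) (e2 p)"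
    "wedge (h22 p) (h12 p) = - wedge (h12 p) (h22 p)"
    by (rule wedge_commute)+
  \<comment> \<open>Doubled bivectors also occur as \<open>2 * M\<close> with the componentwise
    product of \<open>real^4^4\<close>; this aligns the two forms.\<close>
  have two: "(2 * l) *\<^sub>R M = l *\<^sub>R (2 * M)" for l and M :: "real^4^4"
    unfolding mult_2 by (simp only: scaleR_add_left scaleR_add_right)
  show ?thesis
    unfolding N
    unfolding frame_laplacian_def n nl d11 d22 deriv_T[OF p] frame_derivs[OF p] dh cod
    unfolding h_norm2_def T_def w comm mult_2 scaleR_2
    by (simp add: lorentz_commute[of "h22 p" "h12 p"] lorentz_commute[of "h12 p" "h11 p"]
        lorentz_commute[of "h22 p" "h11 p"] two algebra_simps)
qed

end


section \<open>The Hodge star of Minkowski space\<close>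

lemma det_4:
  "det (A::'a::comm_ring_1^4^4) =
    A$1$1 * (A$2$2 * (A$3$3 * A$4$4 - A$3$4 * A$4$3) - A$2$3 * (A$3$2 * A$4$4 - A$3$4 * A$4$2) + A$2$4 * (A$3$2 * A$4$3 - A$3$3 * A$4$2))
  - A$1$2 * (A$2$1 * (A$3$3 * A$4$4 - A$3$4 * A$4$3) - A$2$3 * (A$3$1 * A$4$4 - A$3$4 * A$4$1) + A$2$4 * (A$3$1 * A$4$3 - A$3$3 * A$4$1))
  + A$1$3 * (A$2$1 * (A$3$2 * A$4$4 - A$3$4 * A$4$2) - A$2$2 * (A$3$1 * A$4$4 - A$3$4 * A$4$1) + A$2$4 * (A$3$1 * A$4$2 - A$3$2 * A$4$1))
  - A$1$4 * (A$2$1 * (A$3$2 * A$4$3 - A$3$3 * A$4$2) - A$2$2 * (A$3$1 * A$4$3 - A$3$3 * A$4$1) + A$2$3 * (A$3$1 * A$4$2 - A$3$2 * A$4$1))"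
proof -
  have f1234: "finite {2::4, 3, 4}" "1 \<notin> {2::4, 3, 4}" by auto
  have f234: "finite {3::4, 4}" "2 \<notin> {3::4, 4}" by auto
  have f34: "finite {4::4}" "3 \<notin> {4::4}" by auto
  show ?thesis
    unfolding det_def UNIV_4
    unfolding sum_over_permutations_insert[OF f1234]
    unfolding sum_over_permutations_insert[OF f234]
    unfolding sum_over_permutations_insert[OF f34]
    unfolding permutes_sing
    by (simp add: sign_swap_id permutation_swap_id sign_compose sign_id swap_id_eq permutation_compose algebra_simps)
qed

lemma vector_4 [simp]:
  "(vector [a, b, c, d] :: 'a::zero^4) $ 1 = a" "(vector [a, b, c, d] :: 'a^4) $ 2 = b"
  "(vector [a, b, c, d] :: 'a^4) $ 3 = c" "(vector [a, b, c, d] :: 'a^4) $ 4 = d"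
  unfolding vector_def by simp_all

text \<open>The Gram matrix factors as \<open>M ** \<eta> ** transpose N\<close>, where
  \<open>\<eta>\<close> is the matrix of the Minkowski metric, of determinant
  \<open>-1\<close>.\<close>

lemma lorentz_gram_det:
  "det (\<chi> i j. lorentz (vector [a, b, c, d] $ i) (vector [a', b', c', d'] $ j) :: real^4^4) =
    - det (vector [a, b, c, d]) * det (vector [a', b', c', d'])"
proof -
  let ?H = "(\<chi> i j. if i = j then (if i = 1 then -1 else 1) else 0) :: real^4^4"
  have "det ?H = (\<Prod>i\<in>UNIV. ?H $ i $ i)" by (rule det_diagonal) simp
  also have "\<dots> = -1" unfolding UNIV_4 by simp
  finally have H: "det ?H = -1" .
  have eq: "(\<chi> i j. lorentz (vector [a, b, c, d] $ i) (vector [a', b', c', d'] $ j)) =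
      (vector [a, b, c, d] :: real^4^4) ** ?H ** transpose (vector [a', b', c', d'])"
    by (simp add: vec_eq_iff matrix_matrix_mult_def transpose_def lorentz_def sum_4)
  show ?thesis by (rule trans[OF arg_cong[where f=det, OF eq]]) (simp add: det_mul H)
qed

text \<open>On skew matrices this is a Hodge star for the signature \<open>(-,+,+,+)\<close>.
  Keeping the diagonal and filling the lower triangle from transposed entries makes it linear and
  injective on all matrices, so that skewness need not be tracked.\<close>

definition star :: "real^4^4 \<Rightarrow> real^4^4" where
  "star B = vector [
    vector [B$1$1, B$3$4, - B$2$4, B$2$3],
    vector [B$4$3, B$2$2, - B$1$4, B$1$3],
    vector [- B$4$2, - B$4$1, B$3$3, - B$1$2],
    vector [B$3$2, B$3$1, - B$2$1, B$4$4]]"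

lemma bounded_linear_star: "bounded_linear star"
  unfolding linear_conv_bounded_linear[symmetric] by (auto intro!: linearI simp: star_def vec_eq_iff forall_4)

lemma inj_star: "star B = star C \<Longrightarrow> B = C"
  by (simp add: star_def vec_eq_iff forall_4)

text \<open>By orthonormality, the Gram determinant of \<open>a, b, v, w\<close> against
  \<open>a, b, c, d\<close> reduces to the pairing of \<open>wedge v w\<close> with
  \<open>wedge c d\<close>. Basis vectors for \<open>v, w\<close> then express the coordinates of
  \<open>wedge c d\<close> by complementary minors of \<open>a, b\<close>.\<close>

lemma star_wedge:
  assumes on: "lorentz a a = 1" "lorentz b b = 1" "lorentz a b = 0"
    "lorentz c a = 0" "lorentz c b = 0" "lorentz d a = 0" "lorentz d b = 0"
    "\<bar>lorentz c c\<bar> = 1" "\<bar>lorentz d d\<bar> = 1" "lorentz c d = 0"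
    and pos: "0 < det (vector [a, b, c, d] :: real^4^4)"
  shows "wedge c d = star (wedge a b)"
proof -
  let ?D = "det (vector [a, b, c, d] :: real^4^4)"
  have sym: "lorentz b a = 0" "lorentz a c = 0" "lorentz b c = 0" "lorentz a d = 0" "lorentz b d = 0" "lorentz d c = 0"
    using on by (simp_all add: lorentz_commute)
  \<comment> \<open>Which of \<open>c\<close> and \<open>d\<close> is time-like stays open: the
    absolute value of the squared determinant suffices, and \<open>pos\<close> fixes the sign of
    \<open>?D\<close>.\<close>
  have "- ?D * ?D = lorentz c c * lorentz d d"
    unfolding lorentz_gram_det[symmetric] by (simp add: det_4 on sym)
  moreover have "\<bar>lorentz c c * lorentz d d\<bar> = 1" using on by (simp add: abs_mult)
  ultimately have "\<bar>- ?D * ?D\<bar> = 1" by metis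
  then have "?D * ?D = 1" using pos by (simp add: abs_mult)
  then have D: "?D = 1" using pos by (simp add: square_eq_1_iff)
  have key: "- det (vector [a, b, v, w] :: real^4^4) = lorentz v c * lorentz w d - lorentz v d * lorentz w c" for v w
    using lorentz_gram_det[of a b v w a b c d] by (simp add: det_4[of "\<chi> i j. _ i j"] on sym D)
  show ?thesis
    unfolding vec_eq_iff forall_4
    using key[of "axis 1 1" "axis 2 1"] key[of "axis 1 1" "axis 3 1"] key[of "axis 1 1" "axis 4 1"]
     key[of "axis 2 1" "axis 3 1"] key[of "axis 2 1" "axis 4 1"] key[of "axis 3 1" "axis 4 1"]
    unfolding det_4
    by (simp add: star_def wedge_def lorentz_def axis_def algebra_simps)
qed

text \<open>On bivectors this is the interior product with the covector dual to \<open>v\<close>. It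
  serves to construct a fourth frame vector and to separate the components of a bivector.\<close>

definition lorentz_contract :: "real^4^4 \<Rightarrow> real^4 \<Rightarrow> real^4" where
  "lorentz_contract M v = (\<chi> i. - (M$i$1 * v$1) + M$i$2 * v$2 + M$i$3 * v$3 + M$i$4 * v$4)"

lemma bounded_bilinear_lorentz_contract: "bounded_bilinear lorentz_contract"
proof -
  have "bilinear lorentz_contract"
    by (auto simp: bilinear_def lorentz_contract_def vec_eq_iff algebra_simps intro!: linearI)
  then show ?thesis by (simp add: bilinear_conv_bounded_bilinear)
qed

lemma lorentz_contract_wedge: "lorentz_contract (wedge a b) v = lorentz b v *\<^sub>R a - lorentz a v *\<^sub>R b"
  by (simp add: lorentz_contract_def wedge_def lorentz_def vec_eq_iff algebra_simps)

text \<open>The vector \<open>lorentz_contract (star (wedge a b)) c\<close> is the Lorentzian cross product of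
  \<open>a, b, c\<close>.\<close>

lemma lorentz_cross:
  "lorentz (lorentz_contract (star (wedge a b)) c) v = det (vector [a, b, c, v] :: real^4^4)"
  by (simp add: lorentz_contract_def star_def wedge_def lorentz_def det_4 algebra_simps)

text \<open>The squared length of the cross product is minus the Gram determinant of
  \<open>a, b, c\<close>, which is \<open>-1\<close> here. By \<open>lorentz_cross\<close> the same
  number is the determinant of the whole frame, whence the orientation.\<close>

lemma lorentz_cross_norm:
  assumes on: "lorentz a a = 1" "lorentz b b = 1" "lorentz a b = 0"
    "lorentz c a = 0" "lorentz c b = 0" "lorentz c c = -1"
  defines "d \<equiv> lorentz_contract (star (wedge a b)) c"
  shows "lorentz d a = 0" "lorentz d b = 0" "lorentz c d = 0" "lorentz d d = 1"
    "0 < det (vector [a, b, c, d] :: real^4^4)"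
proof -
  have orth: "lorentz d a = 0" "lorentz d b = 0" "lorentz d c = 0"
    unfolding d_def lorentz_cross by (simp_all add: det_4 algebra_simps)
  then show "lorentz d a = 0" "lorentz d b = 0" "lorentz c d = 0" by (simp_all add: lorentz_commute)
  have "lorentz d d = - det (vector [vector [lorentz a a, lorentz a b, lorentz a c],
     vector [lorentz a b, lorentz b b, lorentz b c], vector [lorentz a c, lorentz b c, lorentz c c]] :: real^3^3)"
    unfolding d_def lorentz_cross by (simp add: lorentz_contract_def star_def wedge_def lorentz_def det_4 det_3) algebra
  then show dd: "lorentz d d = 1" using on by (simp add: det_3 lorentz_commute)
  show "0 < det (vector [a, b, c, d] :: real^4^4)"
    using dd lorentz_cross[of a b c d] by (simp add: d_def)
qed


section \<open>Local frames and the Gauss map\<close>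

context oriented_surface
begin

text \<open>Smooth maps are continuous in a chart, and charts are homeomorphisms, so preimages can
  be taken in the chart image and pulled back to \<open>X\<close>.\<close>

lemma smooth_map_neighbourhood:
  assumes W: "openin X W" and f: "smooth_map W f" and B: "open B" and p: "p \<in> W" "f p \<in> B"
  obtains V where "openin X V" "p \<in> V" "V \<subseteq> W" "\<And>q. q \<in> V \<Longrightarrow> f q \<in> B"
proof -
  define c where "c = chart_at p"
  have pX: "p \<in> topspace X" using openin_subset[OF W] p by auto
  have c: "c \<in> A" "p \<in> fst c" using chart_at[OF pX] by (auto simp: c_def)
  let ?S = "snd c ` (fst c \<inter> W)"
  have S: "open ?S" by (rule open_chart_image[OF c(1) W])
  define R where "R = {u \<in> ?S. chart_rep c f u \<in> B}"
  have "open (chart_rep c f -` B \<inter> ?S)"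
    using smooth_on_continuous_on[OF smooth_mapD[OF f c(1)]] S B continuous_on_open_vimage by blast
  moreover have "R = chart_rep c f -` B \<inter> ?S" by (auto simp: R_def)
  ultimately have R: "open R" by simp
  show thesis
  proof (rule that[of "{q \<in> fst c. snd c q \<in> R}"])
    show "openin X {q \<in> fst c. snd c q \<in> R}" by (rule open_chart_preimage[OF c(1) R])
    show "p \<in> {q \<in> fst c. snd c q \<in> R}"
      using c p by (auto simp: R_def chart_rep_apply)
    have inj: "q \<in> W" if q: "q \<in> fst c" "snd c q \<in> ?S" for q
      using q chart_inj[OF c(1)] by (auto dest: inj_onD)
    then show "{q \<in> fst c. snd c q \<in> R} \<subseteq> W" by (auto simp: R_def)
    show "f q \<in> B" if "q \<in> {q \<in> fst c. snd c q \<in> R}" for q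
      using that chart_rep_apply[OF c(1), of q f] by (simp add: R_def)
  qed
qed

end

section \<open>Existence of positive and of adapted frames\<close>

context spacelike_surface
begin

definition positive_frame :: "'a set \<Rightarrow> ('a \<Rightarrow> real^4) \<Rightarrow> ('a \<Rightarrow> real^4) \<Rightarrow> bool" where
  "positive_frame W e1 e2 \<longleftrightarrow> tangent_frame W e1 e2 \<and>
     (\<forall>q\<in>W. 0 < det (vector [tangent_coords q (e1 q), tangent_coords q (e2 q)] :: real^2^2))"

lemma smooth_chart_vector:
  assumes c: "c \<in> A" shows "smooth_map (fst c) (\<lambda>q. chart_diff c x q w)"
proof (rule smooth_map_in_chart[OF c])
  show "openin X (fst c)" using chart_open[OF c] by simp
  have S: "open (snd c ` fst c)" using chart_open[OF c] by simp
  show "smooth_on (snd c ` fst c) (chart_rep c (\<lambda>q. chart_diff c x q w))"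
    by (rule smooth_on_cong[OF S _ smooth_on_frechet_derivative[OF x_chart_smooth[OF c], of w]])
       (auto simp: chart_rep_apply[OF c] chart_diff_def)
qed simp

text \<open>Gram-Schmidt on the coordinate fields of a chart. The change of basis is triangular with
  positive diagonal \<open>r\<close>, \<open>s\<close>, and the atlas is oriented, so positivity
  also holds in the coordinates of \<open>chart_at q\<close> at each \<open>q\<close>.\<close>

lemma exists_positive_frame:
  assumes p: "p \<in> topspace X"
  obtains W e1 e2 where "p \<in> W" "positive_frame W e1 e2"
proof -
  define c where "c = chart_at p"
  have c: "c \<in> A" "p \<in> fst c" using chart_at[OF p] by (auto simp: c_def)
  have W: "openin X (fst c)" using chart_open[OF c(1)] by simp
  define X1 where "X1 q = chart_diff c x q E1" for q
  define X2 where "X2 q = chart_diff c x q E2" for q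
  have sX: "smooth_map (fst c) X1" "smooth_map (fst c) X2"
    unfolding X1_def X2_def by (rule smooth_chart_vector[OF c(1)])+
  note lin = x_chart_linear[OF c(1)]
  define r where "r q = inverse (sqrt (lorentz (X1 q) (X1 q)))" for q
  define f1 where "f1 q = r q *\<^sub>R X1 q" for q
  define k where "k q = lorentz (X2 q) (f1 q)" for q
  define Y where "Y q = X2 q - k q *\<^sub>R f1 q" for q
  define s where "s q = inverse (sqrt (lorentz (Y q) (Y q)))" for q
  define f2 where "f2 q = s q *\<^sub>R Y q" for q
  have g1: "0 < lorentz (X1 q) (X1 q)" if "q \<in> fst c" for q
    unfolding X1_def by (rule chart_gram_positive(1)[OF c(1) that])
  have r: "r q > 0" "r q * r q * lorentz (X1 q) (X1 q) = 1" if "q \<in> fst c" for q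
    using g1[OF that] by (simp_all add: r_def field_simps)
  have f11: "lorentz (f1 q) (f1 q) = 1" if "q \<in> fst c" for q
    using r(2)[OF that] by (simp add: f1_def lorentz.scaleR_left lorentz.scaleR_right mult_ac)
  have Yf: "lorentz (f1 q) (Y q) = 0" if "q \<in> fst c" for q
    using f11[OF that] by (simp add: Y_def k_def lorentz.diff_right lorentz.scaleR_right lorentz_commute)
  have YY: "0 < lorentz (Y q) (Y q)" if q: "q \<in> fst c" for q
  proof -
    have "lorentz (Y q) (Y q) = lorentz (X2 q) (X2 q) - k q * k q"
      using f11[OF q] unfolding Y_def k_def
      by (simp add: lorentz.diff_right lorentz.diff_left lorentz.scaleR_left lorentz.scaleR_right lorentz_commute)
    also have "k q * k q = (r q * r q) * (lorentz (X1 q) (X2 q) * lorentz (X1 q) (X2 q))"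
      by (simp add: k_def f1_def lorentz.scaleR_right lorentz_commute)
    finally have Y: "lorentz (Y q) (Y q) = lorentz (X2 q) (X2 q) - (r q * r q) * (lorentz (X1 q) (X2 q) * lorentz (X1 q) (X2 q))" .
    \<comment> \<open>Since \<open>r q * r q * lorentz (X1 q) (X1 q) = 1\<close>, the right-hand
      side is the Gram determinant of the coordinate fields.\<close>
    have "lorentz (X1 q) (X1 q) * lorentz (Y q) (Y q) = lorentz (X1 q) (X1 q) * lorentz (X2 q) (X2 q)
        - (r q * r q * lorentz (X1 q) (X1 q)) * (lorentz (X1 q) (X2 q) * lorentz (X1 q) (X2 q))"
      unfolding Y by algebra
    also have "\<dots> > 0"
      using chart_gram_positive(2)[OF c(1) q, folded X1_def X2_def] unfolding r(2)[OF q] by simp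
    finally show ?thesis using g1[OF q] by (simp add: zero_less_mult_iff)
  qed
  have s: "s q > 0" "s q * s q * lorentz (Y q) (Y q) = 1" if "q \<in> fst c" for q
    using YY[OF that] by (simp_all add: s_def field_simps)
  note sl = smooth_map_bilinear[OF bounded_bilinear_lorentz W]
  have sr: "smooth_map (fst c) r" unfolding r_def
    by (rule smooth_map_inverse_sqrt[OF W sl[OF sX(1) sX(1)] g1])
  have sf1: "smooth_map (fst c) f1" unfolding f1_def by (rule smooth_map_scaleR[OF W sr sX(1)])
  have sk: "smooth_map (fst c) k" unfolding k_def by (rule sl[OF sX(2) sf1])
  have sY: "smooth_map (fst c) Y" unfolding Y_def
    by (rule smooth_map_diff[OF W sX(2) smooth_map_scaleR[OF W sk sf1]])
  have ss: "smooth_map (fst c) s" unfolding s_def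
    by (rule smooth_map_inverse_sqrt[OF W sl[OF sY sY] YY])
  have sf2: "smooth_map (fst c) f2" unfolding f2_def by (rule smooth_map_scaleR[OF W ss sY])
  have c1: "chart_diff c x q (r q *\<^sub>R E1) = f1 q" if "q \<in> fst c" for q
    by (simp add: linear_scale[OF lin[OF that]] f1_def X1_def)
  have c2: "chart_diff c x q (s q *\<^sub>R (E2 - (k q * r q) *\<^sub>R E1)) = f2 q" if "q \<in> fst c" for q
    by (simp add: linear_scale[OF lin[OF that]] linear_diff[OF lin[OF that]] f2_def Y_def f1_def X1_def X2_def)
  have "tangent_frame (fst c) f1 f2"
    unfolding tangent_frame_def
  proof (intro conjI ballI W sf1 sf2)
    fix q assume q: "q \<in> fst c"
    show "f1 q \<in> tangent_space q" "f2 q \<in> tangent_space q"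
      unfolding tangent_space_chart[OF c(1) q] by (metis c1 c2 q rangeI)+
    show "lorentz (f1 q) (f1 q) = 1" by (rule f11[OF q])
    show "lorentz (f2 q) (f2 q) = 1"
      using s(2)[OF q] by (simp add: f2_def lorentz.scaleR_left lorentz.scaleR_right mult_ac)
    show "lorentz (f1 q) (f2 q) = 0"
      using Yf[OF q] by (simp add: f2_def lorentz.scaleR_right)
  qed
  moreover have "0 < det (vector [tangent_coords q (f1 q), tangent_coords q (f2 q)] :: real^2^2)" if q: "q \<in> fst c" for q
  proof -
    have qX: "q \<in> topspace X" using chart_subset[OF c(1)] q by auto
    note d = chart_at[OF qX]
    let ?J = "chart_diff c (snd (chart_at q)) q"
    have "chart_rep c (snd (chart_at q)) differentiable (at (snd c q))"
      by (rule smooth_on_differentiable[OF transition_smooth[OF c(1) d(1)]]) (use d q in auto)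
    then have J: "linear ?J" unfolding chart_diff_def by (rule linear_frechet_derivative)
    have pos: "0 < det (matrix ?J)" by (rule transition_orientation[OF c(1) d(1) q d(2)])
    have "det (vector [tangent_coords q (f1 q), tangent_coords q (f2 q)] :: real^2^2) = r q * s q * det (matrix ?J)"
      unfolding tangent_coords_transition[OF c(1) q c1[OF q]] tangent_coords_transition[OF c(1) q c2[OF q]]
      by (simp add: linear_scale[OF J] linear_diff[OF J] det_2 matrix_def algebra_simps)
    then show ?thesis using pos r(1)[OF q] s(1)[OF q] by simp
  qed
  ultimately have "positive_frame (fst c) f1 f2" by (simp add: positive_frame_def)
  then show thesis by (rule that[OF c(2)])
qed

text \<open>Because the tangent plane is space-like, the normal part \<open>n\<close> of the time
  direction \<open>b\<close> is time-like and never zero. Normalised it gives \<open>e3\<close>, and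
  the Lorentzian cross product adds \<open>e4\<close> with the right orientation.\<close>

lemma positive_frame_adapted:
  assumes pf: "positive_frame W e1 e2"
  obtains e3 e4 where "oriented_adapted_frame W e1 e2 e3 e4"
proof -
  have fr: "tangent_frame W e1 e2" using pf by (simp add: positive_frame_def)
  then interpret framed_surface X A x W e1 e2 by unfold_locales
  define b :: "real^4" where "b = axis 1 1"
  define n where "n q = b - lorentz b (e1 q) *\<^sub>R e1 q - lorentz b (e2 q) *\<^sub>R e2 q" for q
  define m where "m q = - lorentz (n q) (n q)" for q
  define e3 where "e3 q = inverse (sqrt (m q)) *\<^sub>R n q" for q
  define e4 where "e4 q = lorentz_contract (star (wedge (e1 q) (e2 q))) (e3 q)" for q
  have bb: "lorentz b b = -1" by (simp add: b_def lorentz_def axis_def)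
  have ne: "lorentz (n q) (e1 q) = 0" "lorentz (n q) (e2 q) = 0" if "q \<in> W" for q
    by (simp_all add: n_def lorentz.diff_left lorentz.scaleR_left e_orthonormal[OF that])
  have m: "0 < m q" if q: "q \<in> W" for q
  proof -
    have "lorentz (n q) (n q) = lorentz (n q) b"
      by (subst (2) n_def) (simp add: lorentz.diff_right lorentz.scaleR_right ne[OF q])
    also have "\<dots> = - 1 - (lorentz b (e1 q))\<^sup>2 - (lorentz b (e2 q))\<^sup>2"
      by (simp add: n_def lorentz.diff_left lorentz.scaleR_left bb power2_eq_square
          lorentz_commute[of "e1 q" b] lorentz_commute[of "e2 q" b])
    finally show ?thesis
      using zero_le_power2[of "lorentz b (e1 q)"] zero_le_power2[of "lorentz b (e2 q)"] unfolding m_def by linarith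
  qed
  note sl = smooth_map_bilinear[OF bounded_bilinear_lorentz W]
  have sn: "smooth_map W n" unfolding n_def
    by (intro smooth_map_diff smooth_map_scaleR sl smooth_map_const W e_smooth)
  have sm: "smooth_map W m" unfolding m_def by (intro smooth_map_minus sl W sn)
  have s3: "smooth_map W e3" unfolding e3_def
    by (rule smooth_map_scaleR[OF W smooth_map_inverse_sqrt[OF W sm m] sn])
  have s4: "smooth_map W e4" unfolding e4_def
    by (rule smooth_map_bilinear[OF bounded_bilinear_lorentz_contract W
          smooth_map_linear[OF bounded_linear_star W smooth_map_bilinear[OF bounded_bilinear_wedge W e_smooth]] s3])
  have "oriented_adapted_frame W e1 e2 e3 e4"
    unfolding oriented_adapted_frame_def
  proof (intro conjI ballI fr s3 s4)
    fix q assume q: "q \<in> W"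
    have e3: "lorentz (e3 q) (e1 q) = 0" "lorentz (e3 q) (e2 q) = 0"
      by (simp_all add: e3_def lorentz.scaleR_left ne[OF q])
    have "inverse (sqrt (m q)) * inverse (sqrt (m q)) * m q = 1"
      using m[OF q] by (simp add: field_simps)
    then have e33: "lorentz (e3 q) (e3 q) = -1"
      by (simp add: e3_def lorentz.scaleR_left lorentz.scaleR_right m_def mult_ac)
    note cross = lorentz_cross_norm[OF e_orthonormal(1)[OF q] e_orthonormal(2)[OF q] e_orthonormal(3)[OF q] e3 e33,
        folded e4_def]
    show "e3 q \<in> normal_space q" "e4 q \<in> normal_space q"
      unfolding normal_space_frame[OF q] using e3 cross by simp_all
    show "\<bar>lorentz (e3 q) (e3 q)\<bar> = 1" "\<bar>lorentz (e4 q) (e4 q)\<bar> = 1" "lorentz (e3 q) (e4 q) = 0"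
      using e33 cross by simp_all
    show "0 < det (vector [e1 q, e2 q, e3 q, e4 q] :: real^4^4)" by (rule cross(5))
    show "0 < det (vector [tangent_coords q (e1 q), tangent_coords q (e2 q)] :: real^2^2)"
      using pf q by (simp add: positive_frame_def)
  qed
  then show thesis by (rule that)
qed

lemma tangent_coords_linear:
  assumes p: "p \<in> topspace X" and "v \<in> tangent_space p" "w \<in> tangent_space p"
  shows "tangent_coords p (a *\<^sub>R v + b *\<^sub>R w) = a *\<^sub>R tangent_coords p v + b *\<^sub>R tangent_coords p w"
  using x_chart_linear[OF chart_at[OF p]] assms
  by (intro tangent_coords_eq[OF p]) (simp add: linear_add linear_scale tangent_coords)

end

section \<open>The sign of a frame and the Gauss map\<close>

context framed_surface
begin

text \<open>\<open>\<sigma>\<close> is the determinant of an orthogonal change of basis of the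
  tangent plane; the bivector and the orientation both change by this factor.\<close>

lemma orthonormal_pair:
  assumes q: "q \<in> W" and a: "a \<in> tangent_space q" and b: "b \<in> tangent_space q"
    and on: "lorentz a a = 1" "lorentz b b = 1" "lorentz a b = 0"
  defines "\<sigma> \<equiv> lorentz a (e1 q) * lorentz b (e2 q) - lorentz a (e2 q) * lorentz b (e1 q)"
  shows "\<sigma> * \<sigma> = 1" "wedge a b = \<sigma> *\<^sub>R wedge (e1 q) (e2 q)"
    "det (vector [tangent_coords q a, tangent_coords q b] :: real^2^2) =
       \<sigma> * det (vector [tangent_coords q (e1 q), tangent_coords q (e2 q)] :: real^2^2)"
proof -
  define a1 a2 b1 b2 where "a1 = lorentz a (e1 q)" and "a2 = lorentz a (e2 q)"
    and "b1 = lorentz b (e1 q)" and "b2 = lorentz b (e2 q)"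
  have ea: "a = a1 *\<^sub>R e1 q + a2 *\<^sub>R e2 q" and eb: "b = b1 *\<^sub>R e1 q + b2 *\<^sub>R e2 q"
    unfolding a1_def a2_def b1_def b2_def by (rule tangent_frame_expand[OF q a] tangent_frame_expand[OF q b])+
  have \<sigma>: "\<sigma> = a1 * b2 - a2 * b1" by (simp add: \<sigma>_def a1_def a2_def b1_def b2_def)
  have "a1 * a1 + a2 * a2 = 1" "b1 * b1 + b2 * b2 = 1" "a1 * b1 + a2 * b2 = 0"
    using on unfolding ea eb
    by (simp_all add: lorentz.add_left lorentz.add_right lorentz.scaleR_left lorentz.scaleR_right e_orthonormal[OF q] mult.commute)
  then show "\<sigma> * \<sigma> = 1" unfolding \<sigma> by algebra
  show "wedge a b = \<sigma> *\<^sub>R wedge (e1 q) (e2 q)"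
    unfolding ea eb \<sigma>
    by (simp add: wedge.add_left wedge.add_right wedge.scaleR_left wedge.scaleR_right
        wedge_commute[of "e2 q" "e1 q"] algebra_simps)
  show "det (vector [tangent_coords q a, tangent_coords q b] :: real^2^2) =
       \<sigma> * det (vector [tangent_coords q (e1 q), tangent_coords q (e2 q)] :: real^2^2)"
    unfolding ea eb \<sigma> tangent_coords_linear[OF in_carrier[OF q] e_tangent(1)[OF q] e_tangent(2)[OF q]]
    by (simp add: det_2 algebra_simps)
qed

text \<open>The choice in \<open>gauss_map\<close> is unambiguous: the wedge of any adapted normal
  pair is the star of its tangent bivector, and two positive tangent frames have the same bivector
  because \<open>\<sigma> > 0\<close> forces \<open>\<sigma> = 1\<close>.\<close>

lemma gauss_map_positive:
  assumes pf: "positive_frame W e1 e2" and q: "q \<in> W"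
  shows "gauss_map q = star (wedge (e1 q) (e2 q))"
proof -
  have uniq: "wedge (f3 q) (f4 q) = star (wedge (e1 q) (e2 q))"
    if qV: "q \<in> V" and of: "oriented_adapted_frame V f1 f2 f3 f4" for V f1 f2 f3 f4
  proof -
    interpret F: framed_surface X A x V f1 f2
      using of by unfold_locales (simp add: oriented_adapted_frame_def)
    have n: "lorentz (f3 q) (f1 q) = 0" "lorentz (f3 q) (f2 q) = 0" "lorentz (f4 q) (f1 q) = 0" "lorentz (f4 q) (f2 q) = 0"
      and u: "\<bar>lorentz (f3 q) (f3 q)\<bar> = 1" "\<bar>lorentz (f4 q) (f4 q)\<bar> = 1" "lorentz (f3 q) (f4 q) = 0"
      and o: "0 < det (vector [tangent_coords q (f1 q), tangent_coords q (f2 q)] :: real^2^2)"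
        "0 < det (vector [f1 q, f2 q, f3 q, f4 q] :: real^4^4)"
    proof -
      have "f3 q \<in> normal_space q \<and> f4 q \<in> normal_space q \<and>
        \<bar>lorentz (f3 q) (f3 q)\<bar> = 1 \<and> \<bar>lorentz (f4 q) (f4 q)\<bar> = 1 \<and> lorentz (f3 q) (f4 q) = 0 \<and>
        0 < det (vector [tangent_coords q (f1 q), tangent_coords q (f2 q)] :: real^2^2) \<and>
        0 < det (vector [f1 q, f2 q, f3 q, f4 q] :: real^4^4)"
        using of qV unfolding oriented_adapted_frame_def by blast
      then show "lorentz (f3 q) (f1 q) = 0" "lorentz (f3 q) (f2 q) = 0" "lorentz (f4 q) (f1 q) = 0" "lorentz (f4 q) (f2 q) = 0"
        "\<bar>lorentz (f3 q) (f3 q)\<bar> = 1" "\<bar>lorentz (f4 q) (f4 q)\<bar> = 1" "lorentz (f3 q) (f4 q) = 0"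
        "0 < det (vector [tangent_coords q (f1 q), tangent_coords q (f2 q)] :: real^2^2)"
        "0 < det (vector [f1 q, f2 q, f3 q, f4 q] :: real^4^4)"
        unfolding F.normal_space_frame[OF qV] by simp_all
    qed
    have 1: "wedge (f3 q) (f4 q) = star (wedge (f1 q) (f2 q))"
      by (rule star_wedge[OF F.e_orthonormal(1-3)[OF qV] n u o(2)])
    define \<sigma> where "\<sigma> = lorentz (f1 q) (e1 q) * lorentz (f2 q) (e2 q) - lorentz (f1 q) (e2 q) * lorentz (f2 q) (e1 q)"
    note op = orthonormal_pair[OF q F.e_tangent(1)[OF qV] F.e_tangent(2)[OF qV] F.e_orthonormal(1-3)[OF qV], folded \<sigma>_def]
    have "0 < det (vector [tangent_coords q (e1 q), tangent_coords q (e2 q)] :: real^2^2)"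
      using pf q by (simp add: positive_frame_def)
    then have "0 < \<sigma>" using op(3) o(1) by (simp add: zero_less_mult_iff)
    then have "\<sigma> = 1" using op(1) by (simp add: square_eq_1_iff)
    then show ?thesis using 1 op(2) by simp
  qed
  obtain e3 e4 where ad: "oriented_adapted_frame W e1 e2 e3 e4"
    using positive_frame_adapted[OF pf] by blast
  show ?thesis
    unfolding gauss_map_def
  proof (rule some_equality)
    show "\<exists>W' f1 f2 f3 f4. q \<in> W' \<and> oriented_adapted_frame W' f1 f2 f3 f4 \<and>
        star (wedge (e1 q) (e2 q)) = wedge (f3 q) (f4 q)"
      using ad q uniq[OF q ad] by metis
  qed (use uniq in blast)
qed

text \<open>The frame chosen by the Laplacian need not be positive. Its sign against a positive
  frame is smooth with values \<open>1\<close> and \<open>-1\<close>, hence locally constant, and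
  can be pulled out of derivatives.\<close>

lemma gauss_map_local:
  assumes p: "p \<in> W"
  obtains V s where "openin X V" "p \<in> V" "V \<subseteq> W" "s = 1 \<or> s = -1"
    "\<And>q. q \<in> V \<Longrightarrow> gauss_map q = s *\<^sub>R star (T q)"
proof -
  obtain U f1 f2 where U: "p \<in> U" "positive_frame U f1 f2"
    using exists_positive_frame[OF in_carrier[OF p]] by blast
  interpret F: framed_surface X A x U f1 f2
    using U by unfold_locales (simp add: positive_frame_def)
  define \<sigma> where "\<sigma> q = lorentz (f1 q) (e1 q) * lorentz (f2 q) (e2 q) - lorentz (f1 q) (e2 q) * lorentz (f2 q) (e1 q)" for q
  have WU: "openin X (W \<inter> U)" by (rule openin_Int[OF W F.W])
  have sm: "smooth_map (W \<inter> U) e1" "smooth_map (W \<inter> U) e2" "smooth_map (W \<inter> U) f1" "smooth_map (W \<inter> U) f2"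
    using smooth_map_subset e_smooth F.e_smooth by (meson Int_lower1 Int_lower2)+
  have s\<sigma>: "smooth_map (W \<inter> U) \<sigma>" unfolding \<sigma>_def
    by (intro smooth_map_diff smooth_map_bilinear[OF bounded_bilinear_mult]
        smooth_map_bilinear[OF bounded_bilinear_lorentz] WU sm)
  have op: "\<sigma> q * \<sigma> q = 1" "wedge (f1 q) (f2 q) = \<sigma> q *\<^sub>R wedge (e1 q) (e2 q)" if q: "q \<in> W" "q \<in> U" for q
    using orthonormal_pair(1,2)[OF q(1) F.e_tangent(1)[OF q(2)] F.e_tangent(2)[OF q(2)] F.e_orthonormal(1-3)[OF q(2)]]
    by (simp_all add: \<sigma>_def)
  have pm: "\<sigma> q = 1 \<or> \<sigma> q = -1" if q: "q \<in> W" "q \<in> U" for q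
    using op(1)[OF q] by (simp add: square_eq_1_iff)
  \<comment> \<open>Radius \<open>1\<close> separates the two possible values of
    \<open>\<sigma>\<close>.\<close>
  obtain V where V: "openin X V" "p \<in> V" "V \<subseteq> W \<inter> U" "\<And>q. q \<in> V \<Longrightarrow> \<sigma> q \<in> ball (\<sigma> p) 1"
    by (rule smooth_map_neighbourhood[OF WU s\<sigma> open_ball[of "\<sigma> p" 1], of p]) (use p U(1) in auto)
  show thesis
  proof (rule that[of V "\<sigma> p"])
    show "openin X V" "p \<in> V" "V \<subseteq> W" using V by auto
    show "\<sigma> p = 1 \<or> \<sigma> p = -1" by (rule pm[OF p U(1)])
    fix q assume qV: "q \<in> V"
    then have q: "q \<in> W" "q \<in> U" using V by auto
    have "\<sigma> q = \<sigma> p" using V(4)[OF qV] pm[OF q] pm[OF p U(1)] by (auto simp: dist_real_def)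
    then show "gauss_map q = \<sigma> p *\<^sub>R star (T q)"
      using F.gauss_map_positive[OF U(2) q(2)] op(2)[OF q]
      by (simp add: T_def bounded_linear.linear[OF bounded_linear_star] linear_scale)
  qed
qed

end


section \<open>The Laplacian of the Gauss map and independence of the frame\<close>

text \<open>A short substitute for Gronwall's inequality: on a ball of radius \<open>r\<close> with
  \<open>C r \<le> 1/2\<close>, the mean value inequality bounds \<open>sup |F|\<close> by half of itself.\<close>

lemma vanishing_of_linear_bound:
  fixes F :: "'a::euclidean_space \<Rightarrow> 'b::real_normed_vector"
  assumes S: "open S" "u0 \<in> S" and F: "\<And>u. u \<in> S \<Longrightarrow> (F has_derivative F' u) (at u)"
    and bound: "\<And>u w. u \<in> S \<Longrightarrow> norm (F' u w) \<le> \<kappa> u * norm (F u) * norm w"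
    and \<kappa>: "continuous_on S \<kappa>" and F0: "F u0 = 0"
  obtains r where "0 < r" "cball u0 r \<subseteq> S" "\<And>u. u \<in> cball u0 r \<Longrightarrow> F u = 0"
proof -
  define C where "C = \<bar>\<kappa> u0\<bar> + 1"
  have C: "0 < C" by (simp add: C_def)
  have "open (\<kappa> -` {..<C} \<inter> S)"
    using \<kappa> S(1) by (simp add: continuous_on_open_vimage)
  moreover have "u0 \<in> \<kappa> -` {..<C} \<inter> S" using S by (simp add: C_def)
  ultimately obtain r0 where r0: "0 < r0" "cball u0 r0 \<subseteq> \<kappa> -` {..<C} \<inter> S"
    unfolding open_contains_cball by blast
  define r where "r = min r0 (1 / (2 * C))"
  have "C * r \<le> C * (1 / (2 * C))"
    using C by (intro mult_left_mono) (simp_all add: r_def)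
  then have r: "0 < r" "C * r \<le> 1 / 2" "cball u0 r \<subseteq> cball u0 r0"
    using r0 C by (simp_all add: r_def subset_cball)
  have rS: "cball u0 r \<subseteq> S" using r(3) r0(2) by blast
  have \<kappa>C: "\<kappa> u < C" if "u \<in> cball u0 r" for u
    using that r(3) r0(2) by auto
  have "continuous_on (cball u0 r) (\<lambda>u. norm (F u))"
    by (intro continuous_on_norm has_derivative_continuous_on[where f' = F'])
      (use rS in \<open>auto intro!: has_derivative_at_withinI[OF F]\<close>)
  then obtain z where z: "z \<in> cball u0 r" "\<And>u. u \<in> cball u0 r \<Longrightarrow> norm (F u) \<le> norm (F z)"
    using continuous_attains_sup[OF compact_cball, of u0 r "\<lambda>u. norm (F u)"] r(1) by auto
  let ?m = "norm (F z)"
  have "norm (F z - F u0) \<le> C * ?m * norm (z - u0)"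
  proof (rule differentiable_bound[of "cball u0 r" F F'])
    fix u assume u: "u \<in> cball u0 r"
    then have uS: "u \<in> S" using rS by auto
    show "(F has_derivative F' u) (at u within cball u0 r)"
      by (rule has_derivative_at_withinI[OF F[OF uS]])
    have "norm (F' u w) \<le> C * ?m * norm w" for w
    proof -
      have "norm (F' u w) \<le> \<kappa> u * norm (F u) * norm w" by (rule bound[OF uS])
      also have "\<dots> \<le> C * norm (F u) * norm w"
        using \<kappa>C[OF u] by (intro mult_right_mono) auto
      also have "\<dots> \<le> C * ?m * norm w"
        using z(2)[OF u] C by (intro mult_right_mono mult_left_mono) auto
      finally show ?thesis .
    qed
    then show "onorm (F' u) \<le> C * ?m" by (rule onorm_le)
  qed (use z r in auto)
  also have "\<dots> \<le> C * ?m * r"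
    using z(1) C by (intro mult_left_mono) (auto simp: dist_norm norm_minus_commute)
  also have "\<dots> = (C * r) * ?m" by simp
  also have "\<dots> \<le> 1 / 2 * ?m" using r(2) by (intro mult_right_mono) auto
  finally have "?m \<le> 0" using F0 by simp
  then have "F u = 0" if "u \<in> cball u0 r" for u using z(2)[OF that] by simp
  then show thesis using that r(1) rS by blast
qed

text \<open>By \<open>eq\<close>, \<open>v\<close> and \<open>w\<close> are proportional unless
  \<open>H\<close> is orthogonal to both. In that case they lie in the orthogonal complement of
  \<open>H\<close> inside the normal plane, which is a line even for null \<open>H\<close>.\<close>

lemma wedge_eq_0_of_normal:
  assumes on: "lorentz a a = 1" "lorentz b b = 1" "lorentz a b = 0"
    and n: "lorentz H a = 0" "lorentz H b = 0" "lorentz v a = 0" "lorentz v b = 0" "lorentz w a = 0" "lorentz w b = 0"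
    and H: "H \<noteq> 0" and eq: "lorentz H w *\<^sub>R v = lorentz H v *\<^sub>R w"
  shows "wedge v w = 0"
proof -
  consider "lorentz H w \<noteq> 0" | "lorentz H v \<noteq> 0" | "lorentz H v = 0" "lorentz H w = 0" by blast
  then show ?thesis
  proof cases
    case 1
    have "lorentz H w *\<^sub>R wedge v w = wedge (lorentz H w *\<^sub>R v) w" by (simp add: wedge.scaleR_left)
    also have "\<dots> = 0" unfolding eq by (simp add: wedge.scaleR_left)
    finally show ?thesis using 1 by simp
  next
    case 2
    have "lorentz H v *\<^sub>R wedge v w = wedge v (lorentz H v *\<^sub>R w)" by (simp add: wedge.scaleR_right)
    also have "\<dots> = 0" unfolding eq[symmetric] by (simp add: wedge.scaleR_right)
    finally show ?thesis using 2 by simp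
  next
    case 3
    let ?M = "vector [a, b, v, w] :: real^4^4"
    \<comment> \<open>\<open>H\<close> with its index lowered: ordinary products of rows with
      \<open>K\<close> are Lorentz products with \<open>H\<close>, so \<open>K\<close> is a nonzero
      kernel vector of \<open>?M\<close>.\<close>
    define K :: "real^4" where "K = vector [- (H$1), H$2, H$3, H$4]"
    have K: "K \<noteq> 0" using H by (simp add: K_def vec_eq_iff forall_4)
    have row: "(\<Sum>j\<in>UNIV. z $ j * K $ j) = lorentz H z" for z
      by (simp add: K_def lorentz_def sum_4 mult.commute)
    have "?M *v K = 0"
      unfolding vec_eq_iff forall_4 matrix_vector_mult_def
      by (simp add: row n 3)
    then have "\<not> (\<exists>B. B ** ?M = mat 1)" using K by (auto simp: matrix_left_invertible_ker)
    then have D: "det ?M = 0" using invertible_det_nz[of ?M] invertible_left_inverse[of ?M] by blast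
    \<comment> \<open>The Gram determinant of \<open>a, b, v, w\<close> against
      \<open>a, b, y, z\<close> has the factor \<open>det ?M = 0\<close>, so
      \<open>wedge v w\<close> pairs to zero with every \<open>wedge y z\<close>.\<close>
    have key: "lorentz v y * lorentz w z - lorentz v z * lorentz w y = 0" for y z
      using lorentz_gram_det[of a b v w a b y z]
      by (simp add: D det_4[of "\<chi> i j. _ i j"] on n lorentz_commute[of b a])
    show ?thesis
      unfolding vec_eq_iff forall_4
      using key[of "axis 1 1" "axis 2 1"] key[of "axis 1 1" "axis 3 1"] key[of "axis 1 1" "axis 4 1"]
        key[of "axis 2 1" "axis 3 1"] key[of "axis 2 1" "axis 4 1"] key[of "axis 3 1" "axis 4 1"]
      by (simp add: wedge_def lorentz_def axis_def algebra_simps)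
  qed
qed

section \<open>Uniqueness and local constancy on the surface\<close>

context spacelike_surface
begin

text \<open>\<open>vanishing_of_linear_bound\<close> read in a chart. Only continuity of
  \<open>\<kappa>\<close> is asked for, because it will be built from norms, which are not
  smooth.\<close>

lemma locally_vanishing:
  fixes f :: "'a \<Rightarrow> 'b::real_normed_vector"
  assumes W: "openin X W" and p: "p \<in> W" and f: "smooth_map W f" and f0: "f p = 0"
    and \<kappa>: "\<And>c. c \<in> A \<Longrightarrow> continuous_on (snd c ` (fst c \<inter> W)) (chart_rep c \<kappa>)"
    and bound: "\<And>q v. q \<in> W \<Longrightarrow> v \<in> tangent_space q \<Longrightarrow> norm (deriv_along q v f) \<le> \<kappa> q * norm (f q) * norm v"
    and \<kappa>0: "\<And>q. q \<in> W \<Longrightarrow> 0 \<le> \<kappa> q"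
  obtains V where "openin X V" "p \<in> V" "V \<subseteq> W" "\<And>q. q \<in> V \<Longrightarrow> f q = 0"
proof -
  define c where "c = chart_at p"
  have pX: "p \<in> topspace X" using openin_subset[OF W] p by auto
  have c: "c \<in> A" "p \<in> fst c" using chart_at[OF pX] by (auto simp: c_def)
  let ?S = "snd c ` (fst c \<inter> W)"
  have S: "open ?S" by (rule open_chart_image[OF c(1) W])
  have uS: "snd c p \<in> ?S" using c p by auto
  let ?D = "\<lambda>u. frechet_derivative (chart_rep c x) (at u)"
  \<comment> \<open>The extra factor bounds the differential of \<open>x\<close> and so converts the
    length of a coordinate vector into a bound for its tangent vector in
    \<open>real^4\<close>.\<close>
  let ?\<mu> = "\<lambda>u. chart_rep c \<kappa> u * (norm (?D u E1) + norm (?D u E2))"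
  have xs: "smooth_on ?S (chart_rep c x)"
    by (rule smooth_on_subset[OF x_chart_smooth[OF c(1)]]) auto
  have cont: "continuous_on ?S ?\<mu>"
    by (intro continuous_on_mult \<kappa>[OF c(1)] continuous_on_add continuous_on_norm
        smooth_on_continuous_on[OF smooth_on_frechet_derivative[OF xs]])
  have bd: "norm (frechet_derivative (chart_rep c f) (at u) w) \<le> ?\<mu> u * norm (chart_rep c f u) * norm w"
    if "u \<in> ?S" for u w
  proof -
    from \<open>u \<in> ?S\<close> obtain q where q: "u = snd c q" "q \<in> fst c" "q \<in> W" by auto
    let ?v = "chart_diff c x q w"
    have t: "?v \<in> tangent_space q" unfolding tangent_space_chart[OF c(1) q(2)] by simp
    have "norm ?v \<le> norm ((w $ 1) *\<^sub>R chart_diff c x q E1) + norm ((w $ 2) *\<^sub>R chart_diff c x q E2)"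
      unfolding chart_diff_expand[OF c(1) q(2), of w] by (rule norm_triangle_ineq)
    also have "\<dots> \<le> norm w * norm (chart_diff c x q E1) + norm w * norm (chart_diff c x q E2)"
      unfolding norm_scaleR by (intro add_mono mult_right_mono) (simp_all add: component_le_norm_cart)
    finally have v: "norm ?v \<le> (norm (?D u E1) + norm (?D u E2)) * norm w"
      by (simp add: q(1) chart_diff_def algebra_simps)
    have "frechet_derivative (chart_rep c f) (at u) w = deriv_along q ?v f"
      using deriv_along_chart[OF W f q(3) c(1) q(2) refl] by (simp add: chart_diff_def q(1))
    then have "norm (frechet_derivative (chart_rep c f) (at u) w) \<le> \<kappa> q * norm (f q) * norm ?v"
      using bound[OF q(3) t] by simp
    also have "\<dots> \<le> \<kappa> q * norm (f q) * ((norm (?D u E1) + norm (?D u E2)) * norm w)"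
      using v \<kappa>0[OF q(3)] by (intro mult_left_mono) auto
    finally show ?thesis unfolding q(1) chart_rep_apply[OF c(1) q(2)] by (simp add: mult_ac)
  qed
  obtain r where r: "0 < r" "cball (snd c p) r \<subseteq> ?S" "\<And>u. u \<in> cball (snd c p) r \<Longrightarrow> chart_rep c f u = 0"
    by (rule vanishing_of_linear_bound[OF S uS smooth_on_has_derivative[OF smooth_mapD[OF f c(1)]] bd cont])
       (simp_all add: chart_rep_apply[OF c] f0)
  show thesis
  proof (rule that[of "{q \<in> fst c. snd c q \<in> ball (snd c p) r}"])
    show "openin X {q \<in> fst c. snd c q \<in> ball (snd c p) r}"
      by (rule open_chart_preimage[OF c(1) open_ball])
    show "p \<in> {q \<in> fst c. snd c q \<in> ball (snd c p) r}" using c r by simp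
    show "{q \<in> fst c. snd c q \<in> ball (snd c p) r} \<subseteq> W"
    proof
      fix q assume q: "q \<in> {q \<in> fst c. snd c q \<in> ball (snd c p) r}"
      then have "snd c q \<in> ?S" using r(2) ball_subset_cball by blast
      then obtain q' where q': "q' \<in> fst c" "q' \<in> W" "snd c q = snd c q'" by auto
      then show "q \<in> W" using inj_onD[OF chart_inj[OF c(1)], of q q'] q by simp
    qed
    show "f q = 0" if "q \<in> {q \<in> fst c. snd c q \<in> ball (snd c p) r}" for q
      using that r(3)[of "snd c q"] chart_rep_apply[OF c(1), of q f] by auto
  qed
qed

lemma locally_constant:
  fixes f :: "'a \<Rightarrow> 'b::real_normed_vector"
  assumes W: "openin X W" and p: "p \<in> W" and f: "smooth_map W f"
    and d: "\<And>q v. q \<in> W \<Longrightarrow> v \<in> tangent_space q \<Longrightarrow> deriv_along q v f = 0"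
  obtains V where "openin X V" "p \<in> V" "V \<subseteq> W" "\<And>q. q \<in> V \<Longrightarrow> f q = f p"
proof -
  have g: "smooth_map W (\<lambda>q. f q + - f p)" by (rule smooth_map_add[OF W f smooth_map_const])
  have z: "deriv_along q v (\<lambda>q. f q + - f p) = 0" if "q \<in> W" "v \<in> tangent_space q" for q v
    unfolding deriv_along_add[OF W that(1) f smooth_map_const] d[OF that] deriv_along_const by simp
  show thesis
  proof (rule locally_vanishing[OF W p g, of "\<lambda>q. 0"])
    fix V assume V: "openin X V" "p \<in> V" "V \<subseteq> W" "\<And>q. q \<in> V \<Longrightarrow> f q + - f p = 0"
    show thesis
    proof (rule that[OF V(1-3)])
      fix q assume "q \<in> V"
      from V(4)[OF this] show "f q = f p" by (simp only: add_uminus_conv_diff right_minus_eq)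
    qed
  qed (simp_all add: chart_rep_const z del: add_uminus_conv_diff)
qed

text \<open>Level sets and their complements are open. No structure on the codomain is required, so
  \<open>f\<close> may also be a truth value, as in \<open>parallel_nonvanishing\<close>.\<close>

lemma connected_constant:
  assumes conn: "connected_space X"
    and loc: "\<And>p. p \<in> topspace X \<Longrightarrow> \<exists>V. openin X V \<and> p \<in> V \<and> (\<forall>q\<in>V. f q = f p)"
    and p: "p \<in> topspace X" and q: "q \<in> topspace X"
  shows "f p = f q"
proof -
  have op: "openin X {z \<in> topspace X. P (f z)}" for P
    unfolding openin_subopen[of X "{z \<in> topspace X. P (f z)}"]
  proof
    fix z assume z: "z \<in> {z \<in> topspace X. P (f z)}"
    then obtain V where V: "openin X V" "z \<in> V" "\<forall>q\<in>V. f q = f z" using loc[of z] by auto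
    have "V \<subseteq> {z \<in> topspace X. P (f z)}"
    proof
      fix y assume "y \<in> V"
      then show "y \<in> {z \<in> topspace X. P (f z)}" using z V(3) openin_subset[OF V(1)] by auto
    qed
    then show "\<exists>V. openin X V \<and> z \<in> V \<and> V \<subseteq> {z \<in> topspace X. P (f z)}" using V(1,2) by blast
  qed
  let ?C = "{z \<in> topspace X. f z = f p}"
  have "topspace X - ?C = {z \<in> topspace X. f z \<noteq> f p}" by auto
  then have "closedin X ?C" unfolding closedin_def using op[of "\<lambda>y. y \<noteq> f p"] by simp
  moreover have "openin X ?C" by (rule op)
  ultimately have "?C = {} \<or> ?C = topspace X"
    using conn connected_space_clopen_in[of X] by metis
  then have "?C = topspace X" using p by auto
  then have "q \<in> ?C" using q by (rule ssubst)
  then show ?thesis by simp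
qed

end

section \<open>Change of frame and the eigenvalue equation at a point\<close>

context framed_surface
begin

text \<open>Tensoriality of the second fundamental form: when \<open>Z\<close> is expanded in the
  frame, the derivatives of its coefficients multiply tangent vectors and are removed by
  \<open>nor_part\<close>.\<close>

lemma second_ff_frame:
  assumes q: "q \<in> W" "q \<in> U" and U: "openin X U" and Z: "smooth_map U Z"
    and t: "\<And>r. r \<in> U \<Longrightarrow> Z r \<in> tangent_space r" and v: "v = v1 *\<^sub>R e1 q + v2 *\<^sub>R e2 q"
  defines "z1 \<equiv> lorentz (Z q) (e1 q)" and "z2 \<equiv> lorentz (Z q) (e2 q)"
  shows "nor_part q (deriv_along q v Z) =
    (v1 * z1) *\<^sub>R h11 q + (v1 * z2 + v2 * z1) *\<^sub>R h12 q + (v2 * z2) *\<^sub>R h22 q"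
proof -
  have WU: "openin X (W \<inter> U)" "q \<in> W \<inter> U" using openin_Int[OF W U] q by auto
  have sm: "smooth_map (W \<inter> U) e1" "smooth_map (W \<inter> U) e2" "smooth_map (W \<inter> U) Z"
    using smooth_map_subset[OF e_smooth(1)] smooth_map_subset[OF e_smooth(2)] smooth_map_subset[OF Z] by auto
  have sz: "smooth_map (W \<inter> U) (\<lambda>r. lorentz (Z r) (e1 r))" "smooth_map (W \<inter> U) (\<lambda>r. lorentz (Z r) (e2 r))"
    by (rule smooth_map_bilinear[OF bounded_bilinear_lorentz WU(1)]; rule sm)+
  note ss = smooth_map_scaleR[OF WU(1) sz(1) sm(1)] smooth_map_scaleR[OF WU(1) sz(2) sm(2)]
  have "deriv_along q v Z = deriv_along q v (\<lambda>r. lorentz (Z r) (e1 r) *\<^sub>R e1 r + lorentz (Z r) (e2 r) *\<^sub>R e2 r)"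
    by (rule deriv_along_cong[OF WU]) (use tangent_frame_expand t in blast)
  also have "\<dots> = deriv_along q v (\<lambda>r. lorentz (Z r) (e1 r)) *\<^sub>R e1 q + z1 *\<^sub>R deriv_along q v e1 +
      (deriv_along q v (\<lambda>r. lorentz (Z r) (e2 r)) *\<^sub>R e2 q + z2 *\<^sub>R deriv_along q v e2)"
    unfolding deriv_along_add[OF WU ss] deriv_along_bilinear[OF bounded_bilinear_scaleR WU sz(1) sm(1)]
      deriv_along_bilinear[OF bounded_bilinear_scaleR WU sz(2) sm(2)] z1_def z2_def ..
  finally have 1: "nor_part q (deriv_along q v Z) =
      z1 *\<^sub>R nor_part q (deriv_along q v e1) + z2 *\<^sub>R nor_part q (deriv_along q v e2)"
    by (simp add: nor_part_linear[OF q(1)])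
  note l = linear_deriv_along[OF W q(1) _ e_tangent(1)[OF q(1)] e_tangent(2)[OF q(1)]]
  note N = nor_part_linear[OF q(1)] nor_part_normal[OF q(1) h_normal(1)[OF q(1)]]
    nor_part_normal[OF q(1) h_normal(2)[OF q(1)]] nor_part_normal[OF q(1) h_normal(3)[OF q(1)]]
  have "nor_part q (deriv_along q v e1) = v1 *\<^sub>R h11 q + v2 *\<^sub>R h12 q"
    "nor_part q (deriv_along q v e2) = v1 *\<^sub>R h12 q + v2 *\<^sub>R h22 q"
    unfolding v l[OF e_smooth(1)] l[OF e_smooth(2)] frame_derivs[OF q(1)] by (simp_all add: N)
  then show ?thesis unfolding 1 by (simp add: algebra_simps)
qed

lemma nor_part_derivs:
  assumes p: "p \<in> W"
  shows "nor_part p (d1 e1 p) = h11 p" "nor_part p (d1 e2 p) = h12 p" "nor_part p (d2 e2 p) = h22 p"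
  unfolding frame_derivs[OF p]
  by (simp_all add: nor_part_linear[OF p] nor_part_normal[OF p] h_normal[OF p])

text \<open>The last three relations, orthogonality of the matrix of inner products, come from
  expanding \<open>e1\<close>, \<open>e2\<close> in the new frame; they are in the form needed for
  invariance of the trace.\<close>

lemma change_of_frame:
  assumes F: "framed_surface X A x U f1 f2" and q: "q \<in> W" "q \<in> U"
  defines "a \<equiv> lorentz (f1 q) (e1 q)" and "b \<equiv> lorentz (f1 q) (e2 q)"
    and "c \<equiv> lorentz (f2 q) (e1 q)" and "d \<equiv> lorentz (f2 q) (e2 q)"
  shows "framed_surface.h11 A x f1 f2 q = (a * a) *\<^sub>R h11 q + (a * b + b * a) *\<^sub>R h12 q + (b * b) *\<^sub>R h22 q"
    and "framed_surface.h12 A x f1 f2 q = (a * c) *\<^sub>R h11 q + (a * d + b * c) *\<^sub>R h12 q + (b * d) *\<^sub>R h22 q"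
    and "framed_surface.h22 A x f1 f2 q = (c * c) *\<^sub>R h11 q + (c * d + d * c) *\<^sub>R h12 q + (d * d) *\<^sub>R h22 q"
    and "a * a + c * c = 1" "b * b + d * d = 1" "a * b + c * d = 0"
proof -
  interpret F: framed_surface X A x U f1 f2 by (rule F)
  have f: "f1 q = a *\<^sub>R e1 q + b *\<^sub>R e2 q" "f2 q = c *\<^sub>R e1 q + d *\<^sub>R e2 q"
    unfolding a_def b_def c_def d_def
    by (rule tangent_frame_expand[OF q(1) F.e_tangent(1)[OF q(2)]] tangent_frame_expand[OF q(1) F.e_tangent(2)[OF q(2)]])+
  show "F.h11 q = (a * a) *\<^sub>R h11 q + (a * b + b * a) *\<^sub>R h12 q + (b * b) *\<^sub>R h22 q"
    using second_ff_frame[OF q F.W F.e_smooth(1) F.e_tangent(1) f(1)] F.nor_part_derivs(1)[OF q(2)]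
    by (simp add: a_def b_def)
  show "F.h12 q = (a * c) *\<^sub>R h11 q + (a * d + b * c) *\<^sub>R h12 q + (b * d) *\<^sub>R h22 q"
    using second_ff_frame[OF q F.W F.e_smooth(2) F.e_tangent(2) f(1)] F.nor_part_derivs(2)[OF q(2)]
    by (simp add: c_def d_def)
  show "F.h22 q = (c * c) *\<^sub>R h11 q + (c * d + d * c) *\<^sub>R h12 q + (d * d) *\<^sub>R h22 q"
    using second_ff_frame[OF q F.W F.e_smooth(2) F.e_tangent(2) f(2)] F.nor_part_derivs(3)[OF q(2)]
    by (simp add: c_def d_def)
  have e: "e1 q = a *\<^sub>R f1 q + c *\<^sub>R f2 q" "e2 q = b *\<^sub>R f1 q + d *\<^sub>R f2 q"
    using F.tangent_frame_expand[OF q(2) e_tangent(1)[OF q(1)]] F.tangent_frame_expand[OF q(2) e_tangent(2)[OF q(1)]]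
    by (simp_all add: a_def b_def c_def d_def lorentz_commute)
  show "a * a + c * c = 1" "b * b + d * d = 1" "a * b + c * d = 0"
    using e_orthonormal(1-3)[OF q(1)] unfolding e
    by (simp_all add: lorentz.add_left lorentz.add_right lorentz.scaleR_left lorentz.scaleR_right F.e_orthonormal[OF q(2)] mult.commute)
qed

text \<open>An orthogonal change of frame preserves the trace of \<open>h\<close>, so every frame
  yields the same value.\<close>

lemma mean_curvature_vector_frame:
  assumes q: "q \<in> W" shows "mean_curvature_vector q = (1/2) *\<^sub>R (h11 q + h22 q)"
  unfolding mean_curvature_vector_def
proof (rule some_equality)
  show "\<exists>W e1' e2'. q \<in> W \<and> tangent_frame W e1' e2' \<and>
      (1/2) *\<^sub>R (h11 q + h22 q) = (1/2) *\<^sub>R (second_ff e1' e1' q + second_ff e2' e2' q)"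
    using q frame nor_part_derivs[OF q] unfolding second_ff_def by metis
next
  fix H assume "\<exists>W e1' e2'. q \<in> W \<and> tangent_frame W e1' e2' \<and> H = (1/2) *\<^sub>R (second_ff e1' e1' q + second_ff e2' e2' q)"
  then obtain U f1 f2 where U: "q \<in> U" "tangent_frame U f1 f2" and H: "H = (1/2) *\<^sub>R (second_ff f1 f1 q + second_ff f2 f2 q)"
    by blast
  interpret F: framed_surface X A x U f1 f2 by unfold_locales (rule U)
  note ch = change_of_frame[OF F.framed_surface_axioms q U(1)]
  define a b c d where "a = lorentz (f1 q) (e1 q)" and "b = lorentz (f1 q) (e2 q)"
    and "c = lorentz (f2 q) (e1 q)" and "d = lorentz (f2 q) (e2 q)"
  note ch = ch[folded a_def b_def c_def d_def]
  have "F.h11 q + F.h22 q = (a * a + c * c) *\<^sub>R h11 q + (2 * (a * b + c * d)) *\<^sub>R h12 q + (b * b + d * d) *\<^sub>R h22 q"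
    unfolding ch(1,3) by (simp add: scaleR_add_left algebra_simps)
  also have "\<dots> = h11 q + h22 q" unfolding ch(4-6) by simp
  finally show "H = (1/2) *\<^sub>R (h11 q + h22 q)"
    unfolding H second_ff_def F.nor_part_derivs[OF U(1)] by simp
qed

text \<open>A change of frame multiplies the determinant of \<open>h\<close> by the squared
  determinant of an orthogonal matrix.\<close>

lemma gaussian_curvature_frame:
  assumes q: "q \<in> W" shows "gaussian_curvature q = lorentz (h11 q) (h22 q) - lorentz (h12 q) (h12 q)"
  unfolding gaussian_curvature_def
proof (rule some_equality)
  show "\<exists>W e1' e2'. q \<in> W \<and> tangent_frame W e1' e2' \<and>
      lorentz (h11 q) (h22 q) - lorentz (h12 q) (h12 q) = lorentz (curvature e1' e2' e2' q) (e1' q)"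
    using q frame gauss_equation[OF q] by metis
next
  fix K assume "\<exists>W e1' e2'. q \<in> W \<and> tangent_frame W e1' e2' \<and> K = lorentz (curvature e1' e2' e2' q) (e1' q)"
  then obtain U f1 f2 where U: "q \<in> U" "tangent_frame U f1 f2" and K: "K = lorentz (curvature f1 f2 f2 q) (f1 q)"
    by blast
  interpret F: framed_surface X A x U f1 f2 by unfold_locales (rule U)
  define a b c d where "a = lorentz (f1 q) (e1 q)" and "b = lorentz (f1 q) (e2 q)"
    and "c = lorentz (f2 q) (e1 q)" and "d = lorentz (f2 q) (e2 q)"
  note ch = change_of_frame[OF F.framed_surface_axioms q U(1), folded a_def b_def c_def d_def]
  have \<delta>: "(a * d - b * c)\<^sup>2 = 1" using ch(4-6) by algebra
  have "K = lorentz (F.h11 q) (F.h22 q) - lorentz (F.h12 q) (F.h12 q)"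
    unfolding K by (rule F.gauss_equation[OF U(1)])
  also have "\<dots> = (a * d - b * c)\<^sup>2 * (lorentz (h11 q) (h22 q) - lorentz (h12 q) (h12 q))"
    unfolding ch(1-3)
    by (simp add: lorentz.add_left lorentz.add_right lorentz.scaleR_left lorentz.scaleR_right
        lorentz_commute[of "h12 q" "h11 q"] lorentz_commute[of "h22 q" "h11 q"] lorentz_commute[of "h22 q" "h12 q"]
        power2_eq_square algebra_simps)
  finally show "K = lorentz (h11 q) (h22 q) - lorentz (h12 q) (h12 q)" unfolding \<delta> by simp
qed

lemma h_norm2_eq:
  assumes q: "q \<in> W"
  shows "h_norm2 q = 4 * lorentz (mean_curvature_vector q) (mean_curvature_vector q) - 2 * gaussian_curvature q"
  unfolding mean_curvature_vector_frame[OF q] gaussian_curvature_frame[OF q] h_norm2_def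
  by (simp add: lorentz.add_left lorentz.add_right lorentz.scaleR_left lorentz.scaleR_right
      lorentz_commute[of "h22 q" "h11 q"] algebra_simps)

text \<open>\<open>mean_curvature_vector\<close> agrees with half the trace on all of
  \<open>W\<close>, not only at \<open>p\<close>, so it may be replaced under the derivative;
  linearity in \<open>v\<close> leaves the two frame directions.\<close>

lemma parallel_frame:
  assumes p: "p \<in> W"
  shows "(\<forall>v\<in>tangent_space p. normal_conn p v mean_curvature_vector = 0) \<longleftrightarrow>
    nor_part p (d1 h11 p + d1 h22 p) = 0 \<and> nor_part p (d2 h11 p + d2 h22 p) = 0"
proof -
  have sH: "smooth_map W (\<lambda>q. h11 q + h22 q)" by (intro smooth_map_add W smooth_h)
  have nc: "normal_conn p v mean_curvature_vector = (1/2) *\<^sub>R nor_part p (deriv_along p v h11 + deriv_along p v h22)" for v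
  proof -
    have "deriv_along p v mean_curvature_vector = deriv_along p v (\<lambda>q. (1/2) *\<^sub>R (h11 q + h22 q))"
      by (rule deriv_along_cong[OF W p mean_curvature_vector_frame])
    also have "\<dots> = (1/2) *\<^sub>R deriv_along p v (\<lambda>q. h11 q + h22 q)"
      by (rule deriv_along_linear[OF bounded_linear_scaleR_right W p sH])
    also have "deriv_along p v (\<lambda>q. h11 q + h22 q) = deriv_along p v h11 + deriv_along p v h22"
      by (rule deriv_along_add[OF W p smooth_h(1,3)])
    finally show ?thesis unfolding normal_conn_def by (simp only: nor_part_linear(3)[OF p])
  qed
  have lin: "deriv_along p v f = lorentz v (e1 p) *\<^sub>R d1 f p + lorentz v (e2 p) *\<^sub>R d2 f p"
    if "v \<in> tangent_space p" "smooth_map W f" for v and f :: "'a \<Rightarrow> real^4"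
    using linear_deriv_along[OF W p that(2) e_tangent(1)[OF p] e_tangent(2)[OF p]]
      tangent_frame_expand[OF p that(1)] by metis
  have split: "nor_part p (deriv_along p v h11 + deriv_along p v h22) =
      lorentz v (e1 p) *\<^sub>R nor_part p (d1 h11 p + d1 h22 p) + lorentz v (e2 p) *\<^sub>R nor_part p (d2 h11 p + d2 h22 p)"
    if "v \<in> tangent_space p" for v
    unfolding lin[OF that smooth_h(1)] lin[OF that smooth_h(3)]
    by (simp add: nor_part_linear[OF p] algebra_simps)
  show ?thesis
  proof
    assume "\<forall>v\<in>tangent_space p. normal_conn p v mean_curvature_vector = 0"
    then show "nor_part p (d1 h11 p + d1 h22 p) = 0 \<and> nor_part p (d2 h11 p + d2 h22 p) = 0"
      using e_tangent[OF p] nc by simp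
  qed (simp add: nc split)
qed

text \<open>Contraction separates the components. With \<open>e1 p\<close> it gives
  \<open>N2 = (h_norm2 p - k) *\<^sub>R e2 p\<close>, where a normal vector equals a tangent one, so
  both vanish; with \<open>e2 p\<close> it then kills \<open>N1\<close>, and only the normal
  curvature is left.\<close>

lemma laplacian_eigen_iff:
  assumes p: "p \<in> W"
  shows "frame_laplacian T p = k *\<^sub>R T p \<longleftrightarrow> h_norm2 p = k \<and> wedge (h11 p - h22 p) (h12 p) = 0 \<and>
    nor_part p (d1 h11 p + d1 h22 p) = 0 \<and> nor_part p (d2 h11 p + d2 h22 p) = 0"
    (is "?L \<longleftrightarrow> ?R")
proof
  assume ?R then show ?L by (simp add: laplacian_T[OF p] wedge.zero_left wedge.zero_right)
next
  define N1 N2 where "N1 = nor_part p (d1 h11 p + d1 h22 p)" and "N2 = nor_part p (d2 h11 p + d2 h22 p)"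
  have N: "lorentz (nor_part p V) (e1 p) = 0" "lorentz (nor_part p V) (e2 p) = 0" for V
    by (simp_all add: nor_part_frame[OF p] lorentz.diff_left lorentz.add_left lorentz.scaleR_left e_orthonormal[OF p])
  interpret C: bounded_bilinear lorentz_contract by (rule bounded_bilinear_lorentz_contract)
  assume ?L
  then have 0: "(h_norm2 p - k) *\<^sub>R T p - 2 *\<^sub>R wedge (h11 p - h22 p) (h12 p) - wedge N1 (e2 p) - wedge (e1 p) N2 = 0"
    unfolding laplacian_T[OF p] N1_def N2_def by (simp add: algebra_simps)
  have contract: "(h_norm2 p - k) *\<^sub>R (lorentz (e2 p) v *\<^sub>R e1 p - lorentz (e1 p) v *\<^sub>R e2 p)
      - 2 *\<^sub>R (lorentz (h12 p) v *\<^sub>R (h11 p - h22 p) - lorentz (h11 p - h22 p) v *\<^sub>R h12 p)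
      - (lorentz (e2 p) v *\<^sub>R N1 - lorentz N1 v *\<^sub>R e2 p) - (lorentz N2 v *\<^sub>R e1 p - lorentz (e1 p) v *\<^sub>R N2) = 0" for v
    using arg_cong[OF 0, of "\<lambda>M. lorentz_contract M v"]
    unfolding C.diff_left C.scaleR_left T_def lorentz_contract_wedge C.zero_left .
  note s = e_orthonormal[OF p] h_orthogonal[OF p] lorentz.diff_left N[folded N1_def N2_def]
  have N': "lorentz N1 (e1 p) = 0" "lorentz N1 (e2 p) = 0" "lorentz N2 (e1 p) = 0" "lorentz N2 (e2 p) = 0"
    by (simp_all add: N1_def N2_def N)
  have 1: "N2 = (h_norm2 p - k) *\<^sub>R e2 p" using contract[of "e1 p"] by (simp add: s N')
  have "lorentz N2 (e2 p) = h_norm2 p - k" unfolding 1 by (simp add: lorentz.scaleR_left e_orthonormal[OF p])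
  then have h: "h_norm2 p = k" by (simp add: N')
  then have N2: "N2 = 0" using 1 by simp
  have "N1 = 0" using contract[of "e2 p"] h by (simp add: s N')
  moreover then have "wedge (h11 p - h22 p) (h12 p) = 0"
    using 0 h N2 by (simp add: wedge.zero_left wedge.zero_right)
  ultimately show ?R using h N2 by (simp add: N1_def N2_def)
qed

text \<open>Near \<open>p\<close> the Gauss map is a fixed injective linear map applied to
  \<open>T\<close>, and such a map commutes with all the derivatives.\<close>

lemma laplacian_gauss_map:
  assumes p: "p \<in> W"
  shows "frame_laplacian gauss_map p = k *\<^sub>R gauss_map p \<longleftrightarrow> frame_laplacian T p = k *\<^sub>R T p"
proof -
  obtain V s where V: "openin X V" "p \<in> V" "V \<subseteq> W" and s: "s = 1 \<or> s = -1"
    and g: "\<And>q. q \<in> V \<Longrightarrow> gauss_map q = s *\<^sub>R star (T q)"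
    using gauss_map_local[OF p] by blast
  have L: "bounded_linear (\<lambda>B. s *\<^sub>R star B)"
    by (rule bounded_linear_compose[OF bounded_linear_scaleR_right bounded_linear_star])
  have lin: "linear star" by (rule bounded_linear.linear[OF bounded_linear_star])
  have D: "deriv_along q v gauss_map = s *\<^sub>R star (deriv_along q v T)" if q: "q \<in> V" for q v
  proof -
    have "deriv_along q v gauss_map = deriv_along q v (\<lambda>q. s *\<^sub>R star (T q))"
      by (rule deriv_along_cong[OF V(1) q g])
    then show ?thesis using deriv_along_linear[OF L V(1) q smooth_map_subset[OF smooth_T V(3)]] by simp
  qed
  have DD: "deriv_along p v (\<lambda>q. deriv_along q (e q) gauss_map) = s *\<^sub>R star (deriv_along p v (\<lambda>q. deriv_along q (e q) T))"
    if e: "smooth_map W (\<lambda>q. deriv_along q (e q) T)" for e v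
  proof -
    have "deriv_along p v (\<lambda>q. deriv_along q (e q) gauss_map) = deriv_along p v (\<lambda>q. s *\<^sub>R star (deriv_along q (e q) T))"
      by (rule deriv_along_cong[OF V(1,2) D])
    then show ?thesis using deriv_along_linear[OF L W p e] by simp
  qed
  have "frame_laplacian gauss_map p = s *\<^sub>R star (frame_laplacian T p)"
    unfolding frame_laplacian_def D[OF V(2)] DD[OF smooth_d(1)[OF smooth_T]] DD[OF smooth_d(2)[OF smooth_T]]
    by (simp add: linear_add[OF lin] linear_diff[OF lin] algebra_simps)
  moreover have "k *\<^sub>R gauss_map p = s *\<^sub>R star (k *\<^sub>R T p)"
    by (simp add: g[OF V(2)] linear_scale[OF lin])
  ultimately show ?thesis using s inj_star by auto
qed

end


section \<open>Parallel mean curvature\<close>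

context framed_surface
begin

definition H2 :: "'a \<Rightarrow> real^4" where "H2 q = h11 q + h22 q"

lemma H2_eq: "q \<in> W \<Longrightarrow> H2 q = 2 *\<^sub>R mean_curvature_vector q"
  by (simp add: H2_def mean_curvature_vector_frame)

lemma smooth_H2: "smooth_map W H2"
  unfolding H2_def by (intro smooth_map_add W smooth_h)

lemma H2_normal: "q \<in> W \<Longrightarrow> H2 q \<in> normal_space q"
  using h_normal by (simp add: normal_space_frame H2_def lorentz.add_left)

text \<open>Without normal part, the derivative reduces to its Weingarten terms. They are linear in
  \<open>H2\<close>, which gives the linear system behind the uniqueness argument.\<close>

lemma parallel_deriv_H2:
  assumes par: parallel_mean_curvature and p: "p \<in> W"
  shows "d1 H2 p = (- lorentz (H2 p) (h11 p)) *\<^sub>R e1 p + (- lorentz (H2 p) (h12 p)) *\<^sub>R e2 p"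
    "d2 H2 p = (- lorentz (H2 p) (h12 p)) *\<^sub>R e1 p + (- lorentz (H2 p) (h22 p)) *\<^sub>R e2 p"
proof -
  have D: "deriv_along p v H2 = deriv_along p v h11 + deriv_along p v h22" for v
    unfolding H2_def by (rule deriv_along_add[OF W p smooth_h(1,3)])
  have "nor_part p (d1 H2 p) = 0" "nor_part p (d2 H2 p) = 0"
    using parallel_frame[OF p] par in_carrier[OF p] unfolding D parallel_mean_curvature_def by auto
  then show "d1 H2 p = (- lorentz (H2 p) (h11 p)) *\<^sub>R e1 p + (- lorentz (H2 p) (h12 p)) *\<^sub>R e2 p"
    "d2 H2 p = (- lorentz (H2 p) (h12 p)) *\<^sub>R e1 p + (- lorentz (H2 p) (h22 p)) *\<^sub>R e2 p"
    using deriv_h_tangential[OF p smooth_H2 H2_normal] by simp_all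
qed

lemma deriv_along_frame:
  assumes p: "p \<in> W" and v: "v \<in> tangent_space p" and f: "smooth_map W f"
  shows "deriv_along p v f = lorentz v (e1 p) *\<^sub>R d1 f p + lorentz v (e2 p) *\<^sub>R d2 f p"
proof -
  have "deriv_along p v f = deriv_along p (lorentz v (e1 p) *\<^sub>R e1 p + lorentz v (e2 p) *\<^sub>R e2 p) f"
    using tangent_frame_expand[OF p v] by simp
  also have "\<dots> = lorentz v (e1 p) *\<^sub>R d1 f p + lorentz v (e2 p) *\<^sub>R d2 f p"
    by (rule linear_deriv_along[OF W p f e_tangent(1)[OF p] e_tangent(2)[OF p]])
  finally show ?thesis .
qed

text \<open>Ricci equation for a parallel section: first derivatives of \<open>H2\<close> are
  tangent, so its flat commutator has no normal part, while the two iterated derivatives have normal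
  parts given by \<open>h\<close>. The resulting relation \<open>eq\<close> says that the normal
  curvature annihilates \<open>H2\<close>; a skew map of a plane with a nonzero kernel vector is
  zero.\<close>

lemma parallel_flat_normal_bundle:
  assumes par: parallel_mean_curvature and p: "p \<in> W" and H: "H2 p \<noteq> 0"
  shows "wedge (h11 p - h22 p) (h12 p) = 0"
proof -
  note N = nor_part_linear[OF p] nor_part_normal[OF p h_normal(1)[OF p]]
    nor_part_normal[OF p h_normal(2)[OF p]] nor_part_normal[OF p h_normal(3)[OF p]]
  have sl: "smooth_map W (\<lambda>q. - lorentz (H2 q) (h q))" if "smooth_map W h" for h
    by (intro smooth_map_minus smooth_map_bilinear[OF bounded_bilinear_lorentz] W smooth_H2 that)
  have D: "nor_part p (deriv_along p v F) = a p *\<^sub>R nor_part p (deriv_along p v e1) + b p *\<^sub>R nor_part p (deriv_along p v e2)"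
    if ab: "smooth_map W a" "smooth_map W b" and F: "\<And>q. q \<in> W \<Longrightarrow> F q = a q *\<^sub>R e1 q + b q *\<^sub>R e2 q" for F a b v
  proof -
    have "deriv_along p v F = deriv_along p v a *\<^sub>R e1 p + a p *\<^sub>R deriv_along p v e1 + deriv_along p v (\<lambda>q. b q *\<^sub>R e2 q)"
      by (rule deriv_frame_combination[OF p ab(1) e_smooth(1) smooth_map_scaleR[OF W ab(2) e_smooth(2)] F])
    then show ?thesis unfolding deriv_scaleR[OF p ab(2) e_smooth(2)] by (simp add: N)
  qed
  have 1: "nor_part p (d1 (d2 H2) p) = - lorentz (H2 p) (h12 p) *\<^sub>R h11 p - lorentz (H2 p) (h22 p) *\<^sub>R h12 p"
    using D[OF sl[OF smooth_h(2)] sl[OF smooth_h(3)] parallel_deriv_H2(2)[OF par]] nor_part_derivs[OF p] by simp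
  have 2: "nor_part p (d2 (d1 H2) p) = - lorentz (H2 p) (h11 p) *\<^sub>R h12 p - lorentz (H2 p) (h12 p) *\<^sub>R h22 p"
    using D[OF sl[OF smooth_h(1)] sl[OF smooth_h(2)] parallel_deriv_H2(1)[OF par]] nor_part_derivs[OF p]
    by (simp add: frame_derivs[OF p] N)
  have "nor_part p (d1 (d2 H2) p - d2 (d1 H2) p) = 0"
    unfolding frame_commutator[OF p smooth_H2] parallel_deriv_H2[OF par p] by (simp add: N)
  then have eq: "lorentz (H2 p) (h12 p) *\<^sub>R (h11 p - h22 p) = lorentz (H2 p) (h11 p - h22 p) *\<^sub>R h12 p"
    unfolding nor_part_linear(2)[OF p] 1 2 by (simp add: lorentz.diff_right algebra_simps)
  show ?thesis
    by (rule wedge_eq_0_of_normal[OF e_orthonormal(1-3)[OF p] _ _ _ _ _ _ H eq])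
      (use H2_normal[OF p] h_orthogonal[OF p] in \<open>simp_all add: normal_space_frame[OF p] lorentz.diff_left\<close>)
qed

text \<open>The derivative of \<open>H2\<close> is tangent, hence orthogonal to
  \<open>H2\<close>.\<close>

lemma parallel_norm_locally_constant:
  assumes par: parallel_mean_curvature and p: "p \<in> W"
  shows "\<exists>V. openin X V \<and> p \<in> V \<and> (\<forall>q\<in>V. lorentz (mean_curvature_vector q) (mean_curvature_vector q) =
    lorentz (mean_curvature_vector p) (mean_curvature_vector p))"
proof -
  let ?f = "\<lambda>q. lorentz (H2 q) (H2 q)"
  have f: "smooth_map W ?f" by (rule smooth_map_bilinear[OF bounded_bilinear_lorentz W smooth_H2 smooth_H2])
  have "deriv_along q v ?f = 0" if q: "q \<in> W" and v: "v \<in> tangent_space q" for q v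
  proof -
    have "lorentz (deriv_along q v H2) (H2 q) = 0"
      unfolding deriv_along_frame[OF q v smooth_H2] parallel_deriv_H2[OF par q]
      using H2_normal[OF q] unfolding normal_space_frame[OF q]
      by (simp add: lorentz_commute[of _ "H2 q"] lorentz.add_right lorentz.diff_right lorentz.minus_right
          lorentz.scaleR_right)
    then show ?thesis unfolding deriv_lorentz[OF q smooth_H2 smooth_H2] by (simp add: lorentz_commute[of "H2 q"])
  qed
  then obtain V where V: "openin X V" "p \<in> V" "V \<subseteq> W" "\<And>q. q \<in> V \<Longrightarrow> ?f q = ?f p"
    using locally_constant[OF W p f] by blast
  have "lorentz (mean_curvature_vector q) (mean_curvature_vector q) = ?f q / 4" if "q \<in> W" for q
    by (simp add: H2_eq[OF that] lorentz.scaleR_left lorentz.scaleR_right)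
  then show ?thesis using V p by (metis subsetD)
qed

text \<open>\<open>parallel_deriv_H2\<close> bounds the derivative of \<open>H2\<close> by a
  multiple of \<open>H2\<close>. The norms are Euclidean, since the Lorentz product does not control
  the size of null vectors.\<close>

lemma parallel_locally_vanishing:
  assumes par: parallel_mean_curvature and p: "p \<in> W" and H: "H2 p = 0"
  obtains V where "openin X V" "p \<in> V" "V \<subseteq> W" "\<And>q. q \<in> V \<Longrightarrow> H2 q = 0"
proof -
  obtain K where K: "0 \<le> K" "\<And>a b. norm (lorentz a b) \<le> norm a * norm b * K"
    using lorentz.nonneg_bounded by blast
  \<comment> \<open>The norms left over when the bound \<open>K\<close> for \<open>lorentz\<close>
    is used twice, for the frame coefficients of \<open>v\<close> and for the Weingarten terms;
    hence \<open>K * K\<close> in \<open>bd\<close>.\<close>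
  define g where "g q = norm (e1 q) * (norm (h11 q) * norm (e1 q) + norm (h12 q) * norm (e2 q)) +
      norm (e2 q) * (norm (h12 q) * norm (e1 q) + norm (h22 q) * norm (e2 q))" for q
  have d: "norm ((- lorentz h a) *\<^sub>R u + (- lorentz h b) *\<^sub>R w) \<le> K * norm h * (norm a * norm u + norm b * norm w)"
    for h a b u w
  proof -
    have "norm ((- lorentz h a) *\<^sub>R u + (- lorentz h b) *\<^sub>R w) \<le> norm (lorentz h a) * norm u + norm (lorentz h b) * norm w"
      by (rule order_trans[OF norm_triangle_ineq]) simp
    also have "\<dots> \<le> (norm h * norm a * K) * norm u + (norm h * norm b * K) * norm w"
      by (intro add_mono mult_right_mono K) auto
    finally show ?thesis by (simp add: algebra_simps)
  qed
  have bd: "norm (deriv_along q v H2) \<le> (K * K * g q) * norm (H2 q) * norm v"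
    if q: "q \<in> W" and v: "v \<in> tangent_space q" for q v
  proof -
    have "norm (deriv_along q v H2) \<le> norm (lorentz v (e1 q)) * norm (d1 H2 q) + norm (lorentz v (e2 q)) * norm (d2 H2 q)"
      unfolding deriv_along_frame[OF q v smooth_H2] by (rule order_trans[OF norm_triangle_ineq]) simp
    also have "\<dots> \<le> (norm v * norm (e1 q) * K) * (K * norm (H2 q) * (norm (h11 q) * norm (e1 q) + norm (h12 q) * norm (e2 q)))
        + (norm v * norm (e2 q) * K) * (K * norm (H2 q) * (norm (h12 q) * norm (e1 q) + norm (h22 q) * norm (e2 q)))"
      unfolding parallel_deriv_H2[OF par q] by (intro add_mono mult_mono K d) (auto simp: K(1))
    finally show ?thesis by (simp add: g_def algebra_simps)
  qed
  have cont: "continuous_on (snd c ` (fst c \<inter> W)) (chart_rep c (\<lambda>q. K * K * g q))" if c: "c \<in> A" for c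
  proof -
    have "continuous_on (snd c ` (fst c \<inter> W)) (chart_rep c f)" if "smooth_map W f" for f :: "'a \<Rightarrow> real^4"
      by (rule smooth_on_continuous_on[OF smooth_mapD[OF that c]])
    note co = this[OF e_smooth(1)] this[OF e_smooth(2)] this[OF smooth_h(1)] this[OF smooth_h(2)] this[OF smooth_h(3)]
    have "chart_rep c (\<lambda>q. K * K * g q) = (\<lambda>u. K * K * (norm (chart_rep c e1 u) * (norm (chart_rep c h11 u) * norm (chart_rep c e1 u) + norm (chart_rep c h12 u) * norm (chart_rep c e2 u)) +
      norm (chart_rep c e2 u) * (norm (chart_rep c h12 u) * norm (chart_rep c e1 u) + norm (chart_rep c h22 u) * norm (chart_rep c e2 u))))"
      by (simp add: chart_rep_def o_def g_def)
    then show ?thesis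
      by (simp only:) (intro continuous_on_mult continuous_on_add continuous_on_norm continuous_on_const co)
  qed
  show thesis
    by (rule locally_vanishing[OF W p smooth_H2 H cont bd _ that]) (use K(1) in \<open>auto simp: g_def\<close>)
qed

end

section \<open>From local frames to the connected surface\<close>

context spacelike_surface
begin

lemma exists_frame:
  assumes "p \<in> topspace X"
  obtains W e1 e2 where "p \<in> W" "framed_surface X A x W e1 e2"
proof -
  obtain W e1 e2 where W: "p \<in> W" "positive_frame W e1 e2" using exists_positive_frame[OF assms] by blast
  have "framed_surface X A x W e1 e2"
    using W(2) by unfold_locales (simp add: positive_frame_def)
  then show thesis using that W(1) by blast
qed

text \<open>The chosen value comes from some frame; extracting that frame and computing in it
  replaces a proof that the value is independent of the frame.\<close>

lemma laplacian_frame: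
  assumes p: "p \<in> topspace X"
  obtains W e1 e2 where "p \<in> W" "framed_surface X A x W e1 e2"
    "laplacian f p = framed_surface.frame_laplacian A x e1 e2 f p"
proof -
  let ?P = "\<lambda>L. \<exists>W e1 e2. p \<in> W \<and> tangent_frame W e1 e2 \<and>
     L = (deriv_along p (nabla e1 e1 p) f - deriv_along p (e1 p) (\<lambda>q. deriv_along q (e1 q) f)) +
         (deriv_along p (nabla e2 e2 p) f - deriv_along p (e2 p) (\<lambda>q. deriv_along q (e2 q) f))"
  obtain W0 f1 f2 where 0: "p \<in> W0" "framed_surface X A x W0 f1 f2" using exists_frame[OF p] by blast
  then have "tangent_frame W0 f1 f2" by (simp add: framed_surface.frame)
  then have "\<exists>L. ?P L" using 0(1) by blast
  then have "?P (laplacian f p)" unfolding laplacian_def by (rule someI_ex)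
  then obtain W e1 e2 where W: "p \<in> W" "tangent_frame W e1 e2" and
    L: "laplacian f p = (deriv_along p (nabla e1 e1 p) f - deriv_along p (e1 p) (\<lambda>q. deriv_along q (e1 q) f)) +
         (deriv_along p (nabla e2 e2 p) f - deriv_along p (e2 p) (\<lambda>q. deriv_along q (e2 q) f))"
    by blast
  interpret F: framed_surface X A x W e1 e2 by unfold_locales (rule W)
  show thesis
    by (rule that[OF W(1) F.framed_surface_axioms]) (simp add: L F.frame_laplacian_def)
qed

text \<open>The pointwise form of the classical formula for \<open>\<Delta>\<nu>\<close>: the eigenvalue is the squared norm
  of the second fundamental form, rewritten by the Gauss equation, and the remaining components are
  the normal curvature and \<open>DH\<close>.\<close>

lemma laplacian_gauss_map_iff:
  assumes p: "p \<in> topspace X"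
  obtains W e1 e2 where "p \<in> W" "framed_surface X A x W e1 e2"
    "\<And>k. laplacian gauss_map p = k *\<^sub>R gauss_map p \<longleftrightarrow>
      4 * lorentz (mean_curvature_vector p) (mean_curvature_vector p) - 2 * gaussian_curvature p = k \<and>
      wedge (framed_surface.h11 A x e1 e2 p - framed_surface.h22 A x e1 e2 p) (framed_surface.h12 A x e1 e2 p) = 0 \<and>
      (\<forall>v\<in>tangent_space p. normal_conn p v mean_curvature_vector = 0)"
proof -
  obtain W e1 e2 where W: "p \<in> W" "framed_surface X A x W e1 e2"
    and L: "laplacian gauss_map p = framed_surface.frame_laplacian A x e1 e2 gauss_map p"
    using laplacian_frame[OF p] by blast
  interpret F: framed_surface X A x W e1 e2 by (rule W(2))
  show thesis
    by (rule that[OF W])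
      (unfold L F.laplacian_gauss_map[OF W(1)] F.laplacian_eigen_iff[OF W(1)] F.h_norm2_eq[OF W(1)]
        F.parallel_frame[OF W(1)], blast)
qed

lemma parallel_norm_constant:
  assumes "connected_space X" and par: parallel_mean_curvature and "p \<in> topspace X" "q \<in> topspace X"
  shows "lorentz (mean_curvature_vector p) (mean_curvature_vector p) =
    lorentz (mean_curvature_vector q) (mean_curvature_vector q)"
proof (rule connected_constant[OF assms(1) _ assms(3,4)])
  fix r assume "r \<in> topspace X"
  then obtain W e1 e2 where W: "r \<in> W" "framed_surface X A x W e1 e2" using exists_frame by blast
  show "\<exists>V. openin X V \<and> r \<in> V \<and> (\<forall>q\<in>V. lorentz (mean_curvature_vector q) (mean_curvature_vector q) =
      lorentz (mean_curvature_vector r) (mean_curvature_vector r))"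
    by (rule framed_surface.parallel_norm_locally_constant[OF W(2) par W(1)])
qed

text \<open>The zeros of \<open>H\<close> form an open set by uniqueness, the other points by
  continuity; connectedness leaves one alternative, and \<open>nm\<close> rules out that
  \<open>H\<close> is zero everywhere.\<close>

lemma parallel_nonvanishing:
  assumes conn: "connected_space X" and par: parallel_mean_curvature and nm: "\<not> maximal"
    and p: "p \<in> topspace X"
  shows "mean_curvature_vector p \<noteq> 0"
proof -
  obtain p0 where p0: "p0 \<in> topspace X" "mean_curvature_vector p0 \<noteq> 0"
    using nm by (auto simp: maximal_def)
  have "(mean_curvature_vector p = 0) = (mean_curvature_vector p0 = 0)"
  proof (rule connected_constant[OF conn _ p p0(1)])
    fix r assume r: "r \<in> topspace X"
    obtain W e1 e2 where W: "r \<in> W" "framed_surface X A x W e1 e2" using exists_frame[OF r] by blast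
    interpret F: framed_surface X A x W e1 e2 by (rule W(2))
    have H: "mean_curvature_vector q = 0 \<longleftrightarrow> F.H2 q = 0" if "q \<in> W" for q
      using F.H2_eq[OF that] by simp
    show "\<exists>V. openin X V \<and> r \<in> V \<and> (\<forall>q\<in>V. (mean_curvature_vector q = 0) = (mean_curvature_vector r = 0))"
    proof (cases "F.H2 r = 0")
      case True
      obtain V where V: "openin X V" "r \<in> V" "V \<subseteq> W" "\<And>q. q \<in> V \<Longrightarrow> F.H2 q = 0"
        using F.parallel_locally_vanishing[OF par W(1) True] by blast
      have "(mean_curvature_vector q = 0) = (mean_curvature_vector r = 0)" if "q \<in> V" for q
        using H[of q] H[OF W(1)] V(3) V(4)[OF that] that True by auto
      then show ?thesis using V(1,2) by blast
    next
      case False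
      obtain V where V: "openin X V" "r \<in> V" "V \<subseteq> W" "\<And>q. q \<in> V \<Longrightarrow> F.H2 q \<in> - {0}"
        by (rule smooth_map_neighbourhood[where B = "- {0}", OF F.W F.smooth_H2 _ W(1)]) (use False in auto)
      have "(mean_curvature_vector q = 0) = (mean_curvature_vector r = 0)" if "q \<in> V" for q
        using H[of q] H[OF W(1)] V(3) V(4)[OF that] that False by auto
      then show ?thesis using V(1,2) by blast
    qed
  qed
  then show ?thesis using p0(2) by simp
qed

lemma one_type_gauss_map_iff:
  assumes conn: "connected_space X" and nm: "\<not> maximal"
  shows "one_type_gauss_map_first_kind \<longleftrightarrow> parallel_mean_curvature \<and> constant_gaussian_curvature"
proof
  \<comment> \<open>A reference point exists because a surface without points would be
    maximal.\<close>
  obtain p0 where p0: "p0 \<in> topspace X" using nm by (auto simp: maximal_def)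
  let ?H = "\<lambda>p. lorentz (mean_curvature_vector p) (mean_curvature_vector p)"
  {
    assume one_type_gauss_map_first_kind
    then obtain k where k: "\<And>p. p \<in> topspace X \<Longrightarrow> laplacian gauss_map p = k *\<^sub>R gauss_map p"
      unfolding one_type_gauss_map_first_kind_def by blast
    have *: "4 * ?H p - 2 * gaussian_curvature p = k \<and>
        (\<forall>v\<in>tangent_space p. normal_conn p v mean_curvature_vector = 0)" if p: "p \<in> topspace X" for p
      by (rule laplacian_gauss_map_iff[OF p]) (use k[OF p] in blast)
    then have par: parallel_mean_curvature unfolding parallel_mean_curvature_def by blast
    have "gaussian_curvature p = (4 * ?H p0 - k) / 2" if p: "p \<in> topspace X" for p
      using *[OF p] parallel_norm_constant[OF conn par p p0] by (simp add: field_simps)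
    then show "parallel_mean_curvature \<and> constant_gaussian_curvature"
      using par unfolding constant_gaussian_curvature_def by blast
  }
  {
    assume a: "parallel_mean_curvature \<and> constant_gaussian_curvature"
    then have par: parallel_mean_curvature by blast
    obtain K where K: "\<And>p. p \<in> topspace X \<Longrightarrow> gaussian_curvature p = K"
      using a unfolding constant_gaussian_curvature_def by blast
    \<comment> \<open>The eigenvalue is the pointwise expression of
      \<open>laplacian_gauss_map_iff\<close>, evaluated at the reference point \<open>p0\<close>
      since \<open>?H\<close> and \<open>gaussian_curvature\<close> are constant.\<close>
    have "laplacian gauss_map p = (4 * ?H p0 - 2 * K) *\<^sub>R gauss_map p" if p: "p \<in> topspace X" for p
    proof (rule laplacian_gauss_map_iff[OF p])
      fix W e1 e2
      assume W: "p \<in> W" "framed_surface X A x W e1 e2"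
        and iff: "\<And>k. laplacian gauss_map p = k *\<^sub>R gauss_map p \<longleftrightarrow>
          4 * ?H p - 2 * gaussian_curvature p = k \<and>
          wedge (framed_surface.h11 A x e1 e2 p - framed_surface.h22 A x e1 e2 p) (framed_surface.h12 A x e1 e2 p) = 0 \<and>
          (\<forall>v\<in>tangent_space p. normal_conn p v mean_curvature_vector = 0)"
      interpret F: framed_surface X A x W e1 e2 by (rule W(2))
      have "F.H2 p \<noteq> 0"
        using parallel_nonvanishing[OF conn par nm p] F.H2_eq[OF W(1)] by simp
      then have "wedge (F.h11 p - F.h22 p) (F.h12 p) = 0"
        by (rule F.parallel_flat_normal_bundle[OF par W(1)])
      then show ?thesis
        unfolding iff using K[OF p] parallel_norm_constant[OF conn par p p0] par p
        by (simp add: parallel_mean_curvature_def)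
    qed
    then show one_type_gauss_map_first_kind unfolding one_type_gauss_map_first_kind_def by blast
  }
qed

end


theorem theorem4p8:
  fixes X :: "'a topology" and A :: "'a chart set" and x :: "'a \<Rightarrow> real^4"
  assumes "spacelike_surface X A x"
    and "connected_space X"
    and "\<not> spacelike_surface.maximal X A x"
  shows "spacelike_surface.one_type_gauss_map_first_kind X A x \<longleftrightarrow>
           spacelike_surface.parallel_mean_curvature X A x \<and>
           spacelike_surface.constant_gaussian_curvature X A x"
  by (rule spacelike_surface.one_type_gauss_map_iff[OF assms])

end
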